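(* The following classes of groups coincide: (1) finitely generated deterministic-context-sensitive-graph automatic groups with quasigeodesic normal form, i.e. groups $G$ for which there are a finite symmetric generating set $X$ and a finite set of symbols $\Lambda$ such that $(G,X,\Lambda)$ is $\mathcal{DCS}$-graph automatic with a quasigeodesic normal form; (2) finitely generated $\mathcal{DCS}$-biautomatic groups with Shortlex geodesic normal form, i.e. groups $G$ for which there is a finite symmetric generating set $X$ such that $(G,X)$ is $\mathcal{DCS}$-biautomatic with normal form the set of Shortlex geodesics over $X$ (for some total order on $X$); (3) finitely generated groups with $\mathcal{DCS}$ word problem.
   Context: A linear bounded automaton is a Turing machine together with a constant $E$ such that on input a word of length $n$ the number of tape squares that can be used is at most $En$. A language is deterministic context-sensitive ($\mathcal{DCS}$) if it is the set of strings accepted by a deterministic linear bounded automaton (the empty string is allowed in the language). A finitely generated group $G$ with finite symmetric (closed under inverses) generating set $X$ has $\mathcal{DCS}$ word problem if the set of words in $X^*$ representing the identity of $G$ is $\mathcal{DCS}$. A normal form for $(G,X,\Lambda)$ is a set $L\subseteq\Lambda^*$ in bijection with $G$; the image of $u\in L$ is denoted $\overline u$. It is quasigeodesic if there is a constant $D$ with $|u|_\Lambda\le D(\|u\|_X+1)$ for all $u\in L$, where $|u|_\Lambda$ is the number of letters of $u$ and $\|u\|_X$ is the length of a shortest word in $X^*$ representing $\overline u$. Convolution: let $\diamond\notin\Lambda$ and $\Lambda_\diamond=\Lambda\cup\{\diamond\}$. For $u,v\in\Lambda^*$, $\otimes(u,v)$ is the word of length $\max(|u|_\Lambda,|v|_\Lambda)$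 over $(\Lambda_\diamond)^2$ whose $i$th letter has first component the $i$th letter of $u$ if $i\le|u|_\Lambda$ and $\diamond$ otherwise, and second component the $i$th letter of $v$ if $i\le|v|_\Lambda$ and $\diamond$ otherwise. For a class $\mathcal C$ of languages, $(G,X,\Lambda)$ is $\mathcal C$-graph automatic if there is a normal form $L\subseteq\Lambda^*$ in $\mathcal C$ such that for each $x\in X$ the language $\{\otimes(u,v)\mid u,v\in L,\ \overline v=_G\overline u x\}$ is in $\mathcal C$. $(G,X)$ is $\mathcal C$-biautomatic if (with $\Lambda=X$) there is a normal form $L\subseteq X^*$ in $\mathcal C$ such that for each $x\in X$ both $\{\otimes(u,v)\mid u,v\in L,\ \overline v=_G\overline u x\}$ and $\{\otimes(u,v)\mid u,v\in L,\ \overline v=_G x\overline u\}$ are in $\mathcal C$. Shortlex order on $X^*$ for a totally ordered finite set $X$: $u<v$ if $|u|<|v|$, or $|u|=|v|$ and $u=p x_i u'$, $v=p x_j v'$ with $x_i<x_j$ in $X$, $p,u',v'\in X^*$. The Shortlex geodesic of a group element is the Shortlex-least word in $X^*$ representing it. *)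

theory Defs
  imports "HOL-Algebra.Generated_Groups"
begin

section \<open>Deterministic linear bounded automata\<close>

text \<open>
  Work symbols and states are natural numbers; since both the tape alphabet and the state set of a
  machine are finite, this is no restriction.
\<close>

datatype 'a tape_symbol = Blank | Input 'a | Work nat

datatype head_move = Move_Left | Stay | Move_Right

fun offset :: "head_move \<Rightarrow> int" where
  "offset Move_Left = -1"
| "offset Stay = 0"
| "offset Move_Right = 1"

record 'a dtm =
  states :: "nat set"
  tape_alphabet :: "'a tape_symbol set"
  start_state :: nat
  accept_states :: "nat set"
  delta :: "nat \<Rightarrow> 'a tape_symbol \<Rightarrow> (nat \<times> 'a tape_symbol \<times> head_move) option"

definition wf_dtm :: "'a set \<Rightarrow> 'a dtm \<Rightarrow> bool" where
  "wf_dtm \<Sigma> M \<longleftrightarrow>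
     finite (states M) \<and> finite (tape_alphabet M) \<and>
     insert Blank (Input ` \<Sigma>) \<subseteq> tape_alphabet M \<and>
     start_state M \<in> states M \<and> accept_states M \<subseteq> states M \<and>
     (\<forall>q\<in>states M. \<forall>s\<in>tape_alphabet M. \<forall>q' s' d.
        delta M q s = Some (q', s', d) \<longrightarrow> q' \<in> states M \<and> s' \<in> tape_alphabet M)"

text \<open>A configuration consists of the state, the two-way infinite tape and the head position.\<close>

type_synonym 'a config = "nat \<times> (int \<Rightarrow> 'a tape_symbol) \<times> int"

fun step :: "'a dtm \<Rightarrow> 'a config \<Rightarrow> 'a config option" where
  "step M (q, t, h) =
     (case delta M q (t h) of
        None \<Rightarrow> None
      | Some (q', s', d) \<Rightarrow> Some (q', t(h := s'), h + offset d))"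

definition init_config :: "'a dtm \<Rightarrow> 'a list \<Rightarrow> 'a config" where
  "init_config M w =
     (start_state M, \<lambda>i. if 0 \<le> i \<and> i < int (length w) then Input (w ! nat i) else Blank, 0)"

definition reachable :: "'a dtm \<Rightarrow> 'a list \<Rightarrow> 'a config set" where
  "reachable M w = {c. (init_config M w, c) \<in> {(c, c'). step M c = Some c'}\<^sup>*}"

definition accepts :: "'a dtm \<Rightarrow> 'a list \<Rightarrow> bool" where
  "accepts M w \<longleftrightarrow> (\<exists>(q, t, h) \<in> reachable M w. q \<in> accept_states M)"

definition squares_used :: "'a dtm \<Rightarrow> 'a list \<Rightarrow> int set" where
  "squares_used M w = {h. \<exists>q t. (q, t, h) \<in> reachable M w}"

text \<open>
  At most \<open>E * n\<close> squares may be used on inputs of length \<open>n\<close>. The maximum with \<open>1\<close> only allows for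
  the square under the head at the start, so that the empty word can be accepted or rejected.
\<close>

definition linear_bounded :: "'a set \<Rightarrow> 'a dtm \<Rightarrow> nat \<Rightarrow> bool" where
  "linear_bounded \<Sigma> M E \<longleftrightarrow>
     (\<forall>w\<in>lists \<Sigma>. finite (squares_used M w) \<and> card (squares_used M w) \<le> max 1 (E * length w))"

definition dcs :: "'a set \<Rightarrow> 'a list set \<Rightarrow> bool" where
  "dcs \<Sigma> L \<longleftrightarrow>
     finite \<Sigma> \<and>
     (\<exists>M E. wf_dtm \<Sigma> M \<and> linear_bounded \<Sigma> M E \<and> L = {w \<in> lists \<Sigma>. accepts M w})"


section \<open>Words in a generating set\<close>

definition sym_generating_set :: "('g, 'm) monoid_scheme \<Rightarrow> 'g set \<Rightarrow> bool" where
  "sym_generating_set G X \<longleftrightarrow>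
     finite X \<and> X \<subseteq> carrier G \<and> (\<forall>x\<in>X. inv\<^bsub>G\<^esub> x \<in> X) \<and> generate G X = carrier G"

definition word_val :: "('g, 'm) monoid_scheme \<Rightarrow> 'g list \<Rightarrow> 'g" where
  "word_val G w = foldr (\<lambda>x y. x \<otimes>\<^bsub>G\<^esub> y) w \<one>\<^bsub>G\<^esub>"

definition word_norm :: "('g, 'm) monoid_scheme \<Rightarrow> 'g set \<Rightarrow> 'g \<Rightarrow> nat" where
  "word_norm G X g = (LEAST n. \<exists>w\<in>lists X. length w = n \<and> word_val G w = g)"

definition dcs_word_problem :: "('g, 'm) monoid_scheme \<Rightarrow> 'g set \<Rightarrow> bool" where
  "dcs_word_problem G X \<longleftrightarrow>
     sym_generating_set G X \<and> dcs X {w \<in> lists X. word_val G w = \<one>\<^bsub>G\<^esub>}"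

text \<open>
  For a strict order \<open>r\<close>, \<^const>\<open>lenlex\<close> is exactly the Shortlex order: it compares lengths first and
  words of equal length at the first position where they differ.
\<close>

definition shortlex_geodesics ::
  "('g, 'm) monoid_scheme \<Rightarrow> 'g set \<Rightarrow> ('g \<times> 'g) set \<Rightarrow> 'g list set" where
  "shortlex_geodesics G X r =
     {u \<in> lists X. \<forall>v\<in>lists X. word_val G v = word_val G u \<and> v \<noteq> u \<longrightarrow> (u, v) \<in> lenlex r}"


section \<open>Normal forms, graph automatic and biautomatic groups\<close>

text \<open>
  A normal form is given by the language \<open>L\<close> together with the bijection \<open>\<nu>\<close> sending a word \<open>u\<close> to
  the group element it denotes.
\<close>

definition normal_form ::
  "('g, 'm) monoid_scheme \<Rightarrow> 'b set \<Rightarrow> 'b list set \<Rightarrow> ('b list \<Rightarrow> 'g) \<Rightarrow> bool" where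
  "normal_form G \<Lambda> L \<nu> \<longleftrightarrow> L \<subseteq> lists \<Lambda> \<and> bij_betw \<nu> L (carrier G)"

definition quasigeodesic ::
  "('g, 'm) monoid_scheme \<Rightarrow> 'g set \<Rightarrow> 'b list set \<Rightarrow> ('b list \<Rightarrow> 'g) \<Rightarrow> bool" where
  "quasigeodesic G X L \<nu> \<longleftrightarrow> (\<exists>D. \<forall>u\<in>L. length u \<le> D * (word_norm G X (\<nu> u) + 1))"

text \<open>The padding symbol is \<^const>\<open>None\<close>.\<close>

definition conv :: "'b list \<Rightarrow> 'b list \<Rightarrow> ('b option \<times> 'b option) list" where
  "conv u v =
     map (\<lambda>i. (if i < length u then Some (u ! i) else None,
               if i < length v then Some (v ! i) else None))
       [0..<max (length u) (length v)]"

definition conv_alphabet :: "'b set \<Rightarrow> ('b option \<times> 'b option) set" where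
  "conv_alphabet \<Lambda> = insert None (Some ` \<Lambda>) \<times> insert None (Some ` \<Lambda>)"

definition right_mult_lang ::
  "('g, 'm) monoid_scheme \<Rightarrow> 'b list set \<Rightarrow> ('b list \<Rightarrow> 'g) \<Rightarrow> 'g \<Rightarrow> ('b option \<times> 'b option) list set"
  where
  "right_mult_lang G L \<nu> x = {conv u v | u v. u \<in> L \<and> v \<in> L \<and> \<nu> v = \<nu> u \<otimes>\<^bsub>G\<^esub> x}"

definition left_mult_lang ::
  "('g, 'm) monoid_scheme \<Rightarrow> 'b list set \<Rightarrow> ('b list \<Rightarrow> 'g) \<Rightarrow> 'g \<Rightarrow> ('b option \<times> 'b option) list set"
  where
  "left_mult_lang G L \<nu> x = {conv u v | u v. u \<in> L \<and> v \<in> L \<and> \<nu> v = x \<otimes>\<^bsub>G\<^esub> \<nu> u}"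

definition dcs_graph_automatic ::
  "('g, 'm) monoid_scheme \<Rightarrow> 'g set \<Rightarrow> 'b set \<Rightarrow> 'b list set \<Rightarrow> ('b list \<Rightarrow> 'g) \<Rightarrow> bool" where
  "dcs_graph_automatic G X \<Lambda> L \<nu> \<longleftrightarrow>
     sym_generating_set G X \<and> finite \<Lambda> \<and> normal_form G \<Lambda> L \<nu> \<and> dcs \<Lambda> L \<and>
     (\<forall>x\<in>X. dcs (conv_alphabet \<Lambda>) (right_mult_lang G L \<nu> x))"

definition dcs_biautomatic ::
  "('g, 'm) monoid_scheme \<Rightarrow> 'g set \<Rightarrow> 'g list set \<Rightarrow> ('g list \<Rightarrow> 'g) \<Rightarrow> bool" where
  "dcs_biautomatic G X L \<nu> \<longleftrightarrow>
     sym_generating_set G X \<and> normal_form G X L \<nu> \<and> dcs X L \<and>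
     (\<forall>x\<in>X. dcs (conv_alphabet X) (right_mult_lang G L \<nu> x) \<and>
             dcs (conv_alphabet X) (left_mult_lang G L \<nu> x))"


section \<open>The three classes of groups\<close>

text \<open>Every finite set of symbols can be renamed to a finite set of natural numbers.\<close>

definition quasigeodesic_dcs_graph_automatic_group :: "('g, 'm) monoid_scheme \<Rightarrow> bool" where
  "quasigeodesic_dcs_graph_automatic_group G \<longleftrightarrow>
     (\<exists>X (\<Lambda> :: nat set) L \<nu>. dcs_graph_automatic G X \<Lambda> L \<nu> \<and> quasigeodesic G X L \<nu>)"

definition shortlex_dcs_biautomatic_group :: "('g, 'm) monoid_scheme \<Rightarrow> bool" where
  "shortlex_dcs_biautomatic_group G \<longleftrightarrow>
     (\<exists>X r. r \<subseteq> X \<times> X \<and> strict_linear_order_on X r \<and>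
            dcs_biautomatic G X (shortlex_geodesics G X r) (word_val G))"

definition dcs_word_problem_group :: "('g, 'm) monoid_scheme \<Rightarrow> bool" where
  "dcs_word_problem_group G \<longleftrightarrow> (\<exists>X. dcs_word_problem G X)"

end

theory Submission
  imports Defs "HOL-Library.Nat_Bijection"
begin

text \<open>
  Each of the three properties gives the next one in a circle.

  A Shortlex biautomatic structure is graph automatic after renaming letters, and quasigeodesic
  because a Shortlex geodesic is as short as any word for its element.

  Given a quasigeodesic graph automatic structure and a word \<open>x\<^sub>1 \<dots> x\<^sub>n\<close>, the normal forms \<open>u\<^sub>i\<close> of the
  prefixes \<open>x\<^sub>1 \<dots> x\<^sub>i\<close> have length at most \<open>D (n + 1)\<close>, so one of them fits into linear space at a time. The
  word \<open>u\<^sub>i\<close> is the only \<open>v\<close> whose convolution with \<open>u\<^sub>i\<^sub>-\<^sub>1\<close> lies in the language of \<open>x\<^sub>i\<close>; it is found by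
  running through all candidates. The word represents the identity iff \<open>u\<^sub>n = u\<^sub>0\<close>.

  Given the word problem, a word \<open>u\<close> fails to be a Shortlex geodesic iff some \<open>v\<close> below \<open>u\<close> in the
  Shortlex order satisfies \<open>u v\<inverse> = 1\<close>, and again all candidates \<open>v\<close> can be tried in linear space. The
  relations \<open>v = u x\<close> and \<open>v = x u\<close> are the instances \<open>x v\<inverse> u = 1\<close> and \<open>x u v\<inverse> = 1\<close> of the word problem.

  What remains is to see that these searches, which call given automata as subroutines, are performed
  by linear bounded automata. The computations are described as iterated maps on words of a fixed
  length over a finite alphabet, where the new letter at a position depends on the old letter and on
  finitely much information about the words to its left and right (\<open>dcs_if_system\<close>): one pass of the
  head to the right and one back compute such a map. In \<open>dcs_if_oracle_system\<close> the map may also depend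
  on whether some word read off the cells belongs to a given deterministic context-sensitive language.
  The automaton of that language is simulated inside the cells, which hold several tracks of its tape.
  As it may run forever on a word it rejects, a counter with one digit per cell stops it once
  as many configurations have been seen as there are possible contents of the cells. Complements,
  intersections and exhaustive search (\<open>dcs_Compl\<close>, \<open>dcs_Int\<close>, \<open>dcs_if_search\<close>) are systems of this
  kind. Words that do not fill the cells are stored with gaps, and \<open>dcs_erase\<close> lets an automaton
  ignore gaps.
\<close>

section \<open>Machines over arbitrary finite sets\<close>

fun mstep :: "('s \<Rightarrow> 'y \<Rightarrow> ('s \<times> 'y \<times> head_move) option) \<Rightarrow>
    's \<times> (int \<Rightarrow> 'y) \<times> int \<Rightarrow> ('s \<times> (int \<Rightarrow> 'y) \<times> int) option" where
  "mstep \<delta> (q, t, h) =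
     (case \<delta> q (t h) of
        None \<Rightarrow> None
      | Some (q', s', d) \<Rightarrow> Some (q', t(h := s'), h + offset d))"

definition tape :: "'y \<Rightarrow> 'y list \<Rightarrow> int \<Rightarrow> 'y" where
  "tape b xs = (\<lambda>i. if 0 \<le> i \<and> i < int (length xs) then xs ! nat i else b)"

abbreviation msteps where
  "msteps \<delta> \<equiv> {(c, c'). mstep \<delta> c = Some c'}\<^sup>*"

lemma reachable_init: "init_config M w \<in> reachable M w"
  by (simp add: reachable_def)

lemma reachable_step: "\<lbrakk>c \<in> reachable M w; step M c = Some d\<rbrakk> \<Longrightarrow> d \<in> reachable M w"
  by (auto simp: reachable_def intro: rtrancl_into_rtrancl)

lemma reachable_induct [consumes 1, case_names init step]:
  assumes "c \<in> reachable M w" and "P (init_config M w)"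
    and "\<And>c d. \<lbrakk>c \<in> reachable M w; P c; step M c = Some d\<rbrakk> \<Longrightarrow> P d"
  shows "P c"
proof -
  have "(init_config M w, c) \<in> {(c, c'). step M c = Some c'}\<^sup>*"
    using assms(1) by (simp add: reachable_def)
  then show ?thesis
  proof (induction rule: rtrancl_induct)
    case (step c d)
    then show ?case using assms(3)[of c d] by (simp add: reachable_def)
  qed (rule assms(2))
qed

lemma msteps_step: "\<lbrakk>(c, d) \<in> msteps \<delta>; mstep \<delta> d = Some e\<rbrakk> \<Longrightarrow> (c, e) \<in> msteps \<delta>"
  by (auto intro: rtrancl_into_rtrancl)

text \<open>
  The states and symbols of a machine can be coded by natural numbers. The machine constructed here
  always writes work symbols, even for \<open>b\<close>; blanks and input letters are only read, and are decoded to
  \<open>b\<close> and \<open>inp\<close>.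
\<close>

lemma dcs_if_machine:
  fixes \<delta> :: "'s \<Rightarrow> 'y \<Rightarrow> ('s \<times> 'y \<times> head_move) option" and inp :: "'a \<Rightarrow> 'y"
  assumes fin: "finite \<Sigma>" "finite Q" "finite Y"
    and q0: "q0 \<in> Q" and b: "b \<in> Y" and inp: "inp ` \<Sigma> \<subseteq> Y"
    and closed: "\<And>q s q' s' d. \<lbrakk>q \<in> Q; s \<in> Y; \<delta> q s = Some (q', s', d)\<rbrakk> \<Longrightarrow> q' \<in> Q \<and> s' \<in> Y"
    and L: "L \<subseteq> lists \<Sigma>"
    and acc: "\<And>w. w \<in> lists \<Sigma> \<Longrightarrow>
      w \<in> L \<longleftrightarrow> (\<exists>q t h. ((q0, tape b (map inp w), 0), (q, t, h)) \<in> msteps \<delta> \<and> q \<in> Acc)"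
    and bound: "\<And>w. w \<in> lists \<Sigma> \<Longrightarrow> \<exists>S. finite S \<and> card S \<le> max 1 (E * length w) \<and>
      (\<forall>q t h. ((q0, tape b (map inp w), 0), (q, t, h)) \<in> msteps \<delta> \<longrightarrow> h \<in> S)"
  shows "dcs \<Sigma> L"
proof -
  obtain e :: "'s \<Rightarrow> nat" where e: "inj_on e Q"
    using finite_imp_inj_to_nat_seg[OF fin(2)] by blast
  obtain k :: "'y \<Rightarrow> nat" where k: "inj_on k Y"
    using finite_imp_inj_to_nat_seg[OF fin(3)] by blast
  define sym where "sym x = (case x of Blank \<Rightarrow> b | Input a \<Rightarrow> inp a | Work i \<Rightarrow> the_inv_into Y k i)"
    for x :: "'a tape_symbol"
  define dlt where "dlt i x = (case \<delta> (the_inv_into Q e i) (sym x) of None \<Rightarrow> None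
     | Some (q', s', d) \<Rightarrow> Some (e q', Work (k s') :: 'a tape_symbol, d))" for i x
  define M where "M = \<lparr>states = e ` Q,
     tape_alphabet = insert Blank (Input ` \<Sigma>) \<union> (\<lambda>y. Work (k y)) ` Y, start_state = e q0,
     accept_states = e ` (Acc \<inter> Q), delta = dlt\<rparr>"
  have sym_Y: "sym x \<in> Y" if "x \<in> tape_alphabet M" for x
    using that b inp k by (auto simp: M_def sym_def the_inv_into_f_f)
  have symk [simp]: "sym (Work (k y)) = y" if "y \<in> Y" for y
    using that k by (auto simp: sym_def the_inv_into_f_f)
  have inve [simp]: "the_inv_into Q e (e q) = q" if "q \<in> Q" for q
    using that e by (auto simp: the_inv_into_f_f)
  have wf: "wf_dtm \<Sigma> M"
    unfolding wf_dtm_def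
  proof (intro conjI ballI allI impI)
    fix q s q' s' d
    assume a: "q \<in> states M" "s \<in> tape_alphabet M" "delta M q s = Some (q', s', d)"
    then obtain p where p: "q = e p" "p \<in> Q" by (auto simp: M_def)
    from a(3) p obtain r u where "\<delta> p (sym s) = Some (r, u, d)" "q' = e r" "s' = Work (k u)"
      by (auto simp: M_def dlt_def split: option.splits prod.splits)
    with closed[OF p(2) sym_Y[OF a(2)]] show "q' \<in> states M" "s' \<in> tape_alphabet M"
      by (auto simp: M_def)
  qed (use fin q0 in \<open>auto simp: M_def\<close>)
  define rel where "rel c c' = (case c of (q, t, h) \<Rightarrow> case c' of (q', t', h') \<Rightarrow>
     q \<in> Q \<and> q' = e q \<and> h' = h \<and> range t' \<subseteq> tape_alphabet M \<and> t = sym \<circ> t')"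
    for c :: "'s \<times> (int \<Rightarrow> 'y) \<times> int" and c' :: "'a config"
  have rel_step: "(case mstep \<delta> c of None \<Rightarrow> step M c' = None
      | Some d \<Rightarrow> \<exists>d'. step M c' = Some d' \<and> rel d d')" if "rel c c'" for c c'
  proof -
    obtain q t h q' t' h' where c: "c = (q, t, h)" "c' = (q', t', h')" by (metis prod_cases3)
    have r: "q \<in> Q" "q' = e q" "h' = h" "range t' \<subseteq> tape_alphabet M" "t = sym \<circ> t'"
      using that by (auto simp: rel_def c)
    show ?thesis
    proof (cases "\<delta> q (t h)")
      case None then show ?thesis using r by (simp add: c M_def dlt_def)
    next
      case (Some v)
      obtain r1 u d where v: "v = (r1, u, d)" by (metis prod_cases3)
      have cl: "r1 \<in> Q" "u \<in> Y" 
        using closed[OF r(1) _ Some[unfolded v]] sym_Y r by auto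
      have "range (t'(h := Work (k u))) \<subseteq> tape_alphabet M"
        using r(4) cl by (auto simp: M_def)
      moreover have "t(h := u) = sym \<circ> t'(h := Work (k u))"
        using r(5) cl by (auto simp: fun_eq_iff)
      ultimately show ?thesis using Some r cl by (simp add: c v M_def dlt_def rel_def)
    qed
  qed
  have rel_init: "rel (q0, tape b (map inp w), 0) (init_config M w)" if "w \<in> lists \<Sigma>" for w
    using that q0 by (auto simp: rel_def init_config_def tape_def M_def sym_def fun_eq_iff
        in_lists_conv_set)
  have to: "\<exists>c'. c' \<in> reachable M w \<and> rel c c'"
    if "w \<in> lists \<Sigma>" "((q0, tape b (map inp w), 0), c) \<in> msteps \<delta>" for w c
    using that(2)
  proof (induction rule: rtrancl_induct)
    case base then show ?case using rel_init[OF that(1)] reachable_init by blast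
  next
    case (step c d)
    then obtain c' where c': "c' \<in> reachable M w" "rel c c'" by blast
    with rel_step[OF c'(2)] step(2) obtain d' where "step M c' = Some d'" "rel d d'" by auto
    with c' reachable_step show ?case by blast
  qed
  have conv: "\<exists>c. ((q0, tape b (map inp w), 0), c) \<in> msteps \<delta> \<and> rel c c'"
    if "w \<in> lists \<Sigma>" "c' \<in> reachable M w" for w c'
    using that(2)
  proof (induction rule: reachable_induct)
    case init then show ?case using rel_init[OF that(1)] by blast
  next
    case (step c' d')
    then obtain c where c: "((q0, tape b (map inp w), 0), c) \<in> msteps \<delta>" "rel c c'" by blast
    with rel_step[OF c(2)] step.hyps(2) obtain d where "mstep \<delta> c = Some d" "rel d d'"
      by (auto split: option.splits)
    with c msteps_step show ?case by blast
  qed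
  have lb: "linear_bounded \<Sigma> M E"
    unfolding linear_bounded_def
  proof (intro ballI)
    fix w assume w: "w \<in> lists \<Sigma>"
    obtain S where S: "finite S" "card S \<le> max 1 (E * length w)"
      "\<And>q t h. ((q0, tape b (map inp w), 0), (q, t, h)) \<in> msteps \<delta> \<Longrightarrow> h \<in> S"
      using bound[OF w] by blast
    have "squares_used M w \<subseteq> S"
    proof
      fix h assume "h \<in> squares_used M w"
      then obtain q t where "(q, t, h) \<in> reachable M w" by (auto simp: squares_used_def)
      from conv[OF w this] obtain c where
        c: "((q0, tape b (map inp w), 0), c) \<in> msteps \<delta>" "rel c (q, t, h)" by blast
      obtain p t1 h1 where "c = (p, t1, h1)" by (metis prod_cases3)
      with c show "h \<in> S" using S(3) by (auto simp: rel_def)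
    qed
    then show "finite (squares_used M w) \<and> card (squares_used M w) \<le> max 1 (E * length w)"
      using S by (meson card_mono finite_subset le_trans)
  qed
  have "accepts M w \<longleftrightarrow> w \<in> L" if w: "w \<in> lists \<Sigma>" for w
  proof
    assume "accepts M w"
    then obtain q t h where c': "(q, t, h) \<in> reachable M w" "q \<in> accept_states M"
      by (auto simp: accepts_def)
    obtain c where c: "((q0, tape b (map inp w), 0), c) \<in> msteps \<delta>" "rel c (q, t, h)"
      using conv[OF w c'(1)] by blast
    obtain p t1 h1 where "c = (p, t1, h1)" by (metis prod_cases3)
    with c c'(2) e have "p \<in> Acc" by (auto simp: rel_def M_def inj_on_def)
    with c \<open>c = _\<close> show "w \<in> L" using acc[OF w] by blast
  next
    assume "w \<in> L"
    then obtain q t h where c: "((q0, tape b (map inp w), 0), (q, t, h)) \<in> msteps \<delta>" "q \<in> Acc"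
      using acc[OF w] by blast
    from to[OF w c(1)] obtain c' where c': "c' \<in> reachable M w" "rel (q, t, h) c'" by blast
    obtain p t1 h1 where p: "c' = (p, t1, h1)" by (metis prod_cases3)
    with c' c(2) have "p \<in> accept_states M" by (auto simp: rel_def M_def)
    with c'(1) p show "accepts M w" unfolding accepts_def by blast
  qed
  then have "L = {w \<in> lists \<Sigma>. accepts M w}" using L by auto
  with wf lb fin show ?thesis unfolding dcs_def by blast
qed

section \<open>Erasing letters\<close>

lemma wf_delta:
  assumes "wf_dtm \<Sigma> M" "q \<in> states M" "s \<in> tape_alphabet M" "delta M q s = Some (q', s', d)"
  shows "q' \<in> states M \<and> s' \<in> tape_alphabet M"
  using assms unfolding wf_dtm_def by blast

text \<open>
  The automaton for \<open>L\<close> runs on the given word and passes over every square whose letter is erased,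
  keeping its state and the direction of its last move. The set of these squares never changes, since
  nothing is written on them. The extra squares are squares of the input, so the space stays linear.
  Besides erasing, this renames letters.
\<close>

lemma dcs_erase:
  fixes \<rho> :: "'a \<Rightarrow> 'b option"
  assumes dcs: "dcs \<Delta> L" and fin: "finite \<Sigma>"
    and \<rho>: "\<And>a d. \<lbrakk>a \<in> \<Sigma>; \<rho> a = Some d\<rbrakk> \<Longrightarrow> d \<in> \<Delta>"
  shows "dcs \<Sigma> {w \<in> lists \<Sigma>. List.map_filter \<rho> w \<in> L}"
proof -
  obtain M E where M: "wf_dtm \<Delta> M" "linear_bounded \<Delta> M E" "L = {w \<in> lists \<Delta>. accepts M w}"
    using dcs by (auto simp: dcs_def)
  define \<delta> where "\<delta> = (\<lambda>(q, d) s. case s of None \<Rightarrow> Some ((q, d), None, d)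
     | Some s \<Rightarrow> (case delta M q s of None \<Rightarrow> None
        | Some (q', s', d') \<Rightarrow> Some ((q', d'), Some s', d')))"
  define inp where "inp = (\<lambda>a. map_option Input (\<rho> a))"
  define moves where "moves = {Move_Left, Stay, Move_Right}"
  have mem: "d \<in> moves" for d by (cases d) (auto simp: moves_def)
  have main: "(\<exists>q d t h. (((start_state M, Move_Right), tape (Some Blank) (map inp w), 0),
                   ((q, d), t, h)) \<in> msteps \<delta> \<and> q \<in> accept_states M)
       \<longleftrightarrow> accepts M (List.map_filter \<rho> w)" (is "?acc \<longleftrightarrow> _")
    "\<exists>S. finite S \<and> card S \<le> max 1 ((E + 2) * length w) \<and>
      (\<forall>q t h. (((start_state M, Move_Right), tape (Some Blank) (map inp w), 0), (q, t, h)) \<in> msteps \<delta>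
         \<longrightarrow> h \<in> S)" if w: "w \<in> lists \<Sigma>" for w
  proof -
    define x where "x = List.map_filter \<rho> w"
    define n where "n = length w"
    have x_in: "x \<in> lists \<Delta>"
      using w \<rho> by (auto simp: x_def List.map_filter_def in_lists_conv_set)
    define gap where "gap p \<longleftrightarrow> 0 \<le> p \<and> p < int n \<and> \<rho> (w ! nat p) = None" for p
    \<comment> \<open>\<open>\<sigma>\<close> sends a square to the square of the original tape that it stands for, and a gap to the
      same value as the next square on its right that is not a gap.\<close>
    define \<sigma> where "\<sigma> p = (if p < 0 then p else if p < int n
        then int (length (List.map_filter \<rho> (take (nat p) w)))
        else int (length x) + (p - int n))" for p
    have \<sigma>_Suc: "\<sigma> (p + 1) = \<sigma> p + (if gap p then 0 else 1)" for p
    proof (cases "0 \<le> p \<and> p < int n")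
      case True
      then have "nat (p + 1) = Suc (nat p)" "nat p < length w" by (auto simp: n_def)
      then have "take (nat (p + 1)) w = take (nat p) w @ [w ! nat p]"
        by (simp add: take_Suc_conv_app_nth)
      moreover have "\<sigma> (p + 1) = int (length (List.map_filter \<rho> (take (nat (p + 1)) w)))"
        using True by (auto simp: \<sigma>_def x_def n_def)
      ultimately show ?thesis using True
        by (auto simp: \<sigma>_def gap_def List.map_filter_def)
    next
      case False
      moreover have "int n = 0 \<Longrightarrow> x = []" by (auto simp: x_def n_def List.map_filter_def)
      moreover have "0 < int n \<Longrightarrow> \<sigma> 0 = 0" by (simp add: \<sigma>_def List.map_filter_def)
      ultimately show ?thesis by (auto simp: \<sigma>_def gap_def List.map_filter_def)
    qed
    have \<sigma>_mono: "\<sigma> p \<le> \<sigma> p'" if "p \<le> p'" for p p'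
      using that by (induction p' rule: int_ge_induct) (auto simp: \<sigma>_Suc)
    have \<sigma>_less: "\<sigma> p < \<sigma> p'" if "p < p'" "\<not> gap p" for p p'
      using \<sigma>_mono[of "p + 1" p'] \<sigma>_Suc[of p] that by auto
    have \<sigma>_eq: "p = p'" if "\<sigma> p = \<sigma> p'" "\<not> gap p" "\<not> gap p'" for p p'
      using \<sigma>_less[of p p'] \<sigma>_less[of p' p] that by linarith
    \<comment> \<open>While the head crosses gaps to the right, \<open>\<sigma>\<close> already has the value of the square it is heading
      for; on the way to the left this square is one less.\<close>
    define rel where "rel c c' = (case c of (q, t, h) \<Rightarrow> case c' of ((q', d), t', h') \<Rightarrow>
       q' = q \<and> (\<forall>p. t' p = (if gap p then None else Some (t (\<sigma> p)))) \<and>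
       (gap h' \<longrightarrow> d \<noteq> Stay) \<and> \<sigma> h' = h + (if gap h' \<and> d = Move_Left then 1 else 0))"
      for c :: "'b config" and c' :: "(nat \<times> head_move) \<times> (int \<Rightarrow> 'b tape_symbol option) \<times> int"
    have rel_init: "rel (init_config M x) ((start_state M, Move_Right), tape (Some Blank) (map inp w), 0)"
    proof -
      have "tape (Some Blank) (map inp w) p = (if gap p then None else
          Some (if 0 \<le> \<sigma> p \<and> \<sigma> p < int (length x) then Input (x ! nat (\<sigma> p)) else Blank))" for p
      proof (cases "0 \<le> p \<and> p < int n")
        case True
        define i where "i = nat p"
        have i: "i < length w" "p = int i" using True by (auto simp: i_def n_def)
        have split: "w = take i w @ w ! i # drop (Suc i) w" using i by (simp add: id_take_nth_drop)
        show ?thesis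
        proof (cases "\<rho> (w ! i)")
          case None then show ?thesis using True i by (simp add: gap_def tape_def inp_def)
        next
          case (Some a)
          have "x = List.map_filter \<rho> (take i w @ w ! i # drop (Suc i) w)"
            using split by (simp add: x_def)
          also have "\<dots> = List.map_filter \<rho> (take i w) @ a # List.map_filter \<rho> (drop (Suc i) w)"
            using Some by (simp add: List.map_filter_def)
          finally have "x = \<dots>" .
          moreover have "\<sigma> p = int (length (List.map_filter \<rho> (take i w)))"
            using True i by (simp add: \<sigma>_def)
          ultimately show ?thesis using Some i True
            by (simp add: gap_def tape_def inp_def nth_append)
        qed
      next
        case False
        then show ?thesis by (auto simp: tape_def \<sigma>_def gap_def n_def)
      qed
      moreover have "\<sigma> 0 = 0"
        by (auto simp: \<sigma>_def x_def n_def List.map_filter_def)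
      ultimately show ?thesis by (simp add: rel_def init_config_def)
    qed
    have step_gap: "mstep \<delta> ((q, d), t', h') = Some ((q, d), t', h' + offset d)"
        "rel c ((q, d), t', h' + offset d)"
      if "rel c ((q, d), t', h')" "gap h'" for c q d t' h'
    proof -
      have "t' h' = None" using that by (auto simp: rel_def split: prod.splits)
      then show "mstep \<delta> ((q, d), t', h') = Some ((q, d), t', h' + offset d)"
        by (simp add: \<delta>_def fun_upd_idem)
      show "rel c ((q, d), t', h' + offset d)"
        using that \<sigma>_Suc[of h'] \<sigma>_Suc[of "h' - 1"]
        by (cases d) (auto simp: rel_def split: if_splits prod.splits)
    qed
    have step_nogap: "(case step M c of None \<Rightarrow> mstep \<delta> c' = None
        | Some d \<Rightarrow> \<exists>d'. mstep \<delta> c' = Some d' \<and> rel d d')"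
      if "rel c c'" "\<not> gap (snd (snd c'))" for c c'
    proof -
      obtain q t h where c1: "c = (q, t, h)" by (metis prod_cases3)
      obtain q1 d t' h' where c2: "c' = ((q1, d), t', h')" by (metis prod.exhaust)
      have "q1 = q" using that by (simp add: rel_def c1 c2)
      with c1 c2 have c: "c = (q, t, h)" "c' = ((q, d), t', h')" by auto
      have r: "\<And>p. t' p = (if gap p then None else Some (t (\<sigma> p)))" "\<sigma> h' = h" "\<not> gap h'"
        using that by (auto simp: rel_def c)
      show ?thesis
      proof (cases "delta M q (t h)")
        case None
        moreover have "t' h' = Some (t h)" using r(1)[of h'] r(2,3) by simp
        ultimately show ?thesis by (simp add: c \<delta>_def)
      next
        case (Some v)
        obtain r1 u d1 where v: "v = (r1, u, d1)" by (metis prod_cases3)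
        have 1: "\<forall>p. (t'(h' := Some u)) p = (if gap p then None else Some ((t(h := u)) (\<sigma> p)))"
        proof
          fix p
          show "(t'(h' := Some u)) p = (if gap p then None else Some ((t(h := u)) (\<sigma> p)))"
            using r(1)[of p] r(2,3) \<sigma>_eq[of p h'] by (cases "p = h'") auto
        qed
        have 2: "\<sigma> (h' + offset d1) = h + offset d1 + (if gap (h' + offset d1) \<and> d1 = Move_Left then 1 else 0)"
          using \<sigma>_Suc[of h'] \<sigma>_Suc[of "h' - 1"] r(2,3) by (cases d1) simp_all
        have 3: "gap (h' + offset d1) \<longrightarrow> d1 \<noteq> Stay" using r(3) by auto
        have "rel (r1, t(h := u), h + offset d1) ((r1, d1), t'(h' := Some u), h' + offset d1)"
          unfolding rel_def prod.case using 1 2 3 by blast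
        moreover have "t' h' = Some (t h)" using r(1)[of h'] r(2,3) by simp
        then have "mstep \<delta> c' = Some ((r1, d1), t'(h' := Some u), h' + offset d1)"
          using Some v by (simp add: c \<delta>_def)
        ultimately show ?thesis using Some by (simp add: c v)
      qed
    qed
    define c0 where "c0 = ((start_state M, Move_Right), tape (Some Blank) (map inp w), 0::int)"
    have conv: "\<exists>c \<in> reachable M x. rel c c'" if "(c0, c') \<in> msteps \<delta>" for c'
      using that
    proof (induction rule: rtrancl_induct)
      case base then show ?case using rel_init reachable_init unfolding c0_def by blast
    next
      case (step c' d')
      then obtain c where c: "c \<in> reachable M x" "rel c c'" by blast
      show ?case
      proof (cases "gap (snd (snd c'))")
        case True
        obtain q d t' h' where c': "c' = ((q, d), t', h')" by (metis prod.exhaust)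
        show ?thesis using step_gap[of c q d t' h'] c step(2) True by (auto simp: c')
      next
        case False
        then obtain d where "step M c = Some d" "rel d d'" 
          using step_nogap[OF c(2)] step(2) by (auto split: option.splits)
        then show ?thesis using c reachable_step by blast
      qed
    qed
    \<comment> \<open>The number of squares to the border of the input in the direction of the move decreases.\<close>
    have cross: "\<exists>t' h'. (((q, d), t1, h1), ((q, d), t', h')) \<in> msteps \<delta> \<and> rel c ((q, d), t', h') \<and> \<not> gap h'"
      if "rel c ((q, d), t1, h1)" for c q d t1 h1
      using that
    proof (induction "nat (if d = Move_Left then h1 + 1 else int n - h1)" arbitrary: h1 rule: less_induct)
      case less
      show ?case
      proof (cases "gap h1")
        case False then show ?thesis using less.prems by blast
      next
        case True
        have "d \<noteq> Stay" using less.prems True by (auto simp: rel_def split: prod.splits)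
        then have "nat (if d = Move_Left then (h1 + offset d) + 1 else int n - (h1 + offset d))
           < nat (if d = Move_Left then h1 + 1 else int n - h1)"
          using True by (cases d) (auto simp: gap_def)
        from less.hyps[OF this step_gap(2)[OF less.prems True]] obtain t' h' where
          "(((q, d), t1, h1 + offset d), ((q, d), t', h')) \<in> msteps \<delta>"
          "rel c ((q, d), t', h')" "\<not> gap h'" by blast
        moreover have "(((q, d), t1, h1), ((q, d), t1, h1 + offset d)) \<in> {(c, c'). mstep \<delta> c = Some c'}"
          using step_gap(1)[OF less.prems True] by simp
        ultimately show ?thesis by (blast intro: converse_rtrancl_into_rtrancl)
      qed
    qed
    have cross': "\<exists>c''. (c', c'') \<in> msteps \<delta> \<and> rel c c'' \<and> \<not> gap (snd (snd c''))"
      if "rel c c'" for c c'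
    proof -
      obtain q d t' h' where c': "c' = ((q, d), t', h')" by (metis prod.exhaust)
      from cross[OF that[unfolded c']] obtain t1 h1 where
        "(((q, d), t', h'), ((q, d), t1, h1)) \<in> msteps \<delta>" "rel c ((q, d), t1, h1)" "\<not> gap h1"
        by blast
      then show ?thesis unfolding c' by (intro exI[of _ "((q, d), t1, h1)"]) simp
    qed
    have to: "\<exists>c'. (c0, c') \<in> msteps \<delta> \<and> rel c c' \<and> \<not> gap (snd (snd c'))" if "c \<in> reachable M x" for c
      using that
    proof (induction rule: reachable_induct)
      case init
      then show ?case using cross'[OF rel_init] by (simp add: c0_def)
    next
      case (step c d)
      then obtain c' where c': "(c0, c') \<in> msteps \<delta>" "rel c c'" "\<not> gap (snd (snd c'))" by blast
      with step_nogap[OF c'(2,3)] step.hyps(2) obtain d' where d': "mstep \<delta> c' = Some d'" "rel d d'" by auto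
      have "(c0, d') \<in> msteps \<delta>" using msteps_step[OF c'(1) d'(1)] .
      with cross'[OF d'(2)] show ?case by (meson rtrancl_trans)
    qed
    show "?acc \<longleftrightarrow> accepts M (List.map_filter \<rho> w)"
    proof
      assume ?acc
      then obtain q d t h where c: "(c0, ((q, d), t, h)) \<in> msteps \<delta>" "q \<in> accept_states M"
        unfolding c0_def by blast
      from conv[OF c(1)] obtain c where c': "c \<in> reachable M x" "rel c ((q, d), t, h)" by blast
      obtain q1 t1 h1 where c1: "c = (q1, t1, h1)" by (metis prod_cases3)
      with c' have "q1 = q" by (simp add: rel_def)
      with c1 c' c(2) show "accepts M (List.map_filter \<rho> w)" 
        unfolding accepts_def x_def[symmetric] by blast
    next
      assume "accepts M (List.map_filter \<rho> w)"
      then obtain q t h where c: "(q, t, h) \<in> reachable M x" "q \<in> accept_states M"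
        unfolding accepts_def x_def[symmetric] by blast
      from to[OF c(1)] obtain c' where c': "(c0, c') \<in> msteps \<delta>" "rel (q, t, h) c'" by blast
      obtain q1 d t1 h1 where c1: "c' = ((q1, d), t1, h1)" by (metis prod.exhaust)
      with c' have "q1 = q" by (simp add: rel_def)
      with c1 c' c(2) show ?acc unfolding c0_def by blast
    qed
    define S where "S = {p. \<not> gap p \<and> \<sigma> p \<in> squares_used M x} \<union> {p. gap p}"
    have su: "finite (squares_used M x)" "card (squares_used M x) \<le> max 1 (E * length x)"
      using M(2) x_in by (auto simp: linear_bounded_def)
    have inj: "inj_on \<sigma> {p. \<not> gap p \<and> \<sigma> p \<in> squares_used M x}"
      using \<sigma>_eq by (auto intro!: inj_onI)
    have im: "\<sigma> ` {p. \<not> gap p \<and> \<sigma> p \<in> squares_used M x} \<subseteq> squares_used M x" by auto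
    have f1: "finite {p. \<not> gap p \<and> \<sigma> p \<in> squares_used M x}"
      by (rule finite_imageD[OF finite_subset[OF im su(1)] inj])
    have c1: "card {p. \<not> gap p \<and> \<sigma> p \<in> squares_used M x} \<le> max 1 (E * length x)"
      using card_inj_on_le[OF inj im su(1)] su(2) by linarith
    have sub: "{p. gap p} \<subseteq> {0..<int n}" by (auto simp: gap_def)
    then have f2: "finite {p. gap p}" and c2: "card {p. gap p} \<le> n"
      using card_mono[OF _ sub] by (auto intro: finite_subset)
    have "length x \<le> n" by (simp add: x_def n_def List.map_filter_def)
    then have "max 1 (E * length x) + n \<le> max 1 ((E + 2) * n)"
      using mult_le_mono2[of "length x" n E] by (cases n) auto
    moreover have "card S \<le> max 1 (E * length x) + n"
      unfolding S_def using c1 c2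
        card_Un_le[of "{p. \<not> gap p \<and> \<sigma> p \<in> squares_used M x}" "{p. gap p}"] by linarith
    ultimately have cS: "card S \<le> max 1 ((E + 2) * length w)" unfolding n_def by linarith
    have fS: "finite S" using f1 f2 by (simp add: S_def)
    have hS: "h \<in> S" if h: "(c0, (q, t, h)) \<in> msteps \<delta>" for q t h
    proof -
      obtain c where c: "c \<in> reachable M x" "rel c (q, t, h)" using conv[OF h] by blast
      obtain q1 t1 h1 where c1: "c = (q1, t1, h1)" by (metis prod_cases3)
      then have "h1 \<in> squares_used M x" using c by (auto simp: squares_used_def)
      moreover have "\<not> gap h \<Longrightarrow> \<sigma> h = h1" using c(2) c1 by (auto simp: rel_def split: prod.splits)
      ultimately show ?thesis by (auto simp: S_def)
    qed
    show "\<exists>S. finite S \<and> card S \<le> max 1 ((E + 2) * length w) \<and>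
      (\<forall>q t h. (((start_state M, Move_Right), tape (Some Blank) (map inp w), 0), (q, t, h)) \<in> msteps \<delta>
         \<longrightarrow> h \<in> S)"
      using fS cS hS[unfolded c0_def] by (intro exI[of _ S] conjI allI impI)
  qed
  show ?thesis
  proof (rule dcs_if_machine[where Q = "states M \<times> moves" and Y = "insert None (Some ` tape_alphabet M)"
        and \<delta> = \<delta> and inp = inp and b = "Some Blank" and ?q0.0 = "(start_state M, Move_Right)"
        and Acc = "accept_states M \<times> moves" and E = "E + 2"])
    show "finite (states M \<times> moves)" "finite (insert None (Some ` tape_alphabet M))"
      "(start_state M, Move_Right) \<in> states M \<times> moves"
      "Some Blank \<in> insert None (Some ` tape_alphabet M)"
      using M(1) by (auto simp: wf_dtm_def moves_def)
    show "inp ` \<Sigma> \<subseteq> insert None (Some ` tape_alphabet M)"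
    proof
      fix y assume "y \<in> inp ` \<Sigma>"
      then obtain a where "a \<in> \<Sigma>" "y = map_option Input (\<rho> a)" by (auto simp: inp_def)
      then show "y \<in> insert None (Some ` tape_alphabet M)"
        using M(1) \<rho>[of a] by (cases "\<rho> a") (auto simp: wf_dtm_def)
    qed
    show "q' \<in> states M \<times> moves \<and> s' \<in> insert None (Some ` tape_alphabet M)"
      if hyp: "q \<in> states M \<times> moves" "s \<in> insert None (Some ` tape_alphabet M)"
        "\<delta> q s = Some (q', s', d)" for q s q' s' d
    proof -
      obtain p m where q': "q = (p, m)" by (cases q)
      with hyp(1) have q: "q = (p, m)" "p \<in> states M" by auto
      show ?thesis
      proof (cases s)
        case None then show ?thesis using hyp(1,3) by (auto simp: q \<delta>_def)
      next
        case (Some y)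
        then obtain p' y' where *: "delta M p y = Some (p', y', d)" "q' = (p', d)" "s' = Some y'"
          using hyp(3) by (auto simp: q \<delta>_def split: option.splits)
        have "y \<in> tape_alphabet M" using hyp(2) Some by auto
        from wf_delta[OF M(1) q(2) this *(1)] show ?thesis by (simp add: * mem)
      qed
    qed
    show "w \<in> {w \<in> lists \<Sigma>. List.map_filter \<rho> w \<in> L} \<longleftrightarrow>
       (\<exists>q t h. (((start_state M, Move_Right), tape (Some Blank) (map inp w), 0), q, t, h) \<in> msteps \<delta> \<and>
         q \<in> accept_states M \<times> moves)" if w: "w \<in> lists \<Sigma>" for w
    proof -
      have "List.map_filter \<rho> w \<in> lists \<Delta>"
        using w \<rho> by (auto simp: List.map_filter_def in_lists_conv_set)
      then have "w \<in> {w \<in> lists \<Sigma>. List.map_filter \<rho> w \<in> L} \<longleftrightarrow> accepts M (List.map_filter \<rho> w)"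
        using w M(3) by auto
      then show ?thesis using main(1)[OF w]
        by (simp only: split_paired_Ex mem_Times_iff fst_conv snd_conv mem simp_thms)
    qed
    show "\<exists>S. finite S \<and> card S \<le> max 1 ((E + 2) * length w) \<and>
      (\<forall>q t h. (((start_state M, Move_Right), tape (Some Blank) (map inp w), 0), q, t, h) \<in> msteps \<delta>
         \<longrightarrow> h \<in> S)" if "w \<in> lists \<Sigma>" for w
      using main(2)[OF that] .
    show "finite \<Sigma>" by (rule fin)
    show "{w \<in> lists \<Sigma>. List.map_filter \<rho> w \<in> L} \<subseteq> lists \<Sigma>" by (rule Collect_restrict)
  qed
qed

section \<open>Recognizable functions and sweeps\<close>

text \<open>
  Recognizability in the sense of Myhill and Nerode: \<open>h\<close> names the classes of a congruence of finite
  index on words, and \<open>F\<close> is constant on the classes. Values of \<open>F\<close> need not determine the value on a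
  concatenation, which makes the notion closed under composition with arbitrary functions.
\<close>

definition recognizable :: "'c set \<Rightarrow> ('c list \<Rightarrow> 'x) \<Rightarrow> bool" where
  "recognizable \<Gamma> F \<longleftrightarrow> (\<exists>h :: 'c list \<Rightarrow> nat. finite (h ` lists \<Gamma>) \<and>
     (\<forall>u\<in>lists \<Gamma>. \<forall>u'\<in>lists \<Gamma>. \<forall>v\<in>lists \<Gamma>. \<forall>v'\<in>lists \<Gamma>.
        h u = h u' \<longrightarrow> h v = h v' \<longrightarrow> h (u @ v) = h (u' @ v')) \<and>
     (\<forall>u\<in>lists \<Gamma>. \<forall>u'\<in>lists \<Gamma>. h u = h u' \<longrightarrow> F u = F u'))"

lemma recognizableE:
  assumes "recognizable \<Gamma> F"
  obtains h :: "'c list \<Rightarrow> nat" where "finite (h ` lists \<Gamma>)"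
    "\<And>u u' v v'. \<lbrakk>u \<in> lists \<Gamma>; u' \<in> lists \<Gamma>; v \<in> lists \<Gamma>; v' \<in> lists \<Gamma>; h u = h u'; h v = h v'\<rbrakk>
      \<Longrightarrow> h (u @ v) = h (u' @ v')"
    "\<And>u u'. \<lbrakk>u \<in> lists \<Gamma>; u' \<in> lists \<Gamma>; h u = h u'\<rbrakk> \<Longrightarrow> F u = F u'"
proof -
  from assms obtain h :: "'c list \<Rightarrow> nat" where h: "finite (h ` lists \<Gamma>)"
    "\<forall>u\<in>lists \<Gamma>. \<forall>u'\<in>lists \<Gamma>. \<forall>v\<in>lists \<Gamma>. \<forall>v'\<in>lists \<Gamma>.
        h u = h u' \<longrightarrow> h v = h v' \<longrightarrow> h (u @ v) = h (u' @ v')"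
    "\<forall>u\<in>lists \<Gamma>. \<forall>u'\<in>lists \<Gamma>. h u = h u' \<longrightarrow> F u = F u'"
    unfolding recognizable_def by (elim exE conjE)
  show thesis
    by (rule that[of h], rule h(1), rule h(2)[rule_format], assumption+,
        rule h(3)[rule_format], assumption+)
qed

lemma recognizableI:
  fixes h :: "'c list \<Rightarrow> nat"
  assumes "finite (h ` lists \<Gamma>)"
    "\<And>u u' v v'. \<lbrakk>u \<in> lists \<Gamma>; u' \<in> lists \<Gamma>; v \<in> lists \<Gamma>; v' \<in> lists \<Gamma>; h u = h u'; h v = h v'\<rbrakk>
      \<Longrightarrow> h (u @ v) = h (u' @ v')"
    "\<And>u u'. \<lbrakk>u \<in> lists \<Gamma>; u' \<in> lists \<Gamma>; h u = h u'\<rbrakk> \<Longrightarrow> F u = F u'"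
  shows "recognizable \<Gamma> F"
  unfolding recognizable_def using assms by (intro exI[of _ h] conjI ballI impI)

lemma recognizable_if_morphism:
  assumes "finite (F ` lists \<Gamma>)"
    and "\<And>u u' v v'. \<lbrakk>u \<in> lists \<Gamma>; u' \<in> lists \<Gamma>; v \<in> lists \<Gamma>; v' \<in> lists \<Gamma>; F u = F u'; F v = F v'\<rbrakk>
      \<Longrightarrow> F (u @ v) = F (u' @ v')"
  shows "recognizable \<Gamma> F"
proof -
  obtain e :: "_ \<Rightarrow> nat" where "inj_on e (F ` lists \<Gamma>)"
    using finite_imp_inj_to_nat_seg[OF assms(1)] by blast
  then have e: "e (F u) = e (F v) \<longleftrightarrow> F u = F v" if "u \<in> lists \<Gamma>" "v \<in> lists \<Gamma>" for u v
    using that by (auto simp: inj_on_def)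
  have "finite ((\<lambda>u. e (F u)) ` lists \<Gamma>)"
    using finite_imageI[OF assms(1), of e] by (simp add: image_image)
  moreover have "e (F (u @ v)) = e (F (u' @ v'))"
    if "u \<in> lists \<Gamma>" "u' \<in> lists \<Gamma>" "v \<in> lists \<Gamma>" "v' \<in> lists \<Gamma>" "e (F u) = e (F u')" "e (F v) = e (F v')"
    for u u' v v'
    using that assms(2)[of u u' v v'] by (simp only: e)
  moreover have "F u = F u'" if "u \<in> lists \<Gamma>" "u' \<in> lists \<Gamma>" "e (F u) = e (F u')" for u u'
    using that by (simp only: e)
  ultimately show ?thesis by (rule recognizableI)
qed

lemma recognizable_comp:
  assumes "recognizable \<Gamma> F"
  shows "recognizable \<Gamma> (\<lambda>u. k (F u))"
proof -
  obtain h :: "_ \<Rightarrow> nat" where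
    h: "finite (h ` lists \<Gamma>)"
    "\<And>u u' v v'. \<lbrakk>u \<in> lists \<Gamma>; u' \<in> lists \<Gamma>; v \<in> lists \<Gamma>; v' \<in> lists \<Gamma>; h u = h u'; h v = h v'\<rbrakk>
      \<Longrightarrow> h (u @ v) = h (u' @ v')"
    "\<And>u u'. \<lbrakk>u \<in> lists \<Gamma>; u' \<in> lists \<Gamma>; h u = h u'\<rbrakk> \<Longrightarrow> F u = F u'"
    by (rule recognizableE[OF assms], rule that, assumption, blast, blast)
  show ?thesis
  proof (rule recognizableI[of h])
    show "k (F u) = k (F u')" if "u \<in> lists \<Gamma>" "u' \<in> lists \<Gamma>" "h u = h u'" for u u'
      using h(3)[OF that] by simp
  qed (use h(1,2) in blast)+
qed

lemma recognizable_Pair: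
  assumes "recognizable \<Gamma> F" "recognizable \<Gamma> G"
  shows "recognizable \<Gamma> (\<lambda>u. (F u, G u))"
proof -
  obtain h :: "_ \<Rightarrow> nat" where
    h: "finite (h ` lists \<Gamma>)"
    "\<And>u u' v v'. \<lbrakk>u \<in> lists \<Gamma>; u' \<in> lists \<Gamma>; v \<in> lists \<Gamma>; v' \<in> lists \<Gamma>; h u = h u'; h v = h v'\<rbrakk>
      \<Longrightarrow> h (u @ v) = h (u' @ v')"
    "\<And>u u'. \<lbrakk>u \<in> lists \<Gamma>; u' \<in> lists \<Gamma>; h u = h u'\<rbrakk> \<Longrightarrow> F u = F u'"
    by (rule recognizableE[OF assms(1)]) iprover
  obtain k :: "_ \<Rightarrow> nat" where
    k: "finite (k ` lists \<Gamma>)"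
    "\<And>u u' v v'. \<lbrakk>u \<in> lists \<Gamma>; u' \<in> lists \<Gamma>; v \<in> lists \<Gamma>; v' \<in> lists \<Gamma>; k u = k u'; k v = k v'\<rbrakk>
      \<Longrightarrow> k (u @ v) = k (u' @ v')"
    "\<And>u u'. \<lbrakk>u \<in> lists \<Gamma>; u' \<in> lists \<Gamma>; k u = k u'\<rbrakk> \<Longrightarrow> G u = G u'"
    by (rule recognizableE[OF assms(2)]) iprover
  have "(\<lambda>u. prod_encode (h u, k u)) ` lists \<Gamma> \<subseteq> prod_encode ` ((h ` lists \<Gamma>) \<times> (k ` lists \<Gamma>))"
    by auto
  then have "finite ((\<lambda>u. prod_encode (h u, k u)) ` lists \<Gamma>)"
    using h(1) k(1) by (meson finite_SigmaI finite_imageI finite_subset)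
  then show ?thesis
  proof (rule recognizableI)
    show "prod_encode (h (u @ v), k (u @ v)) = prod_encode (h (u' @ v'), k (u' @ v'))"
      if "u \<in> lists \<Gamma>" "u' \<in> lists \<Gamma>" "v \<in> lists \<Gamma>" "v' \<in> lists \<Gamma>"
        "prod_encode (h u, k u) = prod_encode (h u', k u')"
        "prod_encode (h v, k v) = prod_encode (h v', k v')" for u u' v v'
      using that h(2)[of u u' v v'] k(2)[of u u' v v'] by (simp add: prod_encode_eq)
    show "(F u, G u) = (F u', G u')"
      if "u \<in> lists \<Gamma>" "u' \<in> lists \<Gamma>" "prod_encode (h u, k u) = prod_encode (h u', k u')" for u u'
      using that h(3)[of u u'] k(3)[of u u'] by (simp add: prod_encode_eq)
  qed
qed

lemma recognizable_map:
  assumes F: "recognizable \<Gamma>' F" and g: "g ` \<Gamma> \<subseteq> \<Gamma>'"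
  shows "recognizable \<Gamma> (\<lambda>u. F (map g u))"
proof -
  obtain h :: "_ \<Rightarrow> nat" where
    h: "finite (h ` lists \<Gamma>')"
    "\<And>u u' v v'. \<lbrakk>u \<in> lists \<Gamma>'; u' \<in> lists \<Gamma>'; v \<in> lists \<Gamma>'; v' \<in> lists \<Gamma>'; h u = h u'; h v = h v'\<rbrakk>
      \<Longrightarrow> h (u @ v) = h (u' @ v')"
    "\<And>u u'. \<lbrakk>u \<in> lists \<Gamma>'; u' \<in> lists \<Gamma>'; h u = h u'\<rbrakk> \<Longrightarrow> F u = F u'"
    by (rule recognizableE[OF F]) iprover
  have m: "map g u \<in> lists \<Gamma>'" if "u \<in> lists \<Gamma>" for u
    using that g by (auto simp: in_lists_conv_set)
  have "(\<lambda>u. h (map g u)) ` lists \<Gamma> \<subseteq> h ` lists \<Gamma>'" using m by auto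
  then have "finite ((\<lambda>u. h (map g u)) ` lists \<Gamma>)" using h(1) finite_subset by blast
  then show ?thesis
  proof (rule recognizableI)
    show "h (map g (u @ v)) = h (map g (u' @ v'))"
      if "u \<in> lists \<Gamma>" "u' \<in> lists \<Gamma>" "v \<in> lists \<Gamma>" "v' \<in> lists \<Gamma>"
        "h (map g u) = h (map g u')" "h (map g v) = h (map g v')" for u u' v v'
      using h(2)[OF m m m m, of u u' v v'] that by simp
    show "F (map g u) = F (map g u')"
      if "u \<in> lists \<Gamma>" "u' \<in> lists \<Gamma>" "h (map g u) = h (map g u')" for u u'
      using h(3)[OF m m that(3)] that by simp
  qed
qed

lemma find_append: "find P (u @ v) = (case find P u of None \<Rightarrow> find P v | Some x \<Rightarrow> Some x)"
  by (induction u) auto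

lemma find_in_set: "find P u = Some x \<Longrightarrow> x \<in> set u"
  by (induction u) (auto split: if_splits)

lemma recognizable_find:
  assumes "finite \<Gamma>"
  shows "recognizable \<Gamma> (find P)"
proof (rule recognizable_if_morphism)
  have "find P ` lists \<Gamma> \<subseteq> insert None (Some ` \<Gamma>)"
  proof
    fix y assume "y \<in> find P ` lists \<Gamma>"
    then show "y \<in> insert None (Some ` \<Gamma>)"
      using find_in_set[of P] by (cases y) (fastforce simp: in_lists_conv_set)+
  qed
  then show "finite (find P ` lists \<Gamma>)" using assms by (meson finite_imageI finite_insert finite_subset)
qed (simp add: find_append split: option.split)

definition last_option :: "'c list \<Rightarrow> 'c option" where
  "last_option u = (if u = [] then None else Some (last u))"

lemma recognizable_last:
  assumes "finite \<Gamma>"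
  shows "recognizable \<Gamma> last_option"
proof (rule recognizable_if_morphism)
  have "last_option ` lists \<Gamma> \<subseteq> insert None (Some ` \<Gamma>)"
    by (auto simp: last_option_def)
  then show "finite (last_option ` lists \<Gamma>)"
    using assms by (meson finite_imageI finite_insert finite_subset)
qed (auto simp: last_option_def split: if_splits)

lemma recognizable_const: "recognizable \<Gamma> (\<lambda>u. k)"
  by (rule recognizable_if_morphism) (auto intro: finite_subset[of _ "{k}"])

lemma nth_lists: "\<lbrakk>c \<in> lists \<Gamma>; i < length c\<rbrakk> \<Longrightarrow> c ! i \<in> \<Gamma>"
  by (auto simp: in_lists_conv_set)

lemma in_lists_nth: "(\<And>i. i < length c \<Longrightarrow> c ! i \<in> \<Gamma>) \<Longrightarrow> c \<in> lists \<Gamma>"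
  by (auto simp: in_lists_conv_set in_set_conv_nth)

text \<open>
  The arguments of \<open>\<phi>\<close> are the information about the whole word, about the part to the left, the letter
  itself, and the information about the part to the right.
\<close>

definition sweep :: "('x \<Rightarrow> 'x \<Rightarrow> 'c \<Rightarrow> 'x \<Rightarrow> 'd) \<Rightarrow> ('c list \<Rightarrow> 'x) \<Rightarrow> 'c list \<Rightarrow> 'd list" where
  "sweep \<phi> F c = map (\<lambda>i. \<phi> (F c) (F (take i c)) (c ! i) (F (drop (Suc i) c))) [0..<length c]"

lemma length_sweep [simp]: "length (sweep \<phi> F c) = length c"
  by (simp add: sweep_def)

lemma nth_sweep:
  "i < length c \<Longrightarrow> sweep \<phi> F c ! i = \<phi> (F c) (F (take i c)) (c ! i) (F (drop (Suc i) c))"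
  by (simp add: sweep_def)

lemma nth_sweep_split: "sweep \<phi> F (l @ a # r) ! length l = \<phi> (F (l @ a # r)) (F l) a (F r)"
  by (simp add: nth_sweep)

text \<open>
  A square holds \<open>Marked m a\<close> when the letter \<open>a\<close> has been passed by the head on its way to the right;
  \<open>m\<close> is the class of the prefix before it.
\<close>

datatype 'c square = Edge | Letter 'c | Marked nat 'c
datatype phase = Start | Accept | Forward nat | Backward nat

lemma tape_nth: "tape b (xs @ s # ys) (int (length xs)) = s"
  by (simp add: tape_def)

lemma tape_upd: "(tape b (xs @ s # ys))(int (length xs) := s') = tape b (xs @ s' # ys)"
  by (auto simp: tape_def fun_eq_iff nth_append nth_Cons' )

lemma tape_end: "tape b xs (int (length xs)) = b" "tape b xs (- 1) = b"
  by (simp_all add: tape_def)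

text \<open>
  One sweep costs one walk of the head over the word and back. On the way to the right the class of
  the prefix is carried in the state and left behind in each square; on the way back the class of the
  suffix is carried, and both together with the letter determine the new letter. Back at the left end
  the state is the class of the whole word, which decides acceptance. Only the two squares next to the
  word are used in addition. The value \<open>e\<close> for the empty word is needed because the automaton cannot
  move at all on it.
\<close>

lemma dcs_if_system:
  fixes \<iota> :: "'a \<Rightarrow> 'c" and F :: "'c list \<Rightarrow> 'x"
  assumes fin: "finite \<Sigma>" "finite \<Gamma>" and \<iota>: "\<iota> ` \<Sigma> \<subseteq> \<Gamma>" and rec: "recognizable \<Gamma> F"
    and closed: "\<And>c. c \<in> lists \<Gamma> \<Longrightarrow> sweep \<phi> F c \<in> lists \<Gamma>"
  shows "dcs \<Sigma> {w \<in> lists \<Sigma>. if w = [] then e else \<exists>t. A (F ((sweep \<phi> F ^^ t) (map \<iota> w)))}"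
proof -
  obtain h :: "_ \<Rightarrow> nat" where
    h: "finite (h ` lists \<Gamma>)"
    "\<And>u u' v v'. \<lbrakk>u \<in> lists \<Gamma>; u' \<in> lists \<Gamma>; v \<in> lists \<Gamma>; v' \<in> lists \<Gamma>; h u = h u'; h v = h v'\<rbrakk>
      \<Longrightarrow> h (u @ v) = h (u' @ v')"
    "\<And>u u'. \<lbrakk>u \<in> lists \<Gamma>; u' \<in> lists \<Gamma>; h u = h u'\<rbrakk> \<Longrightarrow> F u = F u'"
    by (rule recognizableE[OF rec]) iprover
  \<comment> \<open>The class of a word that is extended by a letter is computed from a representative of its class.\<close>
  define rep where "rep m = (SOME u. u \<in> lists \<Gamma> \<and> h u = m)" for m
  have rep: "rep (h u) \<in> lists \<Gamma>" "h (rep (h u)) = h u" if "u \<in> lists \<Gamma>" for u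
    using someI[of "\<lambda>v. v \<in> lists \<Gamma> \<and> h v = h u" u] that by (auto simp: rep_def)
  have F_rep: "F (rep (h u)) = F u" if "u \<in> lists \<Gamma>" for u
    using h(3) rep[OF that] that by blast
  define new where "new m' c m = \<phi> (F (rep m' @ c # rep m)) (F (rep m')) c (F (rep m))" for m' c m
  have new: "new (h l) a (h r) = \<phi> (F (l @ a # r)) (F l) a (F r)"
    if "l \<in> lists \<Gamma>" "a \<in> \<Gamma>" "r \<in> lists \<Gamma>" for l a r
  proof -
    have "h (a # rep (h r)) = h (a # r)"
      using h(2)[of "[a]" "[a]" "rep (h r)" r] rep that by simp
    then have "h (rep (h l) @ a # rep (h r)) = h (l @ a # r)"
      using h(2)[of "rep (h l)" l "a # rep (h r)" "a # r"] rep that by simp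
    then have "F (rep (h l) @ a # rep (h r)) = F (l @ a # r)"
      using h(3) rep that by simp
    then show ?thesis using F_rep that by (simp add: new_def)
  qed
  have h_snoc: "h (rep (h l) @ [a]) = h (l @ [a])" if "l \<in> lists \<Gamma>" "a \<in> \<Gamma>" for l a
    using h(2)[of "rep (h l)" l "[a]" "[a]"] rep that by simp
  have h_Cons: "h (a # rep (h r)) = h (a # r)" if "r \<in> lists \<Gamma>" "a \<in> \<Gamma>" for r a
    using h(2)[of "[a]" "[a]" "rep (h r)" r] rep that by simp
  define \<delta> :: "phase \<Rightarrow> 'c square \<Rightarrow> (phase \<times> 'c square \<times> head_move) option" where
    "\<delta> q s = (case q of
        Start \<Rightarrow> (case s of Edge \<Rightarrow> if e then Some (Accept, Edge, Stay) else None
                | Letter c \<Rightarrow> Some (Forward (h []), Letter c, Stay) | Marked _ _ \<Rightarrow> None)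
      | Accept \<Rightarrow> None
      | Forward m \<Rightarrow> (case s of Edge \<Rightarrow> Some (Backward (h []), Edge, Move_Left)
                | Letter c \<Rightarrow> Some (Forward (h (rep m @ [c])), Marked m c, Move_Right) | Marked _ _ \<Rightarrow> None)
      | Backward m \<Rightarrow> (case s of Edge \<Rightarrow> if A (F (rep m)) then Some (Accept, Edge, Stay)
                                     else Some (Forward (h []), Edge, Move_Right)
                | Letter c \<Rightarrow> None
                | Marked m' c \<Rightarrow> Some (Backward (h (c # rep m)), Letter (new m' c m), Move_Left)))" for q s
  define ann where "ann l = map (\<lambda>i. Marked (h (take i l)) (l ! i)) [0..<length l]" for l
  have ann_snoc: "ann (l @ [a]) = ann l @ [Marked (h l) a]" for l a
    by (simp add: ann_def nth_append)
  have len_ann [simp]: "length (ann l) = length l" for l by (simp add: ann_def)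
  have main: "((\<exists>q t p. ((Start, tape Edge (map (\<lambda>a. Letter (\<iota> a)) w), 0), (q, t, p)) \<in> msteps \<delta> \<and> q \<in> {Accept})
      \<longleftrightarrow> (if w = [] then e else \<exists>t. A (F ((sweep \<phi> F ^^ t) (map \<iota> w)))))
    \<and> (\<exists>S. finite S \<and> card S \<le> max 1 (3 * length w) \<and>
      (\<forall>q t p. ((Start, tape Edge (map (\<lambda>a. Letter (\<iota> a)) w), 0), (q, t, p)) \<in> msteps \<delta> \<longrightarrow> p \<in> S))"
    if w: "w \<in> lists \<Sigma>" for w
  proof (cases "w = []")
    case True
    have "c = (Start, tape Edge [], 0) \<or> e \<and> c = (Accept, tape Edge [], 0)"
      if "((Start, tape Edge [], 0), c) \<in> msteps \<delta>" for c
      using that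
    proof (induction rule: rtrancl_induct)
      case (step c d)
      have T: "tape Edge [] = (\<lambda>_. Edge)" by (rule ext) (auto simp: tape_def)
      show ?case using step(2,3) by (auto simp: \<delta>_def T fun_upd_idem split: if_splits)
    qed simp
    note inv = this
    have "((Start, tape Edge [], 0), (Accept, tape Edge [], 0)) \<in> msteps \<delta>" if e
    proof -
      have "mstep \<delta> (Start, tape Edge [], 0) = Some (Accept, tape Edge [], 0)"
        using that by (simp add: \<delta>_def tape_def fun_upd_idem)
      then show ?thesis by blast
    qed
    then have "(\<exists>q t p. ((Start, tape Edge [], 0), (q, t, p)) \<in> msteps \<delta> \<and> q \<in> {Accept}) \<longleftrightarrow> e"
      using inv by blast
    moreover have "p \<in> {0}" if "((Start, tape Edge [], 0), (q, t, p)) \<in> msteps \<delta>" for q t p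
      using inv[OF that] by auto
    ultimately show ?thesis using True by (intro conjI exI[of _ "{0::int}"]) auto
  next
    case False
    define n where "n = length w"
    have n: "n > 0" using False by (simp add: n_def)
    define W where "W t = (sweep \<phi> F ^^ t) (map \<iota> w)" for t
    have W_in: "W t \<in> lists \<Gamma>" for t
    proof (induction t)
      case 0 then show ?case using w \<iota> by (auto simp: W_def in_lists_conv_set)
    next
      case (Suc t) then show ?case using closed by (simp add: W_def)
    qed
    have W_Suc: "W (Suc t) = sweep \<phi> F (W t)" for t by (simp add: W_def)
    have len_W: "length (W t) = n" for t by (induction t) (simp_all add: W_def n_def)
    \<comment> \<open>The two kinds of configurations between the ends, with \<open>l @ r\<close> the current word and the head
      between \<open>l\<close> and \<open>r\<close>. On the way back, the letters behind the head are those of the next word.\<close>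
    define cF where "cF l r = (Forward (h l), tape Edge (ann l @ map Letter r), int (length l))" for l r
    define cB where "cB t l r = (Backward (h r), tape Edge (ann l @ map Letter (drop (length l) (W (Suc t)))),
        int (length l) - 1)" for t l r
    have c0: "tape Edge (map (\<lambda>a. Letter (\<iota> a)) w) = tape Edge (map Letter (W 0))" by (simp add: W_def comp_def)
    have s0: "mstep \<delta> (Start, tape Edge (map Letter (W 0)), 0) = Some (cF [] (W 0))"
    proof (cases "W 0")
      case Nil then show ?thesis using len_W[of 0] n by simp
    next
      case (Cons a c)
      have "tape Edge (map Letter (W 0)) 0 = Letter a" using Cons by (simp add: tape_def)
      then show ?thesis by (simp add: \<delta>_def cF_def ann_def fun_upd_idem)
    qed
    have s1: "mstep \<delta> (cF l (a # r)) = Some (cF (l @ [a]) r)" if "W t = l @ a # r" for t l a r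
    proof -
      have in': "l \<in> lists \<Gamma>" "a \<in> \<Gamma>" using W_in[of t] that by auto
      have "tape Edge (ann l @ map Letter (a # r)) (int (length l)) = Letter a"
        using tape_nth[of Edge "ann l" "Letter a" "map Letter r"] by simp
      moreover have "(tape Edge (ann l @ map Letter (a # r)))(int (length l) := Marked (h l) a)
         = tape Edge (ann (l @ [a]) @ map Letter r)"
        using tape_upd[of Edge "ann l" "Letter a" "map Letter r"] by (simp add: ann_snoc)
      ultimately show ?thesis using h_snoc[OF in'] by (simp add: cF_def \<delta>_def)
    qed
    have s2: "mstep \<delta> (cF (W t) []) = Some (cB t (W t) [])" for t
    proof -
      have "tape Edge (ann (W t)) (int (length (W t))) = Edge"
        using tape_end(1)[of Edge "ann (W t)"] by simp
      then show ?thesis by (simp add: cF_def cB_def \<delta>_def len_W fun_upd_idem)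
    qed
    have s3: "mstep \<delta> (cB t (l @ [a]) r) = Some (cB t l (a # r))" if "W t = l @ a # r" for t l a r
    proof -
      have in': "l \<in> lists \<Gamma>" "a \<in> \<Gamma>" "r \<in> lists \<Gamma>" using W_in[of t] that by auto
      let ?D = "drop (Suc (length l)) (W (Suc t))"
      have "length l < length (W (Suc t))" using len_W[of t] that by (simp add: len_W)
      then have D: "drop (length l) (W (Suc t)) = W (Suc t) ! length l # ?D"
        by (simp add: Cons_nth_drop_Suc)
      have "W (Suc t) ! length l = new (h l) a (h r)"
        using new[OF in'] that nth_sweep_split[of \<phi> F l a r] by (simp add: W_Suc)
      with D have "map Letter (drop (length l) (W (Suc t))) = Letter (new (h l) a (h r)) # map Letter ?D" by simp
      moreover have "tape Edge (ann (l @ [a]) @ map Letter ?D) (int (length l)) = Marked (h l) a"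
        using tape_nth[of Edge "ann l" "Marked (h l) a" "map Letter ?D"] by (simp add: ann_snoc)
      moreover have "(tape Edge (ann (l @ [a]) @ map Letter ?D))(int (length l) := Letter (new (h l) a (h r)))
         = tape Edge (ann l @ Letter (new (h l) a (h r)) # map Letter ?D)"
        using tape_upd[of Edge "ann l" "Marked (h l) a" "map Letter ?D"] by (simp add: ann_snoc)
      ultimately show ?thesis using h_Cons[OF in'(3,2)] by (simp add: cB_def \<delta>_def)
    qed
    have s4: "mstep \<delta> (cB t [] (W t)) = Some (if A (F (W t))
        then (Accept, tape Edge (map Letter (W (Suc t))), -1) else cF [] (W (Suc t)))" for t
      using F_rep[OF W_in[of t]] tape_end(2)[of Edge "map Letter (W (Suc t))"]
      by (simp add: cB_def cF_def \<delta>_def ann_def fun_upd_idem)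
    define c0 where "c0 = (Start, tape Edge (map Letter (W 0)), 0::int)"
    have inv: "c = c0 \<or> (\<exists>t l r. W t = l @ r \<and> c = cF l r) \<or> (\<exists>t l r. W t = l @ r \<and> c = cB t l r)
        \<or> (\<exists>t t'. A (F (W t)) \<and> c = (Accept, t', -1))" if "(c0, c) \<in> msteps \<delta>" for c
      using that
    proof (induction rule: rtrancl_induct)
      case (step c d)
      from step(2) have cd: "mstep \<delta> c = Some d" by simp
      from step(3) consider "c = c0" | t l r where "W t = l @ r" "c = cF l r"
        | t l r where "W t = l @ r" "c = cB t l r" | t t' where "A (F (W t))" "c = (Accept, t', -1)"
        by blast
      then show ?case
      proof cases
        case 1
        then have "d = cF [] (W 0)" using cd s0 by (simp add: c0_def)
        then show ?thesis by (metis append_Nil)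
      next
        case (2 t l r)
        show ?thesis
        proof (cases r)
          case Nil
          then have "d = cB t (W t) []" using cd s2[of t] 2 by simp
          then show ?thesis by (metis append_Nil2)
        next
          case (Cons a r')
          then have "d = cF (l @ [a]) r'" "W t = (l @ [a]) @ r'" using cd s1[of t l a r'] 2 by simp_all
          then show ?thesis by blast
        qed
      next
        case (3 t l r)
        show ?thesis
        proof (cases l rule: rev_cases)
          case Nil
          then have "d = (if A (F (W t)) then (Accept, tape Edge (map Letter (W (Suc t))), -1) else cF [] (W (Suc t)))"
            using cd s4[of t] 3 by simp
          then show ?thesis by (metis append_Nil)
        next
          case (snoc l' a)
          then have "d = cB t l' (a # r)" "W t = l' @ (a # r)" using cd s3[of t l' a r] 3 by simp_all
          then show ?thesis by blast
        qed
      next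
        case 4
        then show ?thesis using cd by (simp add: \<delta>_def)
      qed
    qed simp
    have f1: "(cF l r, cF (l @ r) []) \<in> msteps \<delta>" if "W t = l @ r" for t l r
      using that
    proof (induction r arbitrary: l)
      case (Cons a r)
      have "(cF l (a # r), cF (l @ [a]) r) \<in> msteps \<delta>" using s1[OF Cons.prems] by blast
      also have "(cF (l @ [a]) r, cF ((l @ [a]) @ r) []) \<in> msteps \<delta>"
        using Cons.IH[of "l @ [a]"] Cons.prems by simp
      finally show ?case by simp
    qed simp
    have b1: "(cB t l r, cB t [] (l @ r)) \<in> msteps \<delta>" if "W t = l @ r" for t l r
      using that
    proof (induction l arbitrary: r rule: rev_induct)
      case (snoc a l)
      have "(cB t (l @ [a]) r, cB t l (a # r)) \<in> msteps \<delta>" using s3[of t l a r] snoc.prems by auto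
      also have "(cB t l (a # r), cB t [] (l @ a # r)) \<in> msteps \<delta>"
        using snoc.IH[of "a # r"] snoc.prems by simp
      finally show ?case by simp
    qed simp
    have pass: "(cF [] (W t), cB t [] (W t)) \<in> msteps \<delta>" for t
    proof -
      have "(cF [] (W t), cF (W t) []) \<in> msteps \<delta>" using f1[of t "[]" "W t"] by simp
      also have "(cF (W t) [], cB t (W t) []) \<in> msteps \<delta>" using s2[of t] by blast
      also have "(cB t (W t) [], cB t [] (W t)) \<in> msteps \<delta>" using b1[of t "W t" "[]"] by simp
      finally show ?thesis .
    qed
    have reach: "(c0, cF [] (W t)) \<in> msteps \<delta>" if "\<forall>s<t. \<not> A (F (W s))" for t
      using that
    proof (induction t)
      case 0
      show ?case using s0 by (auto simp: c0_def)
    next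
      case (Suc t)
      then have "(c0, cF [] (W t)) \<in> msteps \<delta>" by simp
      also note pass[of t]
      also have "(cB t [] (W t), cF [] (W (Suc t))) \<in> msteps \<delta>" using s4[of t] Suc.prems by auto
      finally show ?case .
    qed
    have acc: "(\<exists>q t p. (c0, (q, t, p)) \<in> msteps \<delta> \<and> q \<in> {Accept}) \<longleftrightarrow> (\<exists>t. A (F (W t)))"
    proof
      assume "\<exists>q t p. (c0, (q, t, p)) \<in> msteps \<delta> \<and> q \<in> {Accept}"
      then obtain t p where "(c0, (Accept, t, p)) \<in> msteps \<delta>" by blast
      from inv[OF this] show "\<exists>t. A (F (W t))" by (auto simp: c0_def cF_def cB_def)
    next
      assume "\<exists>t. A (F (W t))"
      then obtain t where t: "A (F (W t))" "\<forall>s<t. \<not> A (F (W s))"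
        using exists_least_iff[of "\<lambda>t. A (F (W t))"] by blast
      note reach[OF t(2)]
      also note pass[of t]
      also have "(cB t [] (W t), (Accept, tape Edge (map Letter (W (Suc t))), -1)) \<in> msteps \<delta>"
        using s4[of t] t(1) by auto
      finally show "\<exists>q t p. (c0, (q, t, p)) \<in> msteps \<delta> \<and> q \<in> {Accept}" by blast
    qed
    have "p \<in> {-1..int n}" if "(c0, (q, t, p)) \<in> msteps \<delta>" for q t p
      using inv[OF that] len_W
    proof (elim disjE exE conjE)
      fix s l r assume "W s = l @ r" "(q, t, p) = cF l r"
      then show ?thesis using len_W[of s] by (simp add: cF_def)
    next
      fix s l r assume "W s = l @ r" "(q, t, p) = cB s l r"
      then show ?thesis using len_W[of s] by (simp add: cB_def)
    qed (simp_all add: c0_def)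
    moreover have "card {-1..int n} = n + 2" by (simp add: nat_add_distrib)
    then have "card {-1..int n} \<le> max 1 (3 * length w)"
      using n unfolding n_def le_max_iff_disj by linarith
    moreover have "finite {-1..int n}" by simp
    ultimately have "\<exists>S. finite S \<and> card S \<le> max 1 (3 * length w) \<and>
      (\<forall>q t p. (c0, (q, t, p)) \<in> msteps \<delta> \<longrightarrow> p \<in> S)"
      by (intro exI[of _ "{-1..int n}"]) blast
    with acc show ?thesis using False unfolding c0 c0_def W_def by (simp only: if_False)
  qed
  show ?thesis
  proof (rule dcs_if_machine[where Q = "{Start, Accept} \<union> Forward ` h ` lists \<Gamma> \<union> Backward ` h ` lists \<Gamma>"
        and Y = "insert Edge (Letter ` \<Gamma>) \<union> (\<lambda>(m, c). Marked m c) ` (h ` lists \<Gamma> \<times> \<Gamma>)" and \<delta> = \<delta>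
        and inp = "\<lambda>a. Letter (\<iota> a)" and b = Edge and ?q0.0 = Start and Acc = "{Accept}" and E = 3])
    show "finite \<Sigma>" by (rule fin)
    show "finite ({Start, Accept} \<union> Forward ` h ` lists \<Gamma> \<union> Backward ` h ` lists \<Gamma>)"
      "finite (insert Edge (Letter ` \<Gamma>) \<union> (\<lambda>(m, c). Marked m c) ` (h ` lists \<Gamma> \<times> \<Gamma>))"
      using h(1) fin(2) by simp_all
    show "(\<lambda>a. Letter (\<iota> a)) ` \<Sigma> \<subseteq> insert Edge (Letter ` \<Gamma>) \<union> (\<lambda>(m, c). Marked m c) ` (h ` lists \<Gamma> \<times> \<Gamma>)"
      using \<iota> by auto
  next
    fix q s q' s' d
    assume q: "q \<in> {Start, Accept} \<union> Forward ` h ` lists \<Gamma> \<union> Backward ` h ` lists \<Gamma>"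
      and s: "s \<in> insert Edge (Letter ` \<Gamma>) \<union> (\<lambda>(m, c). Marked m c) ` (h ` lists \<Gamma> \<times> \<Gamma>)"
      and \<delta>: "\<delta> q s = Some (q', s', d)"
    define H where "H = h ` lists \<Gamma>"
    have new_in: "new m' a m \<in> \<Gamma>" if m: "m' \<in> H" "m \<in> H" and a: "a \<in> \<Gamma>" for m' a m
    proof -
      obtain l r where lr: "m' = h l" "m = h r" "l \<in> lists \<Gamma>" "r \<in> lists \<Gamma>"
        using m unfolding H_def by blast
      have "sweep \<phi> F (l @ a # r) \<in> lists \<Gamma>" using closed a lr by simp
      then have "sweep \<phi> F (l @ a # r) ! length l \<in> \<Gamma>" by (auto simp: in_lists_conv_set)
      then show ?thesis using new[OF lr(3) a lr(4)] by (simp add: nth_sweep_split lr)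
    qed
    have nil: "h [] \<in> H" by (simp add: H_def)
    have step_in: "h (rep m @ [c]) \<in> H" "h (c # rep m) \<in> H" if m: "m \<in> H" and "c \<in> \<Gamma>" for m c
    proof -
      obtain x where "m = h x" "x \<in> lists \<Gamma>" using m unfolding H_def by blast
      then have "rep m \<in> lists \<Gamma>" using rep(1) by blast
      then have "rep m @ [c] \<in> lists \<Gamma>" "c # rep m \<in> lists \<Gamma>" using that(2) by simp_all
      then show "h (rep m @ [c]) \<in> H" "h (c # rep m) \<in> H"
        unfolding H_def by (blast intro: imageI)+
    qed
    show "q' \<in> {Start, Accept} \<union> Forward ` h ` lists \<Gamma> \<union> Backward ` h ` lists \<Gamma> \<and>
       s' \<in> insert Edge (Letter ` \<Gamma>) \<union> (\<lambda>(m, c). Marked m c) ` (h ` lists \<Gamma> \<times> \<Gamma>)"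
      using q s \<delta> unfolding H_def[symmetric]
      by (cases q; cases s) (auto simp: \<delta>_def image_iff nil step_in new_in split: if_splits)
  next
    fix w assume w: "w \<in> lists \<Sigma>"
    show "(w \<in> {w \<in> lists \<Sigma>. if w = [] then e else \<exists>t. A (F ((sweep \<phi> F ^^ t) (map \<iota> w)))}) \<longleftrightarrow>
       (\<exists>q t p. ((Start, tape Edge (map (\<lambda>a. Letter (\<iota> a)) w), 0), q, t, p) \<in> msteps \<delta> \<and> q \<in> {Accept})"
      using main[OF w] w by (simp only: mem_Collect_eq simp_thms)
    show "\<exists>S. finite S \<and> card S \<le> max 1 (3 * length w) \<and>
      (\<forall>q t p. ((Start, tape Edge (map (\<lambda>a. Letter (\<iota> a)) w), 0), q, t, p) \<in> msteps \<delta> \<longrightarrow> p \<in> S)"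
      using main[OF w] by (rule conjunct2)
  qed auto
qed

section \<open>Counting with digits\<close>

text \<open>
  Digits run from \<open>0\<close> to \<open>B - 1\<close>, the most significant one first. A digit changes iff all digits to its
  right are maximal, so \<open>increment B\<close> is a sweep. The largest number is followed by zero.
\<close>

fun increment :: "nat \<Rightarrow> nat list \<Rightarrow> nat list" where
  "increment B [] = []"
| "increment B (x # xs) = (if \<forall>y\<in>set xs. y = B - 1 then (x + 1) mod B else x) # increment B xs"

fun numval :: "nat \<Rightarrow> nat list \<Rightarrow> nat" where
  "numval B [] = 0"
| "numval B (x # xs) = x * B ^ length xs + numval B xs"

lemma length_increment [simp]: "length (increment B xs) = length xs"
  by (induction xs) auto

lemma nth_increment: "i < length xs \<Longrightarrow>
    increment B xs ! i = (if \<forall>y\<in>set (drop (Suc i) xs). y = B - 1 then (xs ! i + 1) mod B else xs ! i)"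
  by (induction xs arbitrary: i) (auto simp: nth_Cons split: nat.split)

lemma increment_in: "\<lbrakk>0 < B; xs \<in> lists {..<B}\<rbrakk> \<Longrightarrow> increment B xs \<in> lists {..<B}"
  by (induction xs) auto

lemma numval_less: "xs \<in> lists {..<B} \<Longrightarrow> numval B xs < B ^ length xs"
proof (induction xs)
  case (Cons x xs)
  then have "numval B xs < B ^ length xs" "x < B" by auto
  then have "x * B ^ length xs + numval B xs < (x + 1) * B ^ length xs" by simp
  also have "\<dots> \<le> B * B ^ length xs" using \<open>x < B\<close> by (intro mult_le_mono1) simp
  finally show ?case by simp
qed simp

lemma numval_max: "xs \<in> lists {..<B} \<Longrightarrow> (\<forall>y\<in>set xs. y = B - 1) \<longleftrightarrow> Suc (numval B xs) = B ^ length xs"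
proof (induction xs)
  case (Cons x xs)
  then have *: "numval B xs < B ^ length xs" "x < B" using numval_less by auto
  have IH: "(\<forall>y\<in>set xs. y = B - 1) \<longleftrightarrow> Suc (numval B xs) = B ^ length xs" using Cons by simp
  show ?case
  proof
    assume a: "\<forall>y\<in>set (x # xs). y = B - 1"
    then have "Suc (numval B xs) = B ^ length xs" "x = B - 1" using IH by auto
    then have "Suc (numval B (x # xs)) = (x + 1) * B ^ length xs" by simp
    also have "x + 1 = B" using \<open>x = B - 1\<close> *(2) by simp
    finally show "Suc (numval B (x # xs)) = B ^ length (x # xs)" by simp
  next
    assume a: "Suc (numval B (x # xs)) = B ^ length (x # xs)"
    have "x = B - 1"
    proof (rule ccontr)
      assume "x \<noteq> B - 1"
      then have "x + 2 \<le> B" using *(2) by linarith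
      then have "(x + 2) * B ^ length xs \<le> B * B ^ length xs" by (intro mult_le_mono1)
      moreover have "Suc (x * B ^ length xs + numval B xs) = B * B ^ length xs" using a by simp
      ultimately show False using *(1) by (simp add: algebra_simps)
    qed
    moreover have "Suc (numval B xs) = B ^ length xs"
    proof -
      have "B = Suc x" using \<open>x = B - 1\<close> *(2) by simp
      then have "B * B ^ length xs = x * B ^ length xs + B ^ length xs"
        by (metis add.commute mult_Suc)
      then show ?thesis using a by simp
    qed
    ultimately show "\<forall>y\<in>set (x # xs). y = B - 1" using IH by simp
  qed
qed simp

lemma numval_increment_max: "\<lbrakk>0 < B; \<forall>y\<in>set xs. y = B - 1\<rbrakk> \<Longrightarrow> numval B (increment B xs) = 0"
proof (induction xs)
  case (Cons x xs)
  then have "x + 1 = B" by simp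
  then show ?case using Cons by simp
qed simp

lemma numval_increment: "\<lbrakk>xs \<in> lists {..<B}; \<not> (\<forall>y\<in>set xs. y = B - 1)\<rbrakk> \<Longrightarrow> numval B (increment B xs) = Suc (numval B xs)"
proof (induction xs)
  case (Cons x xs)
  show ?case
  proof (cases "\<forall>y\<in>set xs. y = B - 1")
    case True
    then have "x + 1 < B" using Cons.prems by auto
    have z: "numval B (increment B xs) = 0" using numval_increment_max[of B xs] True \<open>x + 1 < B\<close> by simp
    have "Suc (numval B xs) = B ^ length xs" using numval_max[of xs B] Cons.prems True by simp
    then show ?thesis using True z \<open>x + 1 < B\<close> by simp
  next
    case False
    then have "increment B (x # xs) = x # increment B xs" by (simp only: increment.simps if_False)
    then show ?thesis using Cons False by simp
  qed
qed simp

lemma numval_inj: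
  "\<lbrakk>xs \<in> lists {..<B}; ys \<in> lists {..<B}; length xs = length ys; numval B xs = numval B ys\<rbrakk> \<Longrightarrow> xs = ys"
proof (induction xs arbitrary: ys)
  case (Cons x xs)
  from Cons.prems(3) obtain y zs where ys: "ys = y # zs" "length zs = length xs"
    by (cases ys) simp_all
  have "xs \<in> lists {..<B}" "zs \<in> lists {..<B}" using Cons.prems(1,2) ys(1) by simp_all
  then have l: "numval B xs < B ^ length xs" "numval B zs < B ^ length xs"
    using numval_less[of xs B] numval_less[of zs B] ys(2) by simp_all
  have e: "x * B ^ length xs + numval B xs = y * B ^ length xs + numval B zs"
    using Cons.prems ys by simp
  have div: "(u * m + v) div m = u" if "v < m" for u v m :: nat
    using that by (subst div_mult_self3) auto
  have "x = y" using div[OF l(1), of x] div[OF l(2), of y] e by simp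
  then show ?case using Cons.IH[of zs] Cons.prems ys e by simp
qed simp

definition counter :: "nat \<Rightarrow> nat \<Rightarrow> nat \<Rightarrow> nat list" where
  "counter B n k = (increment B ^^ k) (replicate n 0)"

lemma counter_0: "counter B n 0 = replicate n 0" and counter_Suc: "counter B n (Suc k) = increment B (counter B n k)"
  by (simp_all add: counter_def)

lemma length_counter [simp]: "length (counter B n k) = n"
  by (induction k) (simp_all add: counter_0 counter_Suc)

lemma counter_in: "0 < B \<Longrightarrow> counter B n k \<in> lists {..<B}"
proof (induction k)
  case 0
  then show ?case by (simp add: counter_0 in_lists_conv_set)
next
  case (Suc k)
  then show ?case unfolding counter_Suc by (intro increment_in)
qed

lemma numval_counter: "\<lbrakk>0 < B; k < B ^ n\<rbrakk> \<Longrightarrow> numval B (counter B n k) = k"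
proof (induction k)
  case 0
  have "numval B (replicate n 0) = 0" by (induction n) auto
  then show ?case by (simp add: counter_0)
next
  case (Suc k)
  then show ?case
    using numval_increment[of "counter B n k" B] numval_max[of "counter B n k" B] counter_in[of B n k]
    by (simp add: counter_Suc)
qed

lemma counter_max: "\<lbrakk>0 < B; k < B ^ n\<rbrakk> \<Longrightarrow> (\<forall>y\<in>set (counter B n k). y = B - 1) \<longleftrightarrow> Suc k = B ^ n"
  using numval_max[of "counter B n k" B] counter_in[of B n k] numval_counter[of B k n] by simp

lemma counter_surj:
  assumes "0 < B" "xs \<in> lists {..<B}"
  shows "\<exists>k < B ^ length xs. counter B (length xs) k = xs"
proof -
  have *: "numval B xs < B ^ length xs" using numval_less assms by blast
  then have "counter B (length xs) (numval B xs) = xs"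
    using numval_inj[of "counter B (length xs) (numval B xs)" B xs] numval_counter[of B _ "length xs"] counter_in assms
    by simp
  with * show ?thesis by blast
qed

section \<open>Simulation in several steps\<close>

text \<open>
  If \<open>T\<close> performs each step of \<open>R\<close> in several steps of its own, without accepting in between unless the
  starting configuration is already accepting, then \<open>T\<close> accepts iff \<open>R\<close> reaches an accepting element.
  Where \<open>R\<close> has no successor, \<open>T\<close> may run forever, as an unsuccessful search does.
\<close>

lemma macro_steps:
  assumes W: "c0 \<in> W" "\<And>c d. \<lbrakk>c \<in> W; (c, d) \<in> R\<rbrakk> \<Longrightarrow> d \<in> W"
    and step: "\<And>c d. \<lbrakk>c \<in> W; (c, d) \<in> R\<rbrakk> \<Longrightarrow>
      \<exists>m>0. (T ^^ m) (enc c) = enc d \<and> (\<forall>j<m. Goal ((T ^^ j) (enc c)) \<longrightarrow> A c)"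
    and stuck: "\<And>c j. \<lbrakk>c \<in> W; c \<notin> Domain R; Goal ((T ^^ j) (enc c))\<rbrakk> \<Longrightarrow> A c"
    and acc: "\<And>c. \<lbrakk>c \<in> W; A c\<rbrakk> \<Longrightarrow> Goal (enc c)"
  shows "(\<exists>t. Goal ((T ^^ t) (enc c0))) \<longleftrightarrow> (\<exists>c. (c0, c) \<in> R\<^sup>* \<and> A c)"
proof
  assume "\<exists>t. Goal ((T ^^ t) (enc c0))"
  then obtain t where "Goal ((T ^^ t) (enc c0))" ..
  then show "\<exists>c. (c0, c) \<in> R\<^sup>* \<and> A c" using W(1)
  proof (induction t arbitrary: c0 rule: less_induct)
    case (less t)
    show ?case
    proof (cases "c0 \<in> Domain R")
      case False then show ?thesis using stuck less.prems by blast
    next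
      case True
      then obtain d where d: "(c0, d) \<in> R" by blast
      obtain m where m: "m > 0" "(T ^^ m) (enc c0) = enc d" "\<forall>j<m. Goal ((T ^^ j) (enc c0)) \<longrightarrow> A c0"
        using step[OF less.prems(2) d] by blast
      show ?thesis
      proof (cases "t < m")
        case True then show ?thesis using m less.prems by blast
      next
        case False
        then have "t = (t - m) + m" by simp
        then have "(T ^^ t) (enc c0) = (T ^^ (t - m)) (enc d)" by (metis m(2) funpow_add comp_apply)
        then obtain c where "(d, c) \<in> R\<^sup>*" "A c"
          using less.IH[of "t - m" d] less.prems m(1) False W(2) d by auto
        then show ?thesis using d by (meson converse_rtrancl_into_rtrancl)
      qed
    qed
  qed
next
  assume "\<exists>c. (c0, c) \<in> R\<^sup>* \<and> A c"
  then obtain c where c: "(c0, c) \<in> R\<^sup>*" "A c" by blast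
  have "c \<in> W \<and> (\<exists>t. (T ^^ t) (enc c0) = enc c)" using c(1)
  proof (induction rule: rtrancl_induct)
    case base
    have "(T ^^ 0) (enc c0) = enc c0" by simp
    then show ?case using W(1) by blast
  next
    case (step c d)
    then obtain t where t: "(T ^^ t) (enc c0) = enc c" "c \<in> W" by blast
    obtain m where "(T ^^ m) (enc c) = enc d" using assms(3)[OF t(2) step(2)] by blast
    then have "(T ^^ (m + t)) (enc c0) = enc d" using t by (simp add: funpow_add)
    then show ?case using W(2) step(2) t(2) by blast
  qed
  then obtain t where "(T ^^ t) (enc c0) = enc c" "c \<in> W" by blast
  then show "\<exists>t. Goal ((T ^^ t) (enc c0))" using acc c(2) by metis
qed

text \<open>
  Before the first visit to \<open>P\<close> the orbit cannot repeat a value. Hence a deterministic automaton that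
  accepts does so within as many steps as it has configurations.
\<close>

lemma pigeonhole_orbit:
  assumes "finite S" "\<And>t. y t \<in> S" "\<And>t. y (Suc t) = g (y t)" "P (y t)"
  shows "\<exists>s < card S. P (y s)"
proof -
  obtain t where t: "P (y t)" "\<forall>s<t. \<not> P (y s)"
    using assms(4) exists_least_iff[of "\<lambda>t. P (y t)"] by blast
  have shift: "y (a + i) = y (b + i)" if "y a = y b" for a b i
    using that by (induction i) (simp_all add: assms(3))
  have "inj_on y {..t}"
  proof (rule linorder_inj_onI)
    fix a b assume ab: "a < b" "a \<in> {..t}" "b \<in> {..t}"
    show "y a \<noteq> y b"
    proof
      assume "y a = y b"
      then have "y (a + (t - b)) = y (b + (t - b))" by (rule shift)
      then show False using ab t by (metis add_diff_inverse_nat atMost_iff linorder_not_less nat_add_left_cancel_less add.commute)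
    qed
  qed auto
  then have "card {..t} \<le> card S" using assms(1,2) by (intro card_inj_on_le) auto
  then show ?thesis using t by (intro exI[of _ t]) simp
qed

section \<open>Serpentine tracks\<close>

text \<open>
  The tape of an automaton is folded into \<open>n\<close> columns. Track \<open>j\<close> consists of the squares \<open>j * n\<close> to
  \<open>(j + 1) * n - 1\<close>, laid out from left to right if \<open>j\<close> is even and from right to left if \<open>j\<close> is odd. At
  the end of a track the head then stays in its column, so that a move always leads to the same or an
  adjacent cell; moreover, odd tracks can be used to reverse a word.
\<close>

definition column :: "int \<Rightarrow> int \<Rightarrow> int" where
  "column n p = (if even (p div n) then p mod n else n - 1 - p mod n)"

definition place :: "int \<Rightarrow> int \<Rightarrow> int \<Rightarrow> int" where
  "place n j i = j * n + (if even j then i else n - 1 - i)"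

lemma place_div: "\<lbrakk>0 \<le> i; i < n\<rbrakk> \<Longrightarrow> place n j i div n = j"
  and column_place: "\<lbrakk>0 \<le> i; i < n\<rbrakk> \<Longrightarrow> column n (place n j i) = i"
proof -
  assume i: "0 \<le> i" "i < n"
  define r where "r = (if even j then i else n - 1 - i)"
  have r: "0 \<le> r" "r < n" using i by (auto simp: r_def)
  have p: "place n j i = j * n + r" by (simp add: place_def r_def)
  show d: "place n j i div n = j" using r unfolding p by simp
  have "place n j i mod n = r" using r unfolding p by simp
  then show "column n (place n j i) = i" by (simp add: column_def d r_def)
qed

lemma place_column: "0 < n \<Longrightarrow> place n (p div n) (column n p) = p"
  by (simp add: place_def column_def)

lemma column_bounds: "0 < n \<Longrightarrow> 0 \<le> column n p \<and> column n p < n"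
  by (auto simp: column_def) (use pos_mod_bound[of n p] pos_mod_sign[of n p] in linarith)+

lemma place_eq_iff: "\<lbrakk>0 \<le> i; i < n\<rbrakk> \<Longrightarrow> place n j i = p \<longleftrightarrow> j = p div n \<and> i = column n p"
  using place_div[of i n j] column_place[of i n j] place_column[of n p] by fastforce

definition direction :: "int \<Rightarrow> head_move \<Rightarrow> int" where
  "direction j d = (if even j then offset d else - offset d)"

text \<open>
  Within a track a move of the automaton is a move by \<open>direction j d\<close> between columns; where this
  would leave the word, the head changes the track instead of the column.
\<close>

lemma move_on_tracks:
  fixes n p :: int
  assumes n: "0 < n"
  defines "j \<equiv> p div n" and "i \<equiv> column n p"
  shows "0 \<le> i + direction j d \<Longrightarrow> i + direction j d < n \<Longrightarrow>
      (p + offset d) div n = j \<and> column n (p + offset d) = i + direction j d" (is "_ \<Longrightarrow> _ \<Longrightarrow> ?in")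
    and "\<not> (0 \<le> i + direction j d \<and> i + direction j d < n) \<Longrightarrow>
      (p + offset d) div n = j + offset d \<and> column n (p + offset d) = i" (is "_ \<Longrightarrow> ?out")
proof -
  have p: "p = place n j i" using place_column[OF n, of p] by (simp add: j_def i_def)
  have i: "0 \<le> i" "i < n" using column_bounds[OF n, of p] by (simp_all add: i_def)
  show ?in if "0 \<le> i + direction j d" "i + direction j d < n"
  proof -
    have "p + offset d = place n j (i + direction j d)"
      unfolding p by (simp add: place_def direction_def)
    then show ?thesis using that by (simp add: place_div column_place)
  qed
  show ?out if out: "\<not> (0 \<le> i + direction j d \<and> i + direction j d < n)"
  proof -
    have "p + offset d = place n (j + offset d) i"
      unfolding p using out i by (cases d) (auto simp: place_def direction_def algebra_simps split: if_splits)
    then show ?thesis using i by (simp add: place_div column_place)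
  qed
qed

text \<open>
  The word read along the first \<open>K\<close> tracks. The function \<open>\<rho>\<close> gives the content of a cell on each track;
  its first argument tells whether the cell is the first one.
\<close>

definition snake :: "nat \<Rightarrow> (bool \<Rightarrow> 'c \<Rightarrow> nat \<Rightarrow> 'd) \<Rightarrow> 'c list \<Rightarrow> 'd list" where
  "snake K \<rho> c = concat (map (\<lambda>j. (if even j then id else rev)
      (map (\<lambda>i. \<rho> (i = 0) (c ! i) j) [0..<length c])) [0..<K])"

lemma nth_concat_uniform:
  "\<lbrakk>\<forall>xs\<in>set xss. length xs = n; p < length xss * n\<rbrakk> \<Longrightarrow> concat xss ! p = xss ! (p div n) ! (p mod n)"
proof (induction xss arbitrary: p)
  case (Cons xs xss)
  have n: "n > 0" using Cons.prems by (cases n) auto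
  show ?case
  proof (cases "p < n")
    case True then show ?thesis using Cons.prems by (simp add: nth_append)
  next
    case False
    then have "p = (p - n) + n" by simp
    then have "p div n = Suc ((p - n) div n)" "p mod n = (p - n) mod n"
      using n False by (simp_all add: le_div_geq le_mod_geq)
    then show ?thesis using Cons.IH[of "p - n"] Cons.prems False by (simp add: nth_append)
  qed
qed simp

lemma length_snake [simp]: "length (snake K \<rho> c) = K * length c"
  by (induction K) (simp_all add: snake_def)

lemma nth_snake:
  assumes "p < K * length c"
  defines "i \<equiv> nat (column (int (length c)) (int p))"
  shows "snake K \<rho> c ! p = \<rho> (i = 0) (c ! i) (p div length c)"
proof -
  define n where "n = length c"
  define row where "row j = (if even j then id else rev) (map (\<lambda>i. \<rho> (i = 0) (c ! i) j) [0..<n])" for j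
  have n: "0 < n" using assms(1) by (cases "length c") (auto simp: n_def)
  have "snake K \<rho> c ! p = map row [0..<K] ! (p div n) ! (p mod n)"
    unfolding snake_def row_def[symmetric] n_def[symmetric]
    by (rule nth_concat_uniform) (use assms(1) in \<open>auto simp: row_def n_def\<close>)
  also have "p div n < K" using assms(1) by (simp add: n_def less_mult_imp_div_less)
  then have "map row [0..<K] ! (p div n) = row (p div n)" by simp
  also have "row (p div n) ! (p mod n) = \<rho> (i = 0) (c ! i) (p div n)"
  proof -
    have m: "p mod n < n" using n by simp
    have "i = (if even (p div n) then p mod n else n - 1 - p mod n)"
      using m unfolding i_def n_def[symmetric] column_def
      by (auto simp: zdiv_int[symmetric] zmod_int[symmetric] nat_diff_distrib)
    then show ?thesis using m by (auto simp: row_def rev_nth)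
  qed
  finally show ?thesis by (simp add: n_def)
qed

lemma snake_in:
  assumes "\<And>f a j. \<lbrakk>a \<in> \<Gamma>; j < K\<rbrakk> \<Longrightarrow> \<rho> f a j \<in> \<Delta>" "c \<in> lists \<Gamma>"
  shows "snake K \<rho> c \<in> lists \<Delta>"
  using assms by (auto simp: snake_def in_lists_conv_set)

section \<open>Simulating a family of machines on serpentine tracks\<close>

text \<open>
  The squares visited form an interval containing \<open>0\<close>, so a bound on their number bounds the distance
  from the start.
\<close>

lemma reachable_head_bound:
  assumes lb: "linear_bounded \<Delta> M E" and w: "w \<in> lists \<Delta>" "w \<noteq> []" and E: "0 < E"
    and r: "(q, t, h) \<in> reachable M w"
  shows "\<bar>h\<bar> < int (E * length w)"
proof -
  define U where "U = squares_used M w"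
  have "0 < E * length w" using w(2) E by simp
  moreover have fin: "finite U" and "card U \<le> max 1 (E * length w)"
    using lb w(1) by (simp_all add: linear_bounded_def U_def)
  ultimately have card: "card U \<le> E * length w" by linarith
  have conn: "{min 0 (snd (snd c))..max 0 (snd (snd c))} \<subseteq> U" if "c \<in> reachable M w" for c
    using that
  proof (induction rule: reachable_induct)
    case init
    have "(start_state M, fst (snd (init_config M w)), 0) \<in> reachable M w"
      using reachable_init[of M w] by (simp add: init_config_def)
    then show ?case by (auto simp: init_config_def U_def squares_used_def)
  next
    case (step c d)
    obtain q t h where c: "c = (q, t, h)" by (metis prod_cases3)
    obtain q' t' h' where d: "d = (q', t', h')" by (metis prod_cases3)
    have "h' \<in> U" using reachable_step[OF step.hyps] unfolding d U_def squares_used_def by blast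
    obtain m where "h' = h + offset m" using step.hyps(2) unfolding c d
      by (auto split: option.splits prod.splits)
    then have "\<bar>h' - h\<bar> \<le> 1" by (cases m) auto
    show ?case
    proof
      fix p assume p: "p \<in> {min 0 (snd (snd d))..max 0 (snd (snd d))}"
      show "p \<in> U"
      proof (cases "p = h'")
        case True then show ?thesis using \<open>h' \<in> U\<close> by simp
      next
        case False
        then have "p \<in> {min 0 (snd (snd c))..max 0 (snd (snd c))}"
          using p \<open>\<bar>h' - h\<bar> \<le> 1\<close> by (auto simp: c d)
        then show ?thesis using step.IH by blast
      qed
    qed
  qed
  have "{min 0 h..max 0 h} \<subseteq> U" using conn[OF r] by simp
  then have "card {min 0 h..max 0 h} \<le> E * length w"
    using card_mono[OF fin] card le_trans by blast
  moreover have "card {min 0 h..max 0 h} = nat (\<bar>h\<bar> + 1)" by (cases "0 \<le> h") auto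
  ultimately show ?thesis by linarith
qed

definition tstep :: "'b dtm \<Rightarrow> 'b config \<Rightarrow> 'b config" where
  "tstep M c = (case step M c of None \<Rightarrow> c | Some d \<Rightarrow> d)"

lemma reachable_iff_tstep: "c \<in> reachable M w \<longleftrightarrow> (\<exists>t. c = (tstep M ^^ t) (init_config M w))"
proof
  assume "c \<in> reachable M w"
  then show "\<exists>t. c = (tstep M ^^ t) (init_config M w)"
  proof (induction rule: reachable_induct)
    case init then show ?case by (intro exI[of _ 0]) simp
  next
    case (step c d)
    then obtain t where "c = (tstep M ^^ t) (init_config M w)" by blast
    moreover have "tstep M c = d" using step.hyps(2) by (simp add: tstep_def)
    ultimately show ?case by (intro exI[of _ "Suc t"]) simp
  qed
next
  assume "\<exists>t. c = (tstep M ^^ t) (init_config M w)"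
  then obtain t where "c = (tstep M ^^ t) (init_config M w)" ..
  then show "c \<in> reachable M w"
  proof (induction t arbitrary: c)
    case 0 then show ?case by (simp add: reachable_init)
  next
    case (Suc t)
    define d where "d = (tstep M ^^ t) (init_config M w)"
    have d: "d \<in> reachable M w" "c = tstep M d" using Suc by (simp_all add: d_def)
    show ?case
    proof (cases "step M d")
      case None then show ?thesis using d by (simp add: tstep_def)
    next
      case (Some e) then show ?thesis using d reachable_step[OF d(1) Some] by (simp add: tstep_def)
    qed
  qed
qed

text \<open>
  The part of the simulated tape that lies in one column, and the head if it is there: its track, the
  index of the automaton within a family, and the state.
\<close>

type_synonym ('b, 'k) mcell = "(int \<Rightarrow> 'b tape_symbol) \<times> (int \<times> 'k \<times> nat) option"

text \<open>
  The action of the head in a column: its track, the index of its automaton, the next state, the symbol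
  to be written, and the move.
\<close>

definition act :: "('k \<Rightarrow> 'b dtm) \<Rightarrow> ('b, 'k) mcell \<Rightarrow>
    (int \<times> 'k \<times> nat \<times> 'b tape_symbol \<times> head_move) option" where
  "act M x = (case snd x of None \<Rightarrow> None
     | Some (j, k, q) \<Rightarrow> Some (j, k, case delta (M k) q (fst x j) of
           None \<Rightarrow> (q, fst x j, Stay) | Some y \<Rightarrow> y))"

text \<open>
  The new content of a column is determined by the column and its neighbours. A missing neighbour means
  that the column is at an end of the word, where the head changes its track.
\<close>

definition local_step :: "('k \<Rightarrow> 'b dtm) \<Rightarrow> ('b, 'k) mcell option \<Rightarrow> ('b, 'k) mcell \<Rightarrow>
    ('b, 'k) mcell option \<Rightarrow> ('b, 'k) mcell" where
  "local_step M l x r = (case act M x of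
       Some (j, k, q, s, d) \<Rightarrow> ((fst x)(j := s),
          if direction j d = 0 then Some (j, k, q)
          else if (direction j d = 1 \<and> r = None) \<or> (direction j d = -1 \<and> l = None)
            then Some (j + offset d, k, q)
          else None)
     | None \<Rightarrow> (fst x, case Option.bind l (act M) of
          Some (j, k, q, s, d) \<Rightarrow> if direction j d = 1 then Some (j, k, q) else None
        | None \<Rightarrow> (case Option.bind r (act M) of
            Some (j, k, q, s, d) \<Rightarrow> if direction j d = -1 then Some (j, k, q) else None
          | None \<Rightarrow> None)))"

text \<open>
  The content of column \<open>i\<close>. Outside the \<open>2 * J\<close> tracks in use the tape is replaced by blanks, so that
  only finitely many contents are possible.
\<close>

definition enc_cell :: "int \<Rightarrow> nat \<Rightarrow> 'k \<Rightarrow> 'b config \<Rightarrow> nat \<Rightarrow> ('b, 'k) mcell" where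
  "enc_cell J n k c i = (case c of (q, t, h) \<Rightarrow>
     (\<lambda>j. if - J \<le> j \<and> j < J then t (place (int n) j (int i)) else Blank,
      if column (int n) h = int i then Some (h div int n, k, q) else None))"

lemma direction_cases: "direction j d = 0 \<or> direction j d = 1 \<or> direction j d = -1"
  by (cases d) (auto simp: direction_def)

lemma track_bounds:
  fixes N J h :: int
  assumes N: "0 < N" and h: "- J * N \<le> h" "h < J * N"
  shows "- J \<le> h div N" "h div N < J"
proof -
  define j where "j = h div N"
  have *: "h = j * N + h mod N" "0 \<le> h mod N" "h mod N < N" using N by (simp_all add: j_def)
  show "- J \<le> h div N"
  proof (rule ccontr)
    assume "\<not> - J \<le> h div N"
    then have "(j + 1) * N \<le> - J * N" using N by (intro mult_right_mono) (auto simp: j_def)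
    then show False using h(1) * by (simp add: algebra_simps)
  qed
  show "h div N < J"
  proof (rule ccontr)
    assume "\<not> h div N < J"
    then have "J * N \<le> j * N" using N by (intro mult_right_mono) (auto simp: j_def)
    then show False using h(2) * by linarith
  qed
qed

text \<open>
  Applying the local rule in every column performs one step of the automaton. Halting configurations are
  repeated, as \<open>tstep\<close> is total.
\<close>

lemma local_step_enc:
  assumes h: "- J * int n \<le> h" "h < J * int n" and i: "i < n"
  shows "local_step M (if i = 0 then None else Some (enc_cell J n k (q, t, h) (i - 1)))
      (enc_cell J n k (q, t, h) i)
      (if Suc i < n then Some (enc_cell J n k (q, t, h) (Suc i)) else None)
    = enc_cell J n k (tstep (M k) (q, t, h)) i"
proof -
  define N where "N = int n"
  have N: "0 < N" using i by (simp add: N_def)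
  define j where "j = h div N"
  define c where "c = column N h"
  have j: "- J \<le> j" "j < J" using track_bounds[OF N, of J h] h by (simp_all add: j_def N_def)
  have c: "0 \<le> c" "c < N" using column_bounds[OF N, of h] by (simp_all add: c_def)
  obtain q' s' d where res: "(case delta (M k) q (t h) of None \<Rightarrow> (q, t h, Stay) | Some y \<Rightarrow> y) = (q', s', d)"
    by (metis prod_cases3)
  have ts: "tstep (M k) (q, t, h) = (q', t(h := s'), h + offset d)"
    using res by (auto simp: tstep_def split: option.splits prod.splits)
  have pl: "place N j' (int i') = h \<longleftrightarrow> j' = j \<and> int i' = c" if "i' < n" for i' j'
    using place_eq_iff[of "int i'" N j' h] that by (simp add: N_def j_def c_def)
  have act: "act M (enc_cell J n k (q, t, h) i') = (if int i' = c then Some (j, k, q', s', d) else None)"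
    if "i' < n" for i'
  proof (cases "int i' = c")
    case True
    then have "place N j (int i') = h" using pl[OF that, of j] by simp
    then have f: "fst (enc_cell J n k (q, t, h) i') j = t h"
      "snd (enc_cell J n k (q, t, h) i') = Some (j, k, q)"
      using True j by (simp_all add: enc_cell_def N_def[symmetric] j_def[symmetric] c_def[symmetric])
    show ?thesis using True unfolding act_def f option.case prod.case res by simp
  next
    case False
    then show ?thesis by (simp add: act_def enc_cell_def N_def[symmetric] c_def[symmetric])
  qed
  have fst_enc: "fst (enc_cell J n k (q', t(h := s'), h + offset d) i) =
     (if int i = c then (fst (enc_cell J n k (q, t, h) i))(j := s') else fst (enc_cell J n k (q, t, h) i))"
    using pl[OF i] j by (auto simp: enc_cell_def N_def[symmetric] fun_eq_iff)
  define e where "e = direction j d"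
  have snd_enc: "snd (enc_cell J n k (q', t(h := s'), h + offset d) i) =
     (if 0 \<le> c + e \<and> c + e < N then if c + e = int i then Some (j, k, q') else None
      else if c = int i then Some (j + offset d, k, q') else None)"
    using move_on_tracks[OF N, of h d]
    by (simp add: enc_cell_def N_def[symmetric] j_def[symmetric] c_def[symmetric] e_def)
  have e: "e = 0 \<or> e = 1 \<or> e = -1" unfolding e_def by (rule direction_cases)
  let ?L = "if i = 0 then None else Some (enc_cell J n k (q, t, h) (i - 1))"
  let ?R = "if Suc i < n then Some (enc_cell J n k (q, t, h) (Suc i)) else None"
  have actL: "Option.bind ?L (act M) = (if 0 < i \<and> int i = c + 1 then Some (j, k, q', s', d) else None)"
    using act[of "i - 1"] i by auto
  have actR: "Option.bind ?R (act M) = (if Suc i < n \<and> int i = c - 1 then Some (j, k, q', s', d) else None)"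
    using act[of "Suc i"] by auto
  have LR: "?L = None \<longleftrightarrow> i = 0" "?R = None \<longleftrightarrow> int i = N - 1" using i by (auto simp: N_def)
  have "local_step M ?L (enc_cell J n k (q, t, h) i) ?R =
     (fst (enc_cell J n k (q', t(h := s'), h + offset d) i),
      snd (enc_cell J n k (q', t(h := s'), h + offset d) i))"
  proof (cases "int i = c")
    case True
    then have "local_step M ?L (enc_cell J n k (q, t, h) i) ?R =
      ((fst (enc_cell J n k (q, t, h) i))(j := s'),
          if e = 0 then Some (j, k, q')
          else if (e = 1 \<and> int i = N - 1) \<or> (e = -1 \<and> i = 0) then Some (j + offset d, k, q') else None)"
      unfolding local_step_def act[OF i] LR by (simp add: e_def)
    then show ?thesis unfolding fst_enc snd_enc using True c e by auto
  next
    case False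
    then have "local_step M ?L (enc_cell J n k (q, t, h) i) ?R =
      (fst (enc_cell J n k (q, t, h) i),
        if 0 < i \<and> int i = c + 1 then (if e = 1 then Some (j, k, q') else None)
        else if Suc i < n \<and> int i = c - 1 then (if e = -1 then Some (j, k, q') else None) else None)"
      unfolding local_step_def act[OF i] actL actR by (simp add: e_def)
    moreover have "Suc i < n \<longleftrightarrow> int i < N - 1" using i by (simp add: N_def) linarith
    ultimately show ?thesis unfolding fst_enc snd_enc using False c e i by (auto simp: N_def)
  qed
  then show ?thesis by (simp add: ts)
qed

section \<open>Systems with oracles\<close>

lemma linear_bounded_mono: "\<lbrakk>linear_bounded \<Delta> M E; E \<le> E'\<rbrakk> \<Longrightarrow> linear_bounded \<Delta> M E'"
  unfolding linear_bounded_def by (meson le_trans max.mono mult_le_mono1 order_refl)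

lemma reachable_wf:
  assumes wf: "wf_dtm \<Delta> M" and w: "w \<in> lists \<Delta>" and r: "(q, t, h) \<in> reachable M w"
  shows "q \<in> states M \<and> (\<forall>p. t p \<in> tape_alphabet M)"
proof -
  have "fst c \<in> states M \<and> (\<forall>p. fst (snd c) p \<in> tape_alphabet M)" if "c \<in> reachable M w" for c
    using that
  proof (induction rule: reachable_induct)
    case init
    have "start_state M \<in> states M" "Blank \<in> tape_alphabet M"
      "\<And>a. a \<in> \<Delta> \<Longrightarrow> Input a \<in> tape_alphabet M"
      using wf unfolding wf_dtm_def by blast+
    moreover have "w ! nat p \<in> \<Delta>" if "0 \<le> p" "p < int (length w)" for p
      using w that by (auto simp: in_lists_conv_set)
    ultimately show ?case by (simp add: init_config_def)
  next
    case (step c d)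
    obtain q t h where c: "c = (q, t, h)" by (metis prod_cases3)
    obtain q' s' m where \<delta>: "delta M q (t h) = Some (q', s', m)" and d: "d = (q', t(h := s'), h + offset m)"
      using step.hyps(2) unfolding c by (auto split: option.splits)
    have "q \<in> states M" "t h \<in> tape_alphabet M" using step.IH by (simp_all add: c)
    from wf_delta[OF wf this \<delta>] show ?case using step.IH by (simp add: c d)
  qed
  from this[OF r] show ?thesis by simp
qed

lemma find_True_drop:
  "i < length xs \<Longrightarrow> find (\<lambda>_. True) (drop (Suc i) xs) = (if Suc i < length xs then Some (xs ! Suc i) else None)"
proof -
  have "find (\<lambda>_. True) ys = (if ys = [] then None else Some (hd ys))" for ys :: "'a list"
    by (cases ys) simp_all
  then show ?thesis by (simp add: hd_drop_conv_nth)
qed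

lemma last_option_take:
  "i < length xs \<Longrightarrow> last_option (take i xs) = (if i = 0 then None else Some (xs ! (i - 1)))"
  by (cases i) (simp_all add: last_option_def take_Suc_conv_app_nth)

lemma find_None_iff_nth: "find P xs = None \<longleftrightarrow> (\<forall>i<length xs. \<not> P (xs ! i))"
  by (auto simp: find_None_iff in_set_conv_nth)

lemma rtrancl_function: "(c, d) \<in> {(c, S c) |c. True}\<^sup>* \<longleftrightarrow> (\<exists>t. d = (S ^^ t) c)"
proof
  assume "(c, d) \<in> {(c, S c) |c. True}\<^sup>*"
  then show "\<exists>t. d = (S ^^ t) c"
  proof (induction rule: rtrancl_induct)
    case base show ?case by (intro exI[of _ 0]) simp
  next
    case (step d e)
    then obtain t where "d = (S ^^ t) c" by blast
    then show ?case using step.hyps(2) by (intro exI[of _ "Suc t"]) simp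
  qed
next
  assume "\<exists>t. d = (S ^^ t) c"
  then obtain t where "d = (S ^^ t) c" ..
  then show "(c, d) \<in> {(c, S c) |c. True}\<^sup>*"
  proof (induction t arbitrary: d)
    case (Suc t)
    then have "(c, (S ^^ t) c) \<in> {(c, S c) |c. True}\<^sup>*" by simp
    moreover have "((S ^^ t) c, d) \<in> {(c, S c) |c. True}" using Suc.prems by auto
    ultimately show ?case by (rule rtrancl_into_rtrancl)
  qed simp
qed

text \<open>
  Outside a query a cell holds a letter only; during a query it also holds a column of the simulated
  automaton and a digit of the step counter.
\<close>

type_synonym ('c, 'b, 'k) sim_cell = "'c \<times> (('b, 'k) mcell \<times> nat) option"
text \<open>
  The information exchanged in a sweep: the given information about the letters, the first and the
  last cell, a cell in which the automaton is in an accepting state, and a cell whose digit is not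
  maximal.
\<close>

type_synonym ('x, 'y) summary = "'x \<times> 'y option \<times> 'y option \<times> 'y option \<times> 'y option"

text \<open>
  A system whose sweep depends on the answer to a query. Each sweep of \<open>S\<close> is replaced by a simulation
  of the automaton for the language asked for, on the word \<open>snake K \<rho> c\<close> written along the tracks. In
  every round the automaton makes one step and the counter is increased. If an accepting state occurs,
  the answer is positive; if the counter reaches its maximum first, as many configurations have been
  inspected as there are words of this length over the alphabet \<open>MC\<close> of columns, and by
  \<open>pigeonhole_orbit\<close> the automaton will never accept. The family \<open>L\<close> allows queries to different languages, chosen by \<open>\<kappa>\<close>.
\<close>

theorem dcs_if_oracle_system:
  fixes \<iota> :: "'a \<Rightarrow> 'c" and F :: "'c list \<Rightarrow> 'x" and L :: "'k \<Rightarrow> 'b list set"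
  assumes fin: "finite \<Sigma>" "finite \<Gamma>" "finite I" and \<iota>: "\<iota> ` \<Sigma> \<subseteq> \<Gamma>" and rec: "recognizable \<Gamma> F"
    and L: "\<And>k. k \<in> I \<Longrightarrow> dcs \<Delta> (L k)"
    and \<kappa>: "\<And>c. \<lbrakk>c \<in> lists \<Gamma>; c \<noteq> []\<rbrakk> \<Longrightarrow> \<kappa> (F c) \<in> I"
    and \<rho>: "\<And>f a j. \<lbrakk>a \<in> \<Gamma>; j < K\<rbrakk> \<Longrightarrow> \<rho> f a j \<in> \<Delta>" and K: "0 < K"
    and closed: "\<And>b c. c \<in> lists \<Gamma> \<Longrightarrow> sweep (\<psi> b) F c \<in> lists \<Gamma>"
  defines "S \<equiv> \<lambda>c. sweep (\<psi> (snake K \<rho> c \<in> L (\<kappa> (F c)))) F c"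
  shows "dcs \<Sigma> {w \<in> lists \<Sigma>. if w = [] then e else \<exists>t. A (F ((S ^^ t) (map \<iota> w)))}"
proof -
  have "\<forall>k\<in>I. \<exists>p. wf_dtm \<Delta> (fst p) \<and> linear_bounded \<Delta> (fst p) (snd p) \<and>
     L k = {w \<in> lists \<Delta>. accepts (fst p) w}"
    using L unfolding dcs_def by fastforce
  then obtain p where p: "\<forall>k\<in>I. wf_dtm \<Delta> (fst (p k)) \<and> linear_bounded \<Delta> (fst (p k)) (snd (p k)) \<and>
     L k = {w \<in> lists \<Delta>. accepts (fst (p k)) w}" by metis
  define M where "M k = fst (p k)" for k
  \<comment> \<open>A common space bound; the successor makes it positive.\<close>
  define E where "E = Suc (\<Sum>k\<in>I. snd (p k))"
  have wf: "wf_dtm \<Delta> (M k)" and lb: "linear_bounded \<Delta> (M k) E" and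
    Lk: "L k = {w \<in> lists \<Delta>. accepts (M k) w}" if "k \<in> I" for k
  proof -
    have "snd (p k) \<le> E" unfolding E_def using member_le_sum[OF that, of "\<lambda>k. snd (p k)"] fin(3) by simp
    then show "wf_dtm \<Delta> (M k)" "linear_bounded \<Delta> (M k) E" "L k = {w \<in> lists \<Delta>. accepts (M k) w}"
      using p that linear_bounded_mono unfolding M_def by blast+
  qed
  define J where "J = int (E * K)"
  have "1 * K \<le> E * K" unfolding E_def by (intro mult_le_mono1) simp
  then have KJ: "int K \<le> J" unfolding J_def by linarith
  define Y where "Y = insert Blank (\<Union>k\<in>I. tape_alphabet (M k))"
  define Qs where "Qs = (\<Union>k\<in>I. states (M k))"
  have finYQ: "finite Y" "finite Qs" using wf fin(3) by (auto simp: Y_def Qs_def wf_dtm_def)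
  define TR where "TR = {f. \<forall>j. (j \<in> {-J..<J} \<longrightarrow> f j \<in> Y) \<and> (j \<notin> {-J..<J} \<longrightarrow> f j = Blank)}"
  have finTR: "finite TR" unfolding TR_def by (rule finite_set_of_finite_funs) (simp_all add: finYQ)
  define MC :: "('b, 'k) mcell set" where "MC = TR \<times> insert None (Some ` ({-J..<J} \<times> I \<times> Qs))"
  have finMC: "finite MC" using finTR finYQ fin(3) by (simp add: MC_def)
  have "((\<lambda>_. Blank), None) \<in> MC" by (simp add: MC_def TR_def Y_def)
  \<comment> \<open>With this base the counter has exactly as many values as there are words of columns.\<close>
  define B where "B = card MC"
  have B: "0 < B" unfolding B_def using finMC \<open>_ \<in> MC\<close> by (auto simp: card_gt_0_iff)
  define \<Gamma>' where "\<Gamma>' = \<Gamma> \<times> insert None (Some ` (MC \<times> {..<B}))"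
  have fin\<Gamma>': "finite \<Gamma>'" using finMC fin(2) by (simp add: \<Gamma>'_def)
  define acc where "acc x \<longleftrightarrow> (\<exists>m cnt j k q. snd x = Some (m, cnt) \<and> snd m = Some (j, k, q) \<and>
      q \<in> accept_states (M k))" for x :: "('c, 'b, 'k) sim_cell"
  define low where "low x \<longleftrightarrow> (\<exists>m cnt. snd x = Some (m, cnt) \<and> cnt \<noteq> B - 1)"
    for x :: "('c, 'b, 'k) sim_cell"
  define \<Phi> where "\<Phi> u = (F (map fst u), find (\<lambda>_. True) u, last_option u, find acc u, find low u)"
    for u :: "(('c, 'b, 'k) sim_cell) list"
  have rec\<Phi>: "recognizable \<Gamma>' \<Phi>"
    unfolding \<Phi>_def
    by (intro recognizable_Pair recognizable_find[OF fin\<Gamma>'] recognizable_last[OF fin\<Gamma>']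
        recognizable_map[OF rec]) (auto simp: \<Gamma>'_def)
  define \<phi>0 where "\<phi>0 X Xl x Xr = (case (X, Xl, Xr) of
      ((v, _, _, ac, lo), (vl, _, la, _, _), (vr, fi, _, _, lor)) \<Rightarrow> (case snd x of
        None \<Rightarrow> (fst x, Some ((\<lambda>j. if 0 \<le> j \<and> j < int K then Input (\<rho> (la = None) (fst x) (nat j)) else Blank,
            if la = None then Some (0, \<kappa> v, start_state (M (\<kappa> v))) else None), 0))
      | Some (m, cnt) \<Rightarrow>
          if ac \<noteq> None then (\<psi> True v vl (fst x) vr, None)
          else if lo = None then (\<psi> False v vl (fst x) vr, None)
          else (fst x, Some (local_step M (map_option (\<lambda>x. fst (the (snd x))) la) m
                               (map_option (\<lambda>x. fst (the (snd x))) fi),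
                 if lor = None then (cnt + 1) mod B else cnt))))"
    for X Xl Xr :: "('x, ('c, 'b, 'k) sim_cell) summary" and x
  \<comment> \<open>On words that do not arise from the simulation \<open>\<phi>0\<close> may leave the alphabet; the old letter is kept
    in this case.\<close>
  define \<phi> where "\<phi> X Xl x Xr = (if \<phi>0 X Xl x Xr \<in> \<Gamma>' then \<phi>0 X Xl x Xr else x)" for X Xl x Xr
  define T where "T = sweep \<phi> \<Phi>"
  have T_eq: "T u = map f [0..<length u]"
    if "\<And>i. i < length u \<Longrightarrow> \<phi>0 (\<Phi> u) (\<Phi> (take i u)) (u ! i) (\<Phi> (drop (Suc i) u)) = f i"
      "\<And>i. i < length u \<Longrightarrow> f i \<in> \<Gamma>'" for u f
    by (rule nth_equalityI) (simp_all add: T_def nth_sweep \<phi>_def that)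
  define idle :: "'c list \<Rightarrow> (('c, 'b, 'k) sim_cell) list" where
    "idle c = map (\<lambda>a. (a, None)) c" for c
  define Goal where "Goal X \<longleftrightarrow> A (fst X) \<and> (case fst (snd X) of Some (_, None) \<Rightarrow> True | _ \<Rightarrow> False)"
    for X :: "('x, ('c, 'b, 'k) sim_cell) summary"
  have fst_idle: "map fst (idle c) = c" for c by (simp add: idle_def comp_def)
  have round: "\<exists>m>0. (T ^^ m) (idle c) = idle (S c) \<and>
      (\<forall>j<m. Goal (\<Phi> ((T ^^ j) (idle c))) \<longrightarrow> A (F c))" if c: "c \<in> lists \<Gamma>" "c \<noteq> []" for c
  proof -
    define n where "n = length c"
    have n: "0 < n" using c(2) by (simp add: n_def)
    have c_in: "c ! i \<in> \<Gamma>" if "i < n" for i using c(1) that by (auto simp: n_def in_lists_conv_set)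
    define k where "k = \<kappa> (F c)"
    have k: "k \<in> I" using \<kappa>[OF c] by (simp add: k_def)
    define w where "w = snake K \<rho> c"
    have w: "w \<in> lists \<Delta>" unfolding w_def by (rule snake_in[OF _ c(1)], erule \<rho>, assumption)
    have len_w: "length w = K * n" by (simp add: w_def n_def)
    then have w0: "w \<noteq> []" using n K by auto
    define x where "x t = (tstep (M k) ^^ t) (init_config (M k) w)" for t
    have x_reach: "x t \<in> reachable (M k) w" for t unfolding reachable_iff_tstep x_def by blast
    have x_Suc: "x (Suc t) = tstep (M k) (x t)" for t by (simp add: x_def)
    have x_head: "- J * int n \<le> snd (snd (x t))" "snd (snd (x t)) < J * int n" for t
    proof -
      obtain q tp h where xt: "x t = (q, tp, h)" by (metis prod_cases3)
      have "\<bar>h\<bar> < int (E * length w)"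
        using reachable_head_bound[OF lb[OF k] w w0 _ x_reach[of t, unfolded xt]] by (simp add: E_def)
      also have "int (E * length w) = J * int n" by (simp add: J_def len_w)
      finally show "- J * int n \<le> snd (snd (x t))" "snd (snd (x t)) < J * int n" by (simp_all add: xt)
    qed
    define y where "y t i = enc_cell J n k (x t) i" for t i
    have y_in: "y t i \<in> MC" if "i < n" for t i
    proof -
      obtain q tp h where xt: "x t = (q, tp, h)" by (metis prod_cases3)
      have "q \<in> states (M k)" "\<And>p. tp p \<in> tape_alphabet (M k)"
        using reachable_wf[OF wf[OF k] w x_reach[of t, unfolded xt]] by auto
      then have 1: "q \<in> Qs" "\<And>p. tp p \<in> Y" using k by (auto simp: Qs_def Y_def)
      have "place (int n) (h div int n) (column (int n) h) = h" using n by (intro place_column) simp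
      have "- J \<le> h div int n" "h div int n < J"
        using track_bounds[of "int n" J h] x_head[of t] n by (simp_all add: xt)
      then show ?thesis using 1 k by (simp add: y_def enc_cell_def xt MC_def TR_def)
    qed
    have y_Suc: "y (Suc t) i = local_step M (if i = 0 then None else Some (y t (i - 1))) (y t i)
        (if Suc i < n then Some (y t (Suc i)) else None)" if "i < n" for t i
    proof -
      obtain q tp h where xt: "x t = (q, tp, h)" by (metis prod_cases3)
      have "- J * int n \<le> h" "h < J * int n" using x_head[of t] by (simp_all add: xt)
      then show ?thesis unfolding y_def x_Suc xt using local_step_enc[of J n h i M k q tp] that by simp
    qed
    define won where "won t \<longleftrightarrow> fst (x t) \<in> accept_states (M k)" for t
    have won_iff: "won t \<longleftrightarrow> (\<exists>i<n. \<exists>j k' q. snd (y t i) = Some (j, k', q) \<and> q \<in> accept_states (M k'))" for t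
    proof -
      obtain q tp h where xt: "x t = (q, tp, h)" by (metis prod_cases3)
      have "0 \<le> column (int n) h \<and> column (int n) h < int n" using n by (intro column_bounds) simp
      then have "\<exists>i<n. column (int n) h = int i" by (metis nat_less_iff int_nat_eq)
      then show ?thesis by (auto simp: won_def y_def enc_cell_def xt)
    qed
    have accepts: "w \<in> L k \<longleftrightarrow> (\<exists>t. won t)"
    proof -
      have "accepts (M k) w \<longleftrightarrow> (\<exists>c\<in>reachable (M k) w. fst c \<in> accept_states (M k))"
        unfolding accepts_def by (rule bex_cong) auto
      also have "\<dots> \<longleftrightarrow> (\<exists>t. won t)"
        unfolding won_def using x_reach by (metis reachable_iff_tstep x_def)
      finally show ?thesis using Lk[OF k] w by simp
    qed
    have bounded: "\<exists>t<B ^ n. won t" if "won t" for t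
    proof -
      define ys where "ys t = map (y t) [0..<n]" for t
      define g where "g zs = map (\<lambda>i. local_step M (if i = 0 then None else Some (zs ! (i - 1))) (zs ! i)
        (if Suc i < n then Some (zs ! (Suc i)) else None)) [0..<n]" for zs
      define P where "P zs \<longleftrightarrow> (\<exists>i<n. \<exists>j k' q. snd (zs ! i) = Some (j, k', q) \<and> q \<in> accept_states (M k'))"
        for zs :: "('b, 'k) mcell list"
      have P: "P (ys t) \<longleftrightarrow> won t" for t unfolding P_def ys_def won_iff by auto
      have "ys t \<in> {zs. set zs \<subseteq> MC \<and> length zs = n}" for t
        using y_in by (auto simp: ys_def)
      moreover have "ys (Suc t) = g (ys t)" for t
        unfolding ys_def g_def by (rule nth_equalityI) (use y_Suc[of _ t] in auto)
      ultimately have "\<exists>s<card {zs. set zs \<subseteq> MC \<and> length zs = n}. P (ys s)"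
        by (rule pigeonhole_orbit[OF finite_lists_length_eq[OF finMC]]) (use P that in blast)
      then show ?thesis using P by (simp add: card_lists_length_eq[OF finMC] B_def)
    qed
    define U where "U t = map (\<lambda>i. (c ! i, Some (y t i, counter B n t ! i))) [0..<n]" for t
    have len_U: "length (U t) = n" for t by (simp add: U_def)
    have nth_U: "U t ! i = (c ! i, Some (y t i, counter B n t ! i))" if "i < n" for t i
      using that by (simp add: U_def)
    have fst_U: "map fst (U t) = c" for t by (simp add: U_def comp_def n_def map_nth)
    have cnt: "counter B n t ! i < B" if "i < n" for t i
      using counter_in[OF B, of n t] that by (auto simp: in_lists_conv_set)
    have U_in: "(c ! i, Some (y t i, counter B n t ! i)) \<in> \<Gamma>'" if "i < n" for t i
      using c_in[OF that] y_in[OF that] cnt[OF that] by (simp add: \<Gamma>'_def)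
    have y0: "y 0 i = (\<lambda>j. if 0 \<le> j \<and> j < int K then Input (\<rho> (i = 0) (c ! i) (nat j)) else Blank,
            if i = 0 then Some (0, k, start_state (M k)) else None)" if i: "i < n" for i
    proof -
      have "(if - J \<le> j \<and> j < J then (if 0 \<le> place (int n) j (int i) \<and> place (int n) j (int i) < int (length w)
           then Input (w ! nat (place (int n) j (int i))) else Blank) else Blank)
        = (if 0 \<le> j \<and> j < int K then Input (\<rho> (i = 0) (c ! i) (nat j)) else Blank)" for j
      proof (cases "0 \<le> j \<and> j < int K")
        case True
        define P where "P = nat (place (int n) j (int i))"
        have "0 \<le> place (int n) j (int i)" using True i by (auto simp: place_def)
        then have P: "int P = place (int n) j (int i)" by (simp add: P_def)
        have d: "int P div int n = j" using i unfolding P by (intro place_div) simp_all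
        have cl: "column (int n) (int P) = int i" using i unfolding P by (intro column_place) simp_all
        have d': "P div n = nat j" using d by (metis nat_int zdiv_int)
        have "nat j < K" using True by linarith
        then have "P < K * n" using d' n by (metis div_less_iff_less_mult)
        then have "w ! P = \<rho> (i = 0) (c ! i) (nat j)"
          using nth_snake[of P K c \<rho>] cl d' by (simp add: w_def n_def)
        moreover have "place (int n) j (int i) < int (length w)"
          using \<open>P < K * n\<close> unfolding P[symmetric] len_w by (simp only: of_nat_less_iff)
        ultimately show ?thesis using True KJ \<open>0 \<le> place _ _ _\<close> by (auto simp: P_def)
      next
        case False
        have "\<not> (0 \<le> place (int n) j (int i) \<and> place (int n) j (int i) < int (length w))"
        proof
          assume a: "0 \<le> place (int n) j (int i) \<and> place (int n) j (int i) < int (length w)"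
          have d: "place (int n) j (int i) div int n = j" using i by (intro place_div) simp_all
          have "0 \<le> j" using a n d by (metis div_int_pos_iff of_nat_0_le_iff)
          moreover have "j < int K"
          proof (rule ccontr)
            assume "\<not> j < int K"
            then have "int K * int n \<le> j * int n" by (intro mult_right_mono) simp_all
            moreover have "j * int n \<le> place (int n) j (int i)" using i by (simp add: place_def)
            ultimately show False using a len_w by simp
          qed
          ultimately show False using False by simp
        qed
        then show ?thesis using False by auto
      qed
      moreover have "column (int n) 0 = 0" by (simp add: column_def)
      ultimately show ?thesis
        using i by (auto simp: y_def x_def enc_cell_def init_config_def)
    qed
    have start: "T (idle c) = U 0"
    proof -
      have "T (idle c) = map (\<lambda>i. (c ! i, Some (y 0 i, 0))) [0..<length (idle c)]"
      proof (rule T_eq)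
        fix i assume "i < length (idle c)"
        then have i: "i < n" "i < length c" by (simp_all add: idle_def n_def)
        have ci: "idle c ! i = (c ! i, None)" using i by (simp add: idle_def)
        have la: "(last_option (take i (idle c)) = None) = (i = 0)"
          using i by (simp add: last_option_take idle_def)
        show "\<phi>0 (\<Phi> (idle c)) (\<Phi> (take i (idle c))) (idle c ! i) (\<Phi> (drop (Suc i) (idle c)))
          = (c ! i, Some (y 0 i, 0))"
          unfolding \<phi>0_def \<Phi>_def prod.case ci fst_conv snd_conv option.case la fst_idle
          by (simp add: y0[OF i(1)] k_def)
        show "(c ! i, Some (y 0 i, 0)) \<in> \<Gamma>'" using c_in y_in i B by (simp add: \<Gamma>'_def)
      qed
      then show ?thesis by (simp add: U_def counter_0 idle_def n_def cong: map_cong)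
    qed
    have acc_U: "find acc (U t) \<noteq> None \<longleftrightarrow> won t" for t
      unfolding find_None_iff_nth len_U won_iff by (auto simp: nth_U acc_def)
    have low_U: "find low (drop m (U t)) = None \<longleftrightarrow> (\<forall>z\<in>set (drop m (counter B n t)). z = B - 1)" for t m
      unfolding find_None_iff_nth all_set_conv_all_nth by (auto simp: len_U nth_U low_def)
    have low_U0: "find low (U t) = None \<longleftrightarrow> Suc t = B ^ n" if "t < B ^ n" for t
      using low_U[of 0 t] counter_max[OF B that] by simp
    have step: "T (U t) = U (Suc t)" if "t < B ^ n" "\<not> won t" "Suc t \<noteq> B ^ n" for t
    proof -
      have "T (U t) = map (\<lambda>i. (c ! i, Some (y (Suc t) i, counter B n (Suc t) ! i))) [0..<length (U t)]"
      proof (rule T_eq)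
        fix i assume "i < length (U t)"
        then have i: "i < n" by (simp add: len_U)
        show "(c ! i, Some (y (Suc t) i, counter B n (Suc t) ! i)) \<in> \<Gamma>'" using U_in[OF i] .
        have ac: "find acc (U t) = None" using acc_U[of t] that(2) by blast
        have lo: "find low (U t) \<noteq> None" using low_U0 that by blast
        have la: "map_option (\<lambda>x. fst (the (snd x))) (last_option (take i (U t))) =
           (if i = 0 then None else Some (y t (i - 1)))"
          using i by (simp add: last_option_take len_U nth_U)
        have fi: "map_option (\<lambda>x. fst (the (snd x))) (find (\<lambda>_. True) (drop (Suc i) (U t))) =
           (if Suc i < n then Some (y t (Suc i)) else None)"
          using i by (simp add: find_True_drop len_U nth_U)
        have cs: "(if find low (drop (Suc i) (U t)) = None then (counter B n t ! i + 1) mod B else counter B n t ! i)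
          = counter B n (Suc t) ! i"
          using i unfolding low_U counter_Suc by (subst nth_increment) simp_all
        show "\<phi>0 (\<Phi> (U t)) (\<Phi> (take i (U t))) (U t ! i) (\<Phi> (drop (Suc i) (U t)))
          = (c ! i, Some (y (Suc t) i, counter B n (Suc t) ! i))"
          unfolding \<phi>0_def \<Phi>_def prod.case nth_U[OF i] fst_conv snd_conv option.case la fi cs y_Suc[OF i]
          using ac lo by simp
      qed
      then show ?thesis by (simp add: U_def len_U)
    qed
    have finish: "T (U t) = idle (sweep (\<psi> (won t)) F c)" if "t < B ^ n" "won t \<or> Suc t = B ^ n" for t
    proof -
      have "T (U t) = map (\<lambda>i. (\<psi> (won t) (F c) (F (take i c)) (c ! i) (F (drop (Suc i) c)), None)) [0..<length (U t)]"
      proof (rule T_eq)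
        fix i assume "i < length (U t)"
        then have i: "i < n" by (simp add: len_U)
        have "sweep (\<psi> (won t)) F c ! i \<in> \<Gamma>" using closed[OF c(1), of "won t"] i
          by (auto simp: in_lists_conv_set n_def)
        then show "(\<psi> (won t) (F c) (F (take i c)) (c ! i) (F (drop (Suc i) c)), None) \<in> \<Gamma>'"
          using i by (simp add: \<Gamma>'_def nth_sweep n_def)
        have m: "map fst (take i (U t)) = take i c" "map fst (drop (Suc i) (U t)) = drop (Suc i) c"
          by (simp_all add: take_map[symmetric] drop_map[symmetric] fst_U)
        show "\<phi>0 (\<Phi> (U t)) (\<Phi> (take i (U t))) (U t ! i) (\<Phi> (drop (Suc i) (U t)))
          = (\<psi> (won t) (F c) (F (take i c)) (c ! i) (F (drop (Suc i) c)), None)"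
          unfolding \<phi>0_def \<Phi>_def prod.case nth_U[OF i] fst_conv snd_conv option.case m fst_U
          using acc_U[of t] low_U0[OF that(1)] that(2) by auto
      qed
      then show ?thesis by (simp add: idle_def sweep_def len_U n_def comp_def)
    qed
    \<comment> \<open>The round in which the query is answered.\<close>
    define t1 where "t1 = (LEAST t. won t \<or> Suc t = B ^ n)"
    have Bn: "0 < B ^ n" using B by simp
    have ex: "won (B ^ n - 1) \<or> Suc (B ^ n - 1) = B ^ n" using Bn by simp
    have t1: "won t1 \<or> Suc t1 = B ^ n" unfolding t1_def using ex by (rule LeastI)
    have "t1 \<le> B ^ n - 1" unfolding t1_def using ex by (rule Least_le)
    then have t1_less: "t1 < B ^ n" using Bn by linarith
    have before: "\<not> won s \<and> Suc s \<noteq> B ^ n" if "s < t1" for s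
      using not_less_Least[OF that[unfolded t1_def]] by blast
    have ans: "won t1 \<longleftrightarrow> w \<in> L k"
    proof
      assume "w \<in> L k"
      then obtain t where t: "t < B ^ n" "won t" using accepts bounded by blast
      show "won t1"
      proof (rule ccontr)
        assume "\<not> won t1"
        then have "Suc t1 = B ^ n" using t1 by simp
        then have "t \<le> t1" using t(1) by linarith
        then show False using before[of t] t(2) \<open>\<not> won t1\<close> by (cases "t = t1") auto
      qed
    qed (use accepts in blast)
    have run: "(T ^^ Suc s) (idle c) = U s" if "s \<le> t1" for s
      using that
    proof (induction s)
      case 0 then show ?case by (simp add: start)
    next
      case (Suc s)
      then have "(T ^^ Suc (Suc s)) (idle c) = T (U s)" by simp
      also have "\<dots> = U (Suc s)" using before[of s] t1_less Suc.prems by (intro step) simp_all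
      finally show ?case .
    qed
    have "(T ^^ Suc (Suc t1)) (idle c) = T (U t1)" using run[of t1] by simp
    also have "\<dots> = idle (S c)" unfolding finish[OF t1_less t1] ans by (simp add: S_def w_def k_def)
    finally have end_eq: "(T ^^ Suc (Suc t1)) (idle c) = idle (S c)" .
    have "A (F c)" if "j < Suc (Suc t1)" "Goal (\<Phi> ((T ^^ j) (idle c)))" for j
    proof (cases j)
      case 0
      then show ?thesis using that(2) by (simp add: Goal_def \<Phi>_def fst_idle)
    next
      case (Suc s)
      then have "(T ^^ j) (idle c) = U s" using run[of s] that(1) by simp
      moreover have "find (\<lambda>_. True) (U s) = Some (U s ! 0)"
        using n len_U[of s] by (cases "U s") auto
      ultimately have False using that(2) nth_U[OF n, of s] by (simp add: Goal_def \<Phi>_def)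
      then show ?thesis ..
    qed
    with end_eq show ?thesis by (intro exI[of _ "Suc (Suc t1)"]) simp
  qed
  have S_in: "S c \<in> lists \<Gamma>" "S c \<noteq> []" if "c \<in> lists \<Gamma>" "c \<noteq> []" for c
  proof -
    show "S c \<in> lists \<Gamma>" unfolding S_def by (rule closed[OF that(1)])
    have "length (S c) = length c" by (simp add: S_def)
    then show "S c \<noteq> []" using that(2) by auto
  qed
  have "(\<exists>t. Goal (\<Phi> ((T ^^ t) (map (\<lambda>a. (\<iota> a, None)) w)))) \<longleftrightarrow> (\<exists>t. A (F ((S ^^ t) (map \<iota> w))))"
    if w: "w \<in> lists \<Sigma>" "w \<noteq> []" for w
  proof -
    have m: "map (\<lambda>a. (\<iota> a, None)) w = idle (map \<iota> w)" by (simp add: idle_def)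
    have "(\<exists>t. Goal (\<Phi> ((T ^^ t) (idle (map \<iota> w))))) \<longleftrightarrow>
        (\<exists>c. (map \<iota> w, c) \<in> {(c, S c) |c. True}\<^sup>* \<and> A (F c))"
    proof (rule macro_steps[where W = "lists \<Gamma> - {[]}" and Goal = "\<lambda>u. Goal (\<Phi> u)"
          and A = "\<lambda>c. A (F c)" and enc = idle])
      show "map \<iota> w \<in> lists \<Gamma> - {[]}" using w \<iota> by (auto simp: in_lists_conv_set)
      show "Goal (\<Phi> (idle c))" if "c \<in> lists \<Gamma> - {[]}" "A (F c)" for c
      proof -
        have "find (\<lambda>_. True) (idle c) = Some (hd c, None)" using that(1) by (cases c) (auto simp: idle_def)
        then show ?thesis using that(2) by (simp add: Goal_def \<Phi>_def fst_idle)
      qed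
    qed (use round S_in in auto)
    then show ?thesis unfolding m rtrancl_function by metis
  qed
  then have "{w \<in> lists \<Sigma>. if w = [] then e else \<exists>t. A (F ((S ^^ t) (map \<iota> w)))} =
    {w \<in> lists \<Sigma>. if w = [] then e else \<exists>t. Goal (\<Phi> ((sweep \<phi> \<Phi> ^^ t) (map (\<lambda>a. (\<iota> a, None)) w)))}"
    unfolding T_def by (intro Collect_cong conj_cong refl) auto
  also have "dcs \<Sigma> \<dots>"
  proof (rule dcs_if_system[OF fin(1) fin\<Gamma>' _ rec\<Phi>])
    show "(\<lambda>a. (\<iota> a, None)) ` \<Sigma> \<subseteq> \<Gamma>'" using \<iota> by (auto simp: \<Gamma>'_def)
    show "sweep \<phi> \<Phi> u \<in> lists \<Gamma>'" if u: "u \<in> lists \<Gamma>'" for u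
    proof -
      have "\<phi> X Xl z Xr \<in> \<Gamma>'" if "z \<in> \<Gamma>'" for X Xl z Xr using that by (simp add: \<phi>_def)
      moreover have "u ! i \<in> \<Gamma>'" if "i < length u" for i
        using u that by (auto simp: in_lists_conv_set)
      ultimately have "sweep \<phi> \<Phi> u ! i \<in> \<Gamma>'" if "i < length u" for i
        unfolding nth_sweep[OF that] using that by blast
      then show ?thesis by (intro in_lists_nth) simp
    qed
  qed
  finally show ?thesis .
qed

section \<open>Closure properties\<close>

lemma snake_1: "snake 1 \<rho> c = map (\<lambda>i. \<rho> (i = 0) (c ! i) 0) [0..<length c]"
  by (simp add: snake_def)

text \<open>
  A single query, whose answer is combined with recognizable information and written into every cell.
\<close>

theorem dcs_if_query:
  assumes fin: "finite \<Sigma>" and rec: "recognizable \<Sigma> F" and L: "dcs \<Delta> L"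
    and \<rho>: "\<And>f a j. \<lbrakk>a \<in> \<Sigma>; j < K\<rbrakk> \<Longrightarrow> \<rho> f a j \<in> \<Delta>" and K: "0 < K"
  shows "dcs \<Sigma> {w \<in> lists \<Sigma>. if w = [] then e else \<Theta> (F w) (snake K \<rho> w \<in> L)}"
proof -
  define G where "G u = (F (map fst u), find (\<lambda>_. True) u)" for u :: "('a \<times> bool) list"
  define \<psi> where "\<psi> b X Xl x Xr = (fst x, \<Theta> (fst X) b)"
    for b and X Xl Xr :: "'b \<times> ('a \<times> bool) option" and x :: "'a \<times> bool"
  define A where "A X = (case snd X of Some (_, s) \<Rightarrow> s | None \<Rightarrow> False)" for X :: "'b \<times> ('a \<times> bool) option"
  define S where "S = (\<lambda>c. sweep (\<psi> (snake K (\<lambda>f x. \<rho> f (fst x)) c \<in> L)) G c)"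
  define start where "start w s = map (\<lambda>a. (a, s)) w" for w :: "'a list" and s :: bool
  define ans where "ans w = \<Theta> (F w) (snake K \<rho> w \<in> L)" for w
  have fst_start: "map fst (start w s) = w" for w s by (simp add: start_def comp_def)
  have S: "S (start w s) = start w (ans w)" for w s
  proof (rule nth_equalityI)
    fix i assume "i < length (S (start w s))"
    then have i: "i < length w" by (simp add: S_def start_def)
    have snk: "snake K (\<lambda>f x. \<rho> f (fst x)) (start w s) = snake K \<rho> w"
      unfolding snake_def by (intro arg_cong[where f = concat] map_cong refl if_cong)
        (auto simp: start_def)
    have "i < length (start w s)" using i by (simp add: start_def)
    then show "S (start w s) ! i = start w (ans w) ! i"
      unfolding S_def snk nth_sweep[OF \<open>i < length (start w s)\<close>]
      using i by (simp add: \<psi>_def G_def fst_start ans_def) (simp add: start_def)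
  qed (simp add: S_def start_def)
  have iter: "(S ^^ t) (start w s) = (if t = 0 then start w s else start w (ans w))" for t w s
    by (induction t) (simp_all add: S)
  have A: "A (G (start w s)) = s" if "w \<noteq> []" for w s
    using that by (cases w) (simp_all add: A_def G_def start_def)
  have "(\<exists>t. A (G ((S ^^ t) (start w False)))) \<longleftrightarrow> ans w" if "w \<noteq> []" for w
    using A[OF that] by (auto simp: iter intro: exI[of _ 1])
  then have "{w \<in> lists \<Sigma>. if w = [] then e else \<Theta> (F w) (snake K \<rho> w \<in> L)} =
    {w \<in> lists \<Sigma>. if w = [] then e else \<exists>t. A (G ((S ^^ t) (map (\<lambda>a. (a, False)) w)))}"
    by (auto simp: ans_def start_def)
  also have "dcs \<Sigma> \<dots>"
    unfolding S_def
  proof (rule dcs_if_oracle_system[where \<Gamma> = "\<Sigma> \<times> UNIV" and I = "{()}" and \<Delta> = \<Delta> and L = "\<lambda>_. L"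
        and \<kappa> = "\<lambda>_. ()" and F = G and \<rho> = "\<lambda>f x. \<rho> f (fst x)"])
    show "recognizable (\<Sigma> \<times> (UNIV :: bool set)) G"
      unfolding G_def using fin
      by (intro recognizable_Pair recognizable_find recognizable_map[OF rec]) auto
    show "sweep (\<psi> b) G c \<in> lists (\<Sigma> \<times> UNIV)" if "c \<in> lists (\<Sigma> \<times> UNIV)" for b c
    proof (rule in_lists_nth)
      fix i assume "i < length (sweep (\<psi> b) G c)"
      then show "sweep (\<psi> b) G c ! i \<in> \<Sigma> \<times> UNIV"
        using nth_lists[OF that, of i] by (simp add: nth_sweep \<psi>_def mem_Times_iff)
    qed
  qed (use fin L \<rho> K in auto)
  finally show ?thesis .
qed

lemma dcs_subset: "dcs \<Sigma> L \<Longrightarrow> L \<subseteq> lists \<Sigma>"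
  by (auto simp: dcs_def)

lemma dcs_finite: "dcs \<Sigma> L \<Longrightarrow> finite \<Sigma>"
  by (simp add: dcs_def)

lemma snake_1_id: "snake 1 (\<lambda>_ a _. a) w = w"
  unfolding snake_1 by (simp add: map_nth)

corollary dcs_Int_recognizable:
  assumes "dcs \<Sigma> L" and "recognizable \<Sigma> F"
  shows "dcs \<Sigma> {w \<in> L. P (F w)}"
proof -
  have "{w \<in> L. P (F w)} = {w \<in> lists \<Sigma>. if w = [] then [] \<in> L \<and> P (F [])
      else P (F w) \<and> snake 1 (\<lambda>_ a _. a) w \<in> L}"
    using dcs_subset[OF assms(1)] unfolding snake_1_id by auto
  also have "dcs \<Sigma> \<dots>"
    by (rule dcs_if_query[OF dcs_finite[OF assms(1)] assms(2,1), where \<Theta> = "\<lambda>v b. P v \<and> b"]) auto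
  finally show ?thesis .
qed

corollary dcs_Compl:
  assumes "dcs \<Sigma> L"
  shows "dcs \<Sigma> (lists \<Sigma> - L)"
proof -
  have "lists \<Sigma> - L = {w \<in> lists \<Sigma>. if w = [] then [] \<notin> L else \<not> snake 1 (\<lambda>_ a _. a) w \<in> L}"
    unfolding snake_1_id by auto
  also have "dcs \<Sigma> \<dots>"
    by (rule dcs_if_query[OF dcs_finite[OF assms] recognizable_const assms, where \<Theta> = "\<lambda>_ b. \<not> b"]) auto
  finally show ?thesis .
qed

text \<open>
  The cells count the positive answers, first to a query for \<open>L1\<close> and then to one for \<open>L2\<close>.
\<close>

theorem dcs_Int:
  assumes L: "dcs \<Sigma> L1" "dcs \<Sigma> L2"
  shows "dcs \<Sigma> (L1 \<inter> L2)"
proof -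
  define \<psi> where "\<psi> b X Xl x Xr = (fst x, if b \<and> snd x < 2 then Suc (snd x) else snd x)"
    for b and X Xl Xr :: "('a \<times> nat) option" and x :: "'a \<times> nat"
  define G where "G = find (\<lambda>_ :: 'a \<times> nat. True)"
  define \<kappa> where "\<kappa> X = (case X of Some (_, s) \<Rightarrow> s = 0 | None \<Rightarrow> False)" for X :: "('a \<times> nat) option"
  define A where "A X = (case X of Some (_, s) \<Rightarrow> s = 2 | None \<Rightarrow> False)" for X :: "('a \<times> nat) option"
  define LL where "LL b = (if b then L1 else L2)" for b
  define S where "S = (\<lambda>c. sweep (\<psi> (snake 1 (\<lambda>_ x _. fst x) c \<in> LL (\<kappa> (G c)))) G c)"
  define stage where "stage w s = map (\<lambda>a. (a, s)) w" for w :: "'a list" and s :: nat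
  have G: "G (stage w s) = Some (hd w, s)" if "w \<noteq> []" for w s
    using that by (cases w) (simp_all add: G_def stage_def)
  have snk: "snake 1 (\<lambda>_ x _. fst x) (stage w s) = w" for w s
    unfolding snake_1 by (rule nth_equalityI) (simp_all add: stage_def)
  have S: "S (stage w s) = stage w (if w \<in> (if s = 0 then L1 else L2) \<and> s < 2 then Suc s else s)"
    if "w \<noteq> []" for w s
  proof (rule nth_equalityI)
    fix i assume "i < length (S (stage w s))"
    then have "i < length w" by (simp add: S_def stage_def)
    then show "S (stage w s) ! i = stage w (if w \<in> (if s = 0 then L1 else L2) \<and> s < 2 then Suc s else s) ! i"
      unfolding S_def snk G[OF that]
      by (subst nth_sweep) (auto simp: stage_def \<psi>_def LL_def \<kappa>_def)
  qed (simp add: S_def stage_def)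
  have A: "A (G (stage w s)) \<longleftrightarrow> s = 2" if "w \<noteq> []" for w s
    using that by (simp add: A_def G)
  have iff: "(\<exists>t. A (G ((S ^^ t) (stage w 0)))) \<longleftrightarrow> w \<in> L1 \<and> w \<in> L2" if w: "w \<noteq> []" for w
  proof
    assume "w \<in> L1 \<and> w \<in> L2"
    then have "(S ^^ 2) (stage w 0) = stage w 2" using S[OF w] by (simp add: numeral_2_eq_2)
    then show "\<exists>t. A (G ((S ^^ t) (stage w 0)))" using A[OF w] by metis
  next
    assume "\<exists>t. A (G ((S ^^ t) (stage w 0)))"
    then obtain t where t: "A (G ((S ^^ t) (stage w 0)))" ..
    have "\<exists>s. (S ^^ t) (stage w 0) = stage w s \<and> (0 < s \<longrightarrow> w \<in> L1) \<and> (1 < s \<longrightarrow> w \<in> L2)" for t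
    proof (induction t)
      case (Suc t)
      then obtain s where "(S ^^ t) (stage w 0) = stage w s" "0 < s \<longrightarrow> w \<in> L1" "1 < s \<longrightarrow> w \<in> L2"
        by blast
      then show ?case using S[OF w, of s]
        by (intro exI[of _ "if w \<in> (if s = 0 then L1 else L2) \<and> s < 2 then Suc s else s"]) auto
    qed (auto intro: exI[of _ 0])
    then obtain s where s: "(S ^^ t) (stage w 0) = stage w s" "0 < s \<longrightarrow> w \<in> L1" "1 < s \<longrightarrow> w \<in> L2"
      by blast
    then have "s = 2" using t A[OF w] by simp
    then show "w \<in> L1 \<and> w \<in> L2" using s by simp
  qed
  then have "L1 \<inter> L2 = {w \<in> lists \<Sigma>. if w = [] then [] \<in> L1 \<inter> L2
      else \<exists>t. A (G ((S ^^ t) (map (\<lambda>a. (a, 0)) w)))}"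
    using dcs_subset[OF L(1)] by (auto simp: stage_def)
  also have "dcs \<Sigma> \<dots>"
    unfolding S_def
  proof (rule dcs_if_oracle_system[where \<Gamma> = "\<Sigma> \<times> {..2}" and I = UNIV and \<Delta> = \<Sigma> and L = LL
        and \<kappa> = \<kappa> and F = G])
    show "recognizable (\<Sigma> \<times> {..2}) G"
      unfolding G_def using dcs_finite[OF L(1)] by (intro recognizable_find) simp
    show "sweep (\<psi> b) G c \<in> lists (\<Sigma> \<times> {..2})" if "c \<in> lists (\<Sigma> \<times> {..2})" for b c
    proof (rule in_lists_nth)
      fix i assume "i < length (sweep (\<psi> b) G c)"
      then show "sweep (\<psi> b) G c ! i \<in> \<Sigma> \<times> {..2}"
        using nth_lists[OF that, of i] by (simp add: nth_sweep \<psi>_def mem_Times_iff)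
    qed
    show "dcs \<Sigma> (LL k)" for k using L by (simp add: LL_def)
  qed (use dcs_finite[OF L(1)] in auto)
  finally show ?thesis .
qed

section \<open>Exhaustive search\<close>

text \<open>
  The cells hold a letter of \<open>\<Gamma>\<close> and a digit that codes an element of \<open>V\<close>. Starting from zero digits, all
  words \<open>v\<close> over \<open>V\<close> of the length of \<open>c\<close> are tried until \<open>ok (zip c v)\<close> holds; then \<open>c\<close> is updated and the
  digits are reset. If no candidate is suitable, the search goes on forever, which is the desired
  rejection. As any suitable candidate leads to the same update, the order of the trials does not matter.
\<close>

theorem dcs_if_search:
  fixes \<iota> :: "'a \<Rightarrow> 'c" and F :: "('c \<times> 'v) list \<Rightarrow> 'x" and G :: "'c list \<Rightarrow> 'e" and L :: "'k \<Rightarrow> 'b list set"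
    and \<Theta> :: "'x \<Rightarrow> bool \<Rightarrow> bool"
  assumes fin: "finite \<Sigma>" "finite \<Gamma>" "finite I" "finite V" and V: "V \<noteq> {}" and \<iota>: "\<iota> ` \<Sigma> \<subseteq> \<Gamma>"
    and rec: "recognizable (\<Gamma> \<times> V) F" "recognizable \<Gamma> G"
    and L: "\<And>k. k \<in> I \<Longrightarrow> dcs \<Delta> (L k)"
    and \<kappa>: "\<And>z. \<lbrakk>z \<in> lists (\<Gamma> \<times> V); z \<noteq> []\<rbrakk> \<Longrightarrow> \<kappa> (F z) \<in> I"
    and \<rho>: "\<And>f a j. \<lbrakk>a \<in> \<Gamma> \<times> V; j < K\<rbrakk> \<Longrightarrow> \<rho> f a j \<in> \<Delta>" and K: "0 < K"
    and closed: "\<And>z. z \<in> lists (\<Gamma> \<times> V) \<Longrightarrow> sweep upd F z \<in> lists \<Gamma>"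
  defines "ok \<equiv> \<lambda>z. \<Theta> (F z) (snake K \<rho> z \<in> L (\<kappa> (F z)))"
  defines "R \<equiv> {(c, sweep upd F (zip c v)) |c v. v \<in> lists V \<and> length v = length c \<and> ok (zip c v)}"
  assumes unique: "\<And>c d d'. \<lbrakk>c \<in> lists \<Gamma>; (c, d) \<in> R; (c, d') \<in> R\<rbrakk> \<Longrightarrow> d = d'"
  shows "dcs \<Sigma> {w \<in> lists \<Sigma>. if w = [] then e else \<exists>c. (map \<iota> w, c) \<in> R\<^sup>* \<and> A (G c)}"
proof -
  define B where "B = card V"
  have B: "0 < B" using fin(4) V by (auto simp: B_def card_gt_0_iff)
  obtain dec where dec: "bij_betw dec {..<B} V"
    using ex_bij_betw_nat_finite[OF fin(4)] by (auto simp: B_def atLeast0LessThan)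
  then have dec_in: "dec d \<in> V" if "d < B" for d using that by (auto simp: bij_betw_def)
  define dc where "dc x = (fst x, dec (snd x))" for x :: "'c \<times> nat"
  define \<Gamma>' where "\<Gamma>' = \<Gamma> \<times> {..<B}"
  have fin\<Gamma>': "finite \<Gamma>'" using fin(2) by (simp add: \<Gamma>'_def)
  define \<Phi> where "\<Phi> u = (F (map dc u), G (map fst u), find (\<lambda>x. snd x \<noteq> B - 1) u)" for u :: "('c \<times> nat) list"
  have rec\<Phi>: "recognizable \<Gamma>' \<Phi>"
    unfolding \<Phi>_def
    by (intro recognizable_Pair recognizable_find[OF fin\<Gamma>'] recognizable_map[OF rec(1)] recognizable_map[OF rec(2)])
      (auto simp: \<Gamma>'_def dc_def dec_in)
  define \<psi> where "\<psi> b X Xl x Xr = (if \<Theta> (fst X) b then (upd (fst X) (fst Xl) (dc x) (fst Xr), 0)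
      else (fst x, if snd (snd Xr) = None then (snd x + 1) mod B else snd x))"
    for b and X Xl Xr :: "'x \<times> 'e \<times> ('c \<times> nat) option" and x
  define T where "T = (\<lambda>u. sweep (\<psi> (snake K (\<lambda>f x. \<rho> f (dc x)) u \<in> L (\<kappa> (fst (\<Phi> u))))) \<Phi> u)"
  define enc where "enc c = map (\<lambda>a. (a, 0 :: nat)) c" for c :: "'c list"
  define U where "U c t = zip c (counter B (length c) t)" for c :: "'c list" and t
  have enc_U: "enc c = U c 0" for c
    by (rule nth_equalityI) (simp_all add: enc_def U_def counter_0)
  have snk: "snake K (\<lambda>f x. \<rho> f (dc x)) u = snake K \<rho> (map dc u)" for u
    unfolding snake_def by (intro arg_cong[where f = concat] map_cong refl if_cong) auto
  define Z where "Z c t = zip c (map dec (counter B (length c) t))" for c :: "'c list" and t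
  have dc_U: "map dc (U c t) = Z c t" for c t
    by (rule nth_equalityI) (simp_all add: U_def Z_def dc_def)
  have fst_U: "map fst (U c t) = c" for c t by (simp add: U_def)
  have len_U: "length (U c t) = length c" for c t by (simp add: U_def)
  have nth_U: "U c t ! i = (c ! i, counter B (length c) t ! i)" if "i < length c" for c t i
    using that by (simp add: U_def)
  have ok_U: "\<Theta> (fst (\<Phi> (U c t))) (snake K (\<lambda>f x. \<rho> f (dc x)) (U c t) \<in> L (\<kappa> (fst (\<Phi> (U c t)))))
      \<longleftrightarrow> ok (Z c t)" for c t
    unfolding snk \<Phi>_def dc_U fst_conv ok_def ..
  have hit: "T (U c t) = enc (sweep upd F (Z c t))" if "ok (Z c t)" for c t
  proof (rule nth_equalityI)
    fix i assume "i < length (T (U c t))"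
    then have i: "i < length c" by (simp add: T_def len_U)
    have m: "map dc (take i (U c t)) = take i (Z c t)" "map dc (drop (Suc i) (U c t)) = drop (Suc i) (Z c t)"
      "dc (U c t ! i) = Z c t ! i"
      using i by (simp_all add: take_map[symmetric] drop_map[symmetric] dc_U[symmetric] len_U)
    have "i < length (Z c t)" using i by (simp add: Z_def)
    then have r: "enc (sweep upd F (Z c t)) ! i = (sweep upd F (Z c t) ! i, 0)"
      by (simp add: enc_def)
    have "T (U c t) ! i = (upd (F (Z c t)) (F (take i (Z c t))) (Z c t ! i) (F (drop (Suc i) (Z c t))), 0)"
      unfolding T_def using i ok_U[of c t] that
      by (subst nth_sweep) (simp_all add: len_U \<psi>_def, simp add: \<Phi>_def m dc_U)
    then show "T (U c t) ! i = enc (sweep upd F (Z c t)) ! i"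
      unfolding r using \<open>i < length (Z c t)\<close> by (simp add: nth_sweep)
  qed (simp add: T_def len_U enc_def Z_def)
  have miss: "T (U c t) = U c (Suc t)" if "\<not> ok (Z c t)" for c t
  proof (rule nth_equalityI)
    fix i assume "i < length (T (U c t))"
    then have i: "i < length c" by (simp add: T_def len_U)
    then have iU: "i < length (U c t)" and iC: "i < length (counter B (length c) t)" by (simp_all add: len_U)
    have n: "\<not> \<Theta> (fst (\<Phi> (U c t))) (snake K (\<lambda>f x. \<rho> f (dc x)) (U c t) \<in> L (\<kappa> (fst (\<Phi> (U c t)))))"
      using ok_U that by blast
    have f: "snd (snd (\<Phi> (drop (Suc i) (U c t)))) = find (\<lambda>x. snd x \<noteq> B - 1) (drop (Suc i) (U c t))"
      by (simp add: \<Phi>_def)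
    have lo: "find (\<lambda>x. snd x \<noteq> B - 1) (drop (Suc i) (U c t)) = None \<longleftrightarrow>
        (\<forall>y\<in>set (drop (Suc i) (counter B (length c) t)). y = B - 1)"
      unfolding find_None_iff_nth all_set_conv_all_nth by (auto simp: len_U nth_U)
    have "T (U c t) ! i = (c ! i, increment B (counter B (length c) t) ! i)"
      unfolding T_def nth_sweep[OF iU] \<psi>_def if_not_P[OF n] f lo nth_U[OF i] nth_increment[OF iC]
      by (simp only: fst_conv snd_conv)
    then show "T (U c t) ! i = U c (Suc t) ! i" using i by (simp add: nth_U counter_Suc)
  qed (simp add: T_def len_U)
  have run: "(T ^^ t) (enc c) = U c t" if "\<forall>s<t. \<not> ok (Z c s)" for c t
    using that by (induction t) (simp_all add: enc_U miss)
  have Z_R: "(c, sweep upd F (Z c t)) \<in> R" if "ok (Z c t)" for c t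
    unfolding R_def using that counter_in[OF B, of "length c" t] dec_in
    by (intro CollectI exI[of _ c] exI[of _ "map dec (counter B (length c) t)"])
      (auto simp: Z_def in_lists_conv_set)
  have R_Z: "\<exists>t. ok (Z c t)" if R: "(c, d) \<in> R" for c d
  proof -
    obtain v where v: "v \<in> lists V" "length v = length c" "ok (zip c v)"
      using R unfolding R_def by blast
    define ds where "ds = map (the_inv_into {..<B} dec) v"
    have "dec (the_inv_into {..<B} dec a) = a \<and> the_inv_into {..<B} dec a < B" if "a \<in> V" for a
      using that dec f_the_inv_into_f_bij_betw[OF dec] the_inv_into_into[of dec "{..<B}" a]
      by (auto simp: bij_betw_def)
    then have "map dec ds = v" "ds \<in> lists {..<B}" using v(1)
      by (auto simp: ds_def in_lists_conv_set intro: map_idI)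
    then obtain t where "counter B (length ds) t = ds" using counter_surj[OF B] by blast
    then have "Z c t = zip c v" using \<open>map dec ds = v\<close> v(2) by (simp add: Z_def ds_def)
    with v(3) have "ok (Z c t)" by simp
    then show ?thesis ..
  qed
  define Goal where "Goal X = A (fst (snd X))" for X :: "'x \<times> 'e \<times> ('c \<times> nat) option"
  have Goal_U: "Goal (\<Phi> (U c t)) \<longleftrightarrow> A (G c)" for c t by (simp add: Goal_def \<Phi>_def fst_U)
  have main: "(\<exists>t. Goal (\<Phi> ((T ^^ t) (enc c0)))) \<longleftrightarrow> (\<exists>c. (c0, c) \<in> R\<^sup>* \<and> A (G c))" if "c0 \<in> lists \<Gamma>" for c0
  proof (rule macro_steps[where W = "lists \<Gamma>" and Goal = "\<lambda>u. Goal (\<Phi> u)" and A = "\<lambda>c. A (G c)" and enc = enc])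
    show "c0 \<in> lists \<Gamma>" by (rule that)
    show "d \<in> lists \<Gamma>" if c: "c \<in> lists \<Gamma>" and R: "(c, d) \<in> R" for c d
    proof -
      obtain v where v: "v \<in> lists V" "d = sweep upd F (zip c v)" using R unfolding R_def by blast
      have "zip c v \<in> lists (\<Gamma> \<times> V)" using c v(1) by (auto simp: in_lists_conv_set dest: set_zip_leftD set_zip_rightD)
      then show ?thesis unfolding v(2) by (rule closed)
    qed
    show "\<exists>m>0. (T ^^ m) (enc c) = enc d \<and> (\<forall>j<m. Goal (\<Phi> ((T ^^ j) (enc c))) \<longrightarrow> A (G c))"
      if "c \<in> lists \<Gamma>" and R: "(c, d) \<in> R" for c d
    proof -
      obtain t where t: "ok (Z c t)" "\<forall>s<t. \<not> ok (Z c s)"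
        using R_Z[OF R] exists_least_iff[of "\<lambda>t. ok (Z c t)"] by blast
      have "(T ^^ Suc t) (enc c) = enc (sweep upd F (Z c t))" using run[OF t(2)] hit[OF t(1)] by simp
      also have "sweep upd F (Z c t) = d" using unique \<open>c \<in> lists \<Gamma>\<close> R Z_R[OF t(1)] by blast
      finally have "(T ^^ Suc t) (enc c) = enc d" .
      moreover have "(T ^^ j) (enc c) = U c j" if "j < Suc t" for j using run[of j c] t(2) that by simp
      ultimately show ?thesis using Goal_U by (intro exI[of _ "Suc t"]) simp
    qed
    show "A (G c)" if "c \<notin> Domain R" "Goal (\<Phi> ((T ^^ j) (enc c)))" for c j
    proof -
      have "\<forall>s. \<not> ok (Z c s)" using Z_R that(1) by blast
      then have "(T ^^ j) (enc c) = U c j" using run by blast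
      then show ?thesis using that(2) Goal_U by simp
    qed
    show "Goal (\<Phi> (enc c))" if "A (G c)" for c using that by (simp add: enc_U Goal_U)
  qed
  have "map \<iota> w \<in> lists \<Gamma>" if "w \<in> lists \<Sigma>" for w using that \<iota> by (auto simp: in_lists_conv_set)
  then have iff: "(\<exists>c. (map \<iota> w, c) \<in> R\<^sup>* \<and> A (G c)) \<longleftrightarrow>
      (\<exists>t. Goal (\<Phi> ((T ^^ t) (map (\<lambda>a. (\<iota> a, 0)) w))))" if "w \<in> lists \<Sigma>" for w
    using main[of "map \<iota> w"] that by (simp add: enc_def comp_def)
  have "{w \<in> lists \<Sigma>. if w = [] then e else \<exists>c. (map \<iota> w, c) \<in> R\<^sup>* \<and> A (G c)} =
     {w \<in> lists \<Sigma>. if w = [] then e else \<exists>t. Goal (\<Phi> ((T ^^ t) (map (\<lambda>a. (\<iota> a, 0)) w)))}"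
    by (intro Collect_cong conj_cong if_cong refl iff, assumption)
  also have "dcs \<Sigma> \<dots>"
    unfolding T_def
  proof (rule dcs_if_oracle_system[where \<Gamma> = \<Gamma>' and I = I and \<Delta> = \<Delta> and L = L
        and \<kappa> = "\<lambda>X. \<kappa> (fst X)" and F = \<Phi> and \<rho> = "\<lambda>f x. \<rho> f (dc x)"])
    show "finite \<Sigma>" "finite \<Gamma>'" "finite I" "recognizable \<Gamma>' \<Phi>" "0 < K" using fin fin\<Gamma>' rec\<Phi> K by auto
    show "(\<lambda>a. (\<iota> a, 0)) ` \<Sigma> \<subseteq> \<Gamma>'" using \<iota> B by (auto simp: \<Gamma>'_def)
    show "dcs \<Delta> (L k)" if "k \<in> I" for k using L that .
    have dcm: "map dc c \<in> lists (\<Gamma> \<times> V)" if "c \<in> lists \<Gamma>'" for c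
      using that dec_in by (auto simp: \<Gamma>'_def dc_def in_lists_conv_set)
    show "\<kappa> (fst (\<Phi> c)) \<in> I" if "c \<in> lists \<Gamma>'" "c \<noteq> []" for c
      using \<kappa>[OF dcm[OF that(1)]] that(2) by (simp add: \<Phi>_def)
    show "\<rho> f (dc a) j \<in> \<Delta>" if "a \<in> \<Gamma>'" "j < K" for f a j
      using that dec_in by (intro \<rho>) (auto simp: \<Gamma>'_def dc_def)
    show "sweep (\<psi> b) \<Phi> c \<in> lists \<Gamma>'" if c: "c \<in> lists \<Gamma>'" for b c
    proof (rule in_lists_nth)
      fix i assume "i < length (sweep (\<psi> b) \<Phi> c)"
      then have i: "i < length c" by simp
      have m: "map dc (take i c) = take i (map dc c)" "map dc (drop (Suc i) c) = drop (Suc i) (map dc c)"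
        "dc (c ! i) = map dc c ! i"
        using i by (simp_all add: take_map drop_map)
      have "sweep upd F (map dc c) ! i \<in> \<Gamma>" using nth_lists[OF closed[OF dcm[OF c]], of i] i by simp
      then have "upd (F (map dc c)) (F (take i (map dc c))) (map dc c ! i) (F (drop (Suc i) (map dc c))) \<in> \<Gamma>"
        using i by (simp add: nth_sweep)
      then have "upd (fst (\<Phi> c)) (fst (\<Phi> (take i c))) (dc (c ! i)) (fst (\<Phi> (drop (Suc i) c))) \<in> \<Gamma>"
        by (simp only: \<Phi>_def m fst_conv)
      then show "sweep (\<psi> b) \<Phi> c ! i \<in> \<Gamma>'"
        using nth_lists[OF c i] i B unfolding nth_sweep[OF i] \<psi>_def \<Gamma>'_def
        by (auto simp: mem_Times_iff)
    qed
  qed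
  finally show ?thesis .
qed

section \<open>Padded words and convolutions\<close>

definition pad :: "nat \<Rightarrow> 'b list \<Rightarrow> 'b option list" where
  "pad n u = map (\<lambda>i. if i < length u then Some (u ! i) else None) [0..<n]"

lemma length_pad [simp]: "length (pad n u) = n"
  by (simp add: pad_def)

lemma nth_pad: "i < n \<Longrightarrow> pad n u ! i = (if i < length u then Some (u ! i) else None)"
  by (simp add: pad_def)

lemma pad_eq: "length u \<le> n \<Longrightarrow> pad n u = map Some u @ replicate (n - length u) None"
  by (rule nth_equalityI) (auto simp: nth_pad nth_append)

lemma map_filter_pad: "length u \<le> n \<Longrightarrow> List.map_filter id (pad n u) = u"
  by (simp add: pad_eq List.map_filter_def comp_def filter_replicate)

lemma pad_inj: "\<lbrakk>pad n u = pad n v; length u \<le> n; length v \<le> n\<rbrakk> \<Longrightarrow> u = v"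
  using map_filter_pad by metis

lemma pad_in: "u \<in> lists \<Lambda> \<Longrightarrow> pad n u \<in> lists (insert None (Some ` \<Lambda>))"
  by (auto simp: pad_def in_lists_conv_set)

text \<open>
  The elements satisfying \<open>P\<close> form an initial part of the list.
\<close>

definition tidy :: "('a \<Rightarrow> bool) \<Rightarrow> 'a list \<Rightarrow> bool" where
  "tidy P = sorted_wrt (\<lambda>a b. P b \<longrightarrow> P a)"

lemma tidy_split: "tidy P z \<Longrightarrow> z = filter P z @ filter (\<lambda>a. \<not> P a) z"
proof (induction z)
  case (Cons a z)
  show ?case
  proof (cases "P a")
    case True then show ?thesis using Cons by (simp add: tidy_def)
  next
    case False
    then have "\<forall>b\<in>set z. \<not> P b" using Cons.prems by (simp add: tidy_def)
    then have "filter P z = []" "filter (\<lambda>a. \<not> P a) z = z" by (simp_all add: filter_empty_conv)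
    then show ?thesis using False by simp
  qed
qed simp

text \<open>
  A concatenation is tidy iff both parts are and no violation arises between them, which depends only
  on the kinds of elements occurring in the parts.
\<close>

lemma recognizable_tidy: "recognizable \<Gamma> (tidy P)"
proof -
  have "recognizable \<Gamma> (\<lambda>u. (\<exists>a\<in>set u. P a, \<exists>a\<in>set u. \<not> P a, tidy P u))"
  proof (rule recognizable_if_morphism)
    show "finite ((\<lambda>u. (\<exists>a\<in>set u. P a, \<exists>a\<in>set u. \<not> P a, tidy P u)) ` lists \<Gamma>)"
      by (rule finite_subset[OF subset_UNIV]) simp
    have t: "tidy P (u @ v) \<longleftrightarrow> tidy P u \<and> tidy P v \<and> ((\<exists>a\<in>set u. \<not> P a) \<longrightarrow> \<not> (\<exists>a\<in>set v. P a))" for u v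
      by (auto simp: tidy_def sorted_wrt_append)
    show "((\<exists>a\<in>set (u @ v). P a), (\<exists>a\<in>set (u @ v). \<not> P a), tidy P (u @ v)) =
       ((\<exists>a\<in>set (u' @ v'). P a), (\<exists>a\<in>set (u' @ v'). \<not> P a), tidy P (u' @ v'))"
      if "((\<exists>a\<in>set u. P a), (\<exists>a\<in>set u. \<not> P a), tidy P u) = ((\<exists>a\<in>set u'. P a), (\<exists>a\<in>set u'. \<not> P a), tidy P u')"
        "((\<exists>a\<in>set v. P a), (\<exists>a\<in>set v. \<not> P a), tidy P v) = ((\<exists>a\<in>set v'. P a), (\<exists>a\<in>set v'. \<not> P a), tidy P v')"
      for u u' v v'
      using that unfolding t set_append bex_Un prod.inject by argo
  qed
  from recognizable_comp[OF this, of "\<lambda>(_, _, t). t"] show ?thesis by simp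
qed

lemma tidy_eq_pad:
  assumes "tidy (\<lambda>a. a \<noteq> None) y"
  shows "y = pad (length y) (List.map_filter id y)"
proof -
  let ?u = "List.map_filter id y"
  have "map Some ?u = filter (\<lambda>a. a \<noteq> None) y"
    by (induction y) (auto simp: List.map_filter_def)
  moreover have "filter (\<lambda>a. \<not> a \<noteq> None) y = replicate (length (filter (\<lambda>a. \<not> a \<noteq> None) y)) None"
    by (rule replicate_eqI) auto
  ultimately have y: "y = map Some ?u @ replicate (length (filter (\<lambda>a. \<not> a \<noteq> None) y)) None"
    using tidy_split[OF assms] by simp
  then have l: "length y = length ?u + length (filter (\<lambda>a. \<not> a \<noteq> None) y)"
    by (metis length_append length_map length_replicate)
  then show ?thesis using y by (subst pad_eq) simp_all
qed

lemma tidy_pad: "tidy (\<lambda>a. a \<noteq> None) (pad n u)"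
  unfolding tidy_def by (auto simp: sorted_wrt_iff_nth_less nth_pad)

lemma conv_eq: "conv u v = zip (pad (max (length u) (length v)) u) (pad (max (length u) (length v)) v)"
  by (rule nth_equalityI) (simp_all add: conv_def nth_pad)

lemma length_conv [simp]: "length (conv u v) = max (length u) (length v)"
  by (simp add: conv_def)

lemma conv_in: "\<lbrakk>u \<in> lists \<Lambda>; v \<in> lists \<Lambda>\<rbrakk> \<Longrightarrow> conv u v \<in> lists (conv_alphabet \<Lambda>)"
  by (auto simp: conv_def conv_alphabet_def in_lists_conv_set)

lemma map_filter_conv:
  "List.map_filter fst (conv u v) = u" "List.map_filter snd (conv u v) = v"
proof -
  have *: "List.map_filter f z = List.map_filter id (map f z)" for f and z :: "('b option \<times> 'b option) list"
    by (simp add: List.map_filter_def comp_def filter_map)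
  show "List.map_filter fst (conv u v) = u" "List.map_filter snd (conv u v) = v"
    unfolding * conv_eq by (simp_all add: map_filter_pad)
qed

lemma conv_nonempty_letters: "a \<in> set (conv u v) \<Longrightarrow> a \<noteq> (None, None)"
  by (auto simp: conv_def split: if_splits)

text \<open>
  The words over pairs that are convolutions: padding occurs only at the end of a component, and not
  in both components at once.
\<close>

definition proper :: "('b option \<times> 'b option) list \<Rightarrow> bool" where
  "proper z \<longleftrightarrow> tidy (\<lambda>a. fst a \<noteq> None) z \<and> tidy (\<lambda>a. snd a \<noteq> None) z \<and> (None, None) \<notin> set z"

lemma tidy_map: "tidy P (map f z) \<longleftrightarrow> tidy (\<lambda>a. P (f a)) z"
  by (simp add: tidy_def sorted_wrt_map)

lemma proper_conv: "proper (conv u v)"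
proof -
  have "map fst (conv u v) = pad (max (length u) (length v)) u"
    "map snd (conv u v) = pad (max (length u) (length v)) v"
    by (simp_all add: conv_eq)
  then show ?thesis using tidy_pad tidy_map[of "\<lambda>a. a \<noteq> None" fst "conv u v"]
      tidy_map[of "\<lambda>a. a \<noteq> None" snd "conv u v"] conv_nonempty_letters
    unfolding proper_def by metis
qed

lemma conv_of_proper:
  assumes "proper z"
  shows "z = conv (List.map_filter fst z) (List.map_filter snd z)"
proof -
  have *: "List.map_filter f z = List.map_filter id (map f z)" for f :: "_ \<Rightarrow> 'b option"
    by (simp add: List.map_filter_def comp_def filter_map)
  let ?u = "List.map_filter fst z" and ?v = "List.map_filter snd z"
  have uv: "map fst z = pad (length z) ?u" "map snd z = pad (length z) ?v"
    using tidy_eq_pad[of "map fst z"] tidy_eq_pad[of "map snd z"] assms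
    unfolding * by (simp_all add: proper_def tidy_map)
  have z: "z = zip (pad (length z) ?u) (pad (length z) ?v)"
    unfolding uv[symmetric] by (simp add: zip_map_fst_snd)
  have "length ?u \<le> length z" "length ?v \<le> length z" by (simp_all add: List.map_filter_def)
  moreover have "length z \<le> max (length ?u) (length ?v)"
  proof (rule ccontr)
    assume a: "\<not> length z \<le> max (length ?u) (length ?v)"
    define i where "i = length z - 1"
    have i: "i < length z" "\<not> i < length ?u" "\<not> i < length ?v" using a by (auto simp: i_def)
    have "z ! i = (pad (length z) ?u ! i, pad (length z) ?v ! i)"
      using i(1) by (subst z) simp
    then have "z ! i = (None, None)" using i by (simp add: nth_pad)
    then show False using assms i(1) by (metis nth_mem proper_def)
  qed
  ultimately have "length z = max (length ?u) (length ?v)" by simp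
  then show ?thesis using z by (simp add: conv_eq)
qed

lemma recognizable_proper:
  assumes fin: "finite \<Gamma>"
  shows "recognizable \<Gamma> proper"
proof -
  have "proper = (\<lambda>z. case (tidy (\<lambda>a. fst a \<noteq> None) z, tidy (\<lambda>a. snd a \<noteq> None) z,
      find (\<lambda>a :: 'a option \<times> 'a option. a = (None, None)) z) of (a, b, c) \<Rightarrow> a \<and> b \<and> c = None)"
    by (rule ext) (auto simp: proper_def find_None_iff)
  moreover have "recognizable \<Gamma> (\<lambda>z. case (tidy (\<lambda>a. fst a \<noteq> None) z, tidy (\<lambda>a. snd a \<noteq> None) z,
      find (\<lambda>a. a = (None, None)) z) of (a, b, c) \<Rightarrow> a \<and> b \<and> c = None)"
    by (rule recognizable_comp) (intro recognizable_Pair recognizable_tidy recognizable_find[OF fin])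
  ultimately show ?thesis by simp
qed

section \<open>Words in groups\<close>

lemma word_val_Nil [simp]: "word_val G [] = \<one>\<^bsub>G\<^esub>"
  and word_val_Cons [simp]: "word_val G (x # w) = x \<otimes>\<^bsub>G\<^esub> word_val G w"
  by (simp_all add: word_val_def)

context group
begin

lemma word_val_closed [simp]: "w \<in> lists (carrier G) \<Longrightarrow> word_val G w \<in> carrier G"
  by (induction w) auto

lemma word_val_append:
  "\<lbrakk>u \<in> lists (carrier G); v \<in> lists (carrier G)\<rbrakk> \<Longrightarrow> word_val G (u @ v) = word_val G u \<otimes> word_val G v"
  by (induction u) (auto simp: m_assoc)

lemma word_val_inv:
  "w \<in> lists (carrier G) \<Longrightarrow> word_val G (rev (map (m_inv G) w)) = inv (word_val G w)"
proof (induction w)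
  case (Cons x w)
  then have "rev (map (m_inv G) w) \<in> lists (carrier G)" by (auto simp: in_lists_conv_set)
  then show ?case using Cons by (simp add: word_val_append inv_mult_group)
qed simp

lemma word_val_surj:
  assumes X: "sym_generating_set G X" and g: "g \<in> carrier G"
  shows "\<exists>w\<in>lists X. word_val G w = g"
proof -
  have Xc: "X \<subseteq> carrier G" "\<And>x. x \<in> X \<Longrightarrow> inv x \<in> X" using X by (auto simp: sym_generating_set_def)
  have "g \<in> generate G X" using X g by (simp add: sym_generating_set_def)
  then show ?thesis
  proof (induction rule: generate.induct)
    case one show ?case by (intro bexI[of _ "[]"]) auto
  next
    case (incl h) then show ?case using Xc by (intro bexI[of _ "[h]"]) auto
  next
    case (inv h) then show ?case using Xc by (intro bexI[of _ "[inv h]"]) auto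
  next
    case (eng h1 h2)
    then obtain u v where uv: "u \<in> lists X" "word_val G u = h1" "v \<in> lists X" "word_val G v = h2" by blast
    have "lists X \<subseteq> lists (carrier G)" using Xc(1) by (rule lists_mono)
    then have "word_val G (u @ v) = h1 \<otimes> h2" using uv word_val_append[of u v] by blast
    then show ?case using uv by (intro bexI[of _ "u @ v"]) simp_all
  qed
qed

end

lemma word_norm_le: "\<lbrakk>w \<in> lists X; word_val G w = g\<rbrakk> \<Longrightarrow> word_norm G X g \<le> length w"
  unfolding word_norm_def by (rule Least_le) blast

lemma word_norm_witness:
  assumes "w \<in> lists X" "word_val G w = g"
  shows "\<exists>v\<in>lists X. length v = word_norm G X g \<and> word_val G v = g"
  unfolding word_norm_def by (rule LeastI[of _ "length w"]) (use assms in blast)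

section \<open>From Shortlex biautomatic to graph automatic groups\<close>

lemma dcs_rename:
  assumes "dcs \<Delta> L" "finite \<Lambda>" "d ` \<Lambda> \<subseteq> \<Delta>"
  shows "dcs \<Lambda> {w \<in> lists \<Lambda>. map d w \<in> L}"
proof -
  have "List.map_filter (\<lambda>a. Some (d a)) w = map d w" for w
    by (induction w) (simp_all add: List.map_filter_def)
  moreover have "dcs \<Lambda> {w \<in> lists \<Lambda>. List.map_filter (\<lambda>a. Some (d a)) w \<in> L}"
    by (rule dcs_erase[OF assms(1,2)]) (use assms(3) in auto)
  ultimately show ?thesis by simp
qed

lemma conv_map: "conv (map f u) (map f v) = map (map_prod (map_option f) (map_option f)) (conv u v)"
  by (rule nth_equalityI) (auto simp: conv_def)

lemma shortlex_length:
  assumes "u \<in> shortlex_geodesics G X r" "v \<in> lists X" "word_val G v = word_val G u"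
  shows "length u \<le> length v"
  using assms by (cases "v = u") (auto simp: shortlex_geodesics_def lenlex_conv)

text \<open>
  The words are renamed by an injection \<open>e\<close> of \<open>X\<close> into the natural numbers, which carries convolutions to
  convolutions. The constant of the quasigeodesic condition is \<open>1\<close>.
\<close>

theorem (in group) graph_automatic_if_shortlex_biautomatic:
  assumes "shortlex_dcs_biautomatic_group G"
  shows "quasigeodesic_dcs_graph_automatic_group G"
proof -
  obtain X r where b: "dcs_biautomatic G X (shortlex_geodesics G X r) (word_val G)"
    using assms by (auto simp: shortlex_dcs_biautomatic_group_def)
  define S where "S = shortlex_geodesics G X r"
  have X: "sym_generating_set G X" and nf: "normal_form G X S (word_val G)" and S: "dcs X S"
    and rm: "\<And>x. x \<in> X \<Longrightarrow> dcs (conv_alphabet X) (right_mult_lang G S (word_val G) x)"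
    using b by (auto simp: dcs_biautomatic_def S_def)
  have finX: "finite X" using X by (simp add: sym_generating_set_def)
  have SX: "S \<subseteq> lists X" using nf by (simp add: normal_form_def)
  obtain e :: "'a \<Rightarrow> nat" where e: "inj_on e X" using finite_imp_inj_to_nat_seg[OF finX] by blast
  define d where "d = the_inv_into X e"
  have de: "d (e x) = x" if "x \<in> X" for x using e that by (simp add: d_def the_inv_into_f_f)
  have ed: "e (d n) = n" if "n \<in> e ` X" for n using de that by auto
  define \<Lambda> where "\<Lambda> = e ` X"
  define L where "L = map e ` S"
  define \<nu> where "\<nu> = word_val G \<circ> map d"
  have mde: "map d (map e w) = w" if "w \<in> lists X" for w
    using that de by (auto simp: in_lists_conv_set intro: map_idI)
  have med: "map e (map d w) = w" if "w \<in> lists \<Lambda>" for w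
    using that ed by (auto simp: \<Lambda>_def in_lists_conv_set intro: map_idI)
  have d_in: "d ` \<Lambda> \<subseteq> X" using de by (auto simp: \<Lambda>_def)
  have L_in: "L \<subseteq> lists \<Lambda>" unfolding L_def \<Lambda>_def lists_image using SX by (rule image_mono)
  have L_eq: "L = {w \<in> lists \<Lambda>. map d w \<in> S}"
  proof (intro equalityI subsetI)
    fix w assume "w \<in> L"
    then obtain u where "u \<in> S" "w = map e u" by (auto simp: L_def)
    moreover then have "map d w = u" using mde SX by blast
    ultimately show "w \<in> {w \<in> lists \<Lambda>. map d w \<in> S}" using L_in \<open>w \<in> L\<close> by auto
  next
    fix w assume "w \<in> {w \<in> lists \<Lambda>. map d w \<in> S}"
    then show "w \<in> L" using med[of w] unfolding L_def by (metis (mono_tags, lifting) image_eqI mem_Collect_eq)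
  qed
  have "bij_betw (map d) L S"
  proof (rule bij_betw_byWitness[where f' = "map e"])
    show "\<forall>w\<in>L. map e (map d w) = w" using med L_in by blast
    show "\<forall>u\<in>S. map d (map e u) = u" using mde SX by blast
    show "map d ` L \<subseteq> S" unfolding L_eq by blast
    show "map e ` S \<subseteq> L" by (simp add: L_def)
  qed
  then have "bij_betw \<nu> L (carrier G)"
    using nf unfolding \<nu>_def normal_form_def by (blast intro: bij_betw_trans)
  then have nfL: "normal_form G \<Lambda> L \<nu>" using L_in by (simp add: normal_form_def)
  have finL: "finite \<Lambda>" "finite (conv_alphabet \<Lambda>)" using finX by (simp_all add: \<Lambda>_def conv_alphabet_def)
  have dcsL: "dcs \<Lambda> L" unfolding L_eq by (rule dcs_rename[OF S finL(1) d_in])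
  have "dcs (conv_alphabet \<Lambda>) (right_mult_lang G L \<nu> x)" if x: "x \<in> X" for x
  proof -
    define dd where "dd = map_prod (map_option d) (map_option d)"
    define ee where "ee = map_prod (map_option e) (map_option e)"
    have "right_mult_lang G L \<nu> x =
      {z \<in> lists (conv_alphabet \<Lambda>). map dd z \<in> right_mult_lang G S (word_val G) x}"
    proof (intro equalityI subsetI)
      fix z assume "z \<in> right_mult_lang G L \<nu> x"
      then obtain u v where uv: "z = conv u v" "u \<in> L" "v \<in> L" "\<nu> v = \<nu> u \<otimes> x"
        by (auto simp: right_mult_lang_def)
      then have "map dd z = conv (map d u) (map d v)" by (simp add: conv_map dd_def)
      moreover have "map d u \<in> S" "map d v \<in> S" using uv L_eq by auto
      ultimately have "map dd z \<in> right_mult_lang G S (word_val G) x"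
        using uv(4) unfolding right_mult_lang_def \<nu>_def by auto
      moreover have "u \<in> lists \<Lambda>" "v \<in> lists \<Lambda>" using uv(2,3) L_in by blast+
      then have "z \<in> lists (conv_alphabet \<Lambda>)" unfolding uv(1) by (rule conv_in)
      ultimately show "z \<in> {z \<in> lists (conv_alphabet \<Lambda>). map dd z \<in> right_mult_lang G S (word_val G) x}"
        by blast
    next
      fix z assume z: "z \<in> {z \<in> lists (conv_alphabet \<Lambda>). map dd z \<in> right_mult_lang G S (word_val G) x}"
      then obtain u v where uv: "map dd z = conv u v" "u \<in> S" "v \<in> S" "word_val G v = word_val G u \<otimes> x"
        by (auto simp: right_mult_lang_def)
      have "map ee (map dd z) = z"
        using z ed by (auto simp: ee_def dd_def in_lists_conv_set conv_alphabet_def \<Lambda>_def intro!: map_idI)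
      then have "z = conv (map e u) (map e v)" unfolding uv(1) by (simp add: conv_map ee_def)
      moreover have "\<nu> (map e u) = word_val G u" "\<nu> (map e v) = word_val G v"
      proof -
        have "map d (map e u) = u" "map d (map e v) = v" using mde uv(2,3) SX by blast+
        then show "\<nu> (map e u) = word_val G u" "\<nu> (map e v) = word_val G v"
          by (simp_all only: \<nu>_def comp_apply)
      qed
      ultimately show "z \<in> right_mult_lang G L \<nu> x"
        using uv(2-4) unfolding right_mult_lang_def L_def
        by (intro CollectI exI[of _ "map e u"] exI[of _ "map e v"]) simp
    qed
    moreover have "dd ` conv_alphabet \<Lambda> \<subseteq> conv_alphabet X"
      using d_in by (auto simp: conv_alphabet_def dd_def)
    ultimately show ?thesis using dcs_rename[OF rm[OF x] finL(2)] by simp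
  qed
  then have "dcs_graph_automatic G X \<Lambda> L \<nu>"
    using X finL nfL dcsL by (simp add: dcs_graph_automatic_def)
  moreover have "length u \<le> 1 * (word_norm G X (\<nu> u) + 1)" if "u \<in> L" for u
  proof -
    have u: "map d u \<in> S" using that L_eq by blast
    obtain v where "v \<in> lists X" "length v = word_norm G X (\<nu> u)" "word_val G v = \<nu> u"
      using word_norm_witness[of "map d u" X G "\<nu> u"] u SX by (auto simp: \<nu>_def)
    then show ?thesis using shortlex_length[OF u[unfolded S_def], of v] by (simp add: \<nu>_def)
  qed
  then have "quasigeodesic G X L \<nu>" unfolding quasigeodesic_def by blast
  ultimately show ?thesis unfolding quasigeodesic_dcs_graph_automatic_group_def by blast
qed

section \<open>From the word problem to Shortlex biautomatic groups\<close>

lemma map_filter_append: "List.map_filter f (u @ v) = List.map_filter f u @ List.map_filter f v"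
  by (simp add: List.map_filter_def)

lemma map_filter_rev: "List.map_filter f (rev u) = rev (List.map_filter f u)"
  by (simp add: List.map_filter_def rev_filter rev_map)

lemma map_filter_map: "List.map_filter f (map g u) = List.map_filter (\<lambda>a. f (g a)) u"
  by (simp add: List.map_filter_def comp_def filter_map)

lemma map_filter_map_option:
  "List.map_filter (\<lambda>a. map_option f (g a)) u = map f (List.map_filter g u)"
  by (induction u) (auto simp: List.map_filter_def)

lemma map_filter_Some: "List.map_filter (\<lambda>a. Some (f a)) u = map f u"
  by (induction u) (auto simp: List.map_filter_def)

lemma map_filter_in: "(\<And>a b. \<lbrakk>a \<in> set u; f a = Some b\<rbrakk> \<Longrightarrow> b \<in> X) \<Longrightarrow> List.map_filter f u \<in> lists X"
  by (auto simp: List.map_filter_def in_lists_conv_set)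

lemma snake_numeral:
  "snake 2 \<rho> c = map (\<lambda>i. \<rho> (i = 0) (c ! i) 0) [0..<length c] @ rev (map (\<lambda>i. \<rho> (i = 0) (c ! i) 1) [0..<length c])"
  "snake 3 \<rho> c = map (\<lambda>i. \<rho> (i = 0) (c ! i) 0) [0..<length c] @ rev (map (\<lambda>i. \<rho> (i = 0) (c ! i) 1) [0..<length c])
     @ map (\<lambda>i. \<rho> (i = 0) (c ! i) 2) [0..<length c]"
  "snake 4 \<rho> c = map (\<lambda>i. \<rho> (i = 0) (c ! i) 0) [0..<length c] @ rev (map (\<lambda>i. \<rho> (i = 0) (c ! i) 1) [0..<length c])
     @ map (\<lambda>i. \<rho> (i = 0) (c ! i) 2) [0..<length c] @ rev (map (\<lambda>i. \<rho> (i = 0) (c ! i) 3) [0..<length c])"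
proof -
  have u: "[0..<2] = [0, 1 :: nat]" "[0..<3] = [0, 1, 2 :: nat]" "[0..<4] = [0, 1, 2, 3 :: nat]"
    by (simp_all add: upt_rec)
  show "snake 2 \<rho> c = map (\<lambda>i. \<rho> (i = 0) (c ! i) 0) [0..<length c] @ rev (map (\<lambda>i. \<rho> (i = 0) (c ! i) 1) [0..<length c])"
    "snake 3 \<rho> c = map (\<lambda>i. \<rho> (i = 0) (c ! i) 0) [0..<length c] @ rev (map (\<lambda>i. \<rho> (i = 0) (c ! i) 1) [0..<length c])
     @ map (\<lambda>i. \<rho> (i = 0) (c ! i) 2) [0..<length c]"
    "snake 4 \<rho> c = map (\<lambda>i. \<rho> (i = 0) (c ! i) 0) [0..<length c] @ rev (map (\<lambda>i. \<rho> (i = 0) (c ! i) 1) [0..<length c])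
     @ map (\<lambda>i. \<rho> (i = 0) (c ! i) 2) [0..<length c] @ rev (map (\<lambda>i. \<rho> (i = 0) (c ! i) 3) [0..<length c])"
    unfolding snake_def u by simp_all
qed

lemma map_nth_fun: "map (\<lambda>i. f (c ! i)) [0..<length c] = map f c"
  by (rule nth_equalityI) simp_all

lemma map_filter_None: "List.map_filter (\<lambda>_. None) u = []"
  by (simp add: List.map_filter_def)

lemma map_filter_first:
  assumes "c \<noteq> []"
  shows "List.map_filter (\<lambda>i. if i = 0 then Some x else None) [0..<length c] = [x]"
proof -
  have "[0..<length c] = 0 # [1..<length c]" using assms by (simp add: upt_conv_Cons)
  moreover have "List.map_filter (\<lambda>i. if i = 0 then Some x else None) [1..<length c] = []"
    by (simp add: List.map_filter_def filter_empty_conv)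
  ultimately show ?thesis by (simp add: List.map_filter_def)
qed

text \<open>
  The Shortlex order for a candidate \<open>v\<close> with gaps that has been paired with a word \<open>u\<close>: a gap makes the
  candidate shorter than \<open>u\<close>, and without gaps the first difference decides. Hence gaps may occur
  anywhere in a candidate.
\<close>

definition precedes :: "('g \<times> 'g) set \<Rightarrow> ('g \<times> 'g option) list \<Rightarrow> bool" where
  "precedes r z \<longleftrightarrow> (\<exists>a\<in>set z. snd a = None) \<or>
     (case find (\<lambda>a. snd a \<noteq> Some (fst a)) z of Some (x, Some y) \<Rightarrow> (y, x) \<in> r | _ \<Rightarrow> False)"

lemma recognizable_precedes:
  assumes fin: "finite \<Gamma>"
  shows "recognizable \<Gamma> (precedes r)"
proof -
  have "precedes r = (\<lambda>z. case (find (\<lambda>a. snd a = None) z, find (\<lambda>a. snd a \<noteq> Some (fst a)) z) of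
      (n, f) \<Rightarrow> n \<noteq> None \<or> (case f of Some (x, Some y) \<Rightarrow> (y, x) \<in> r | _ \<Rightarrow> False))"
    unfolding precedes_def[abs_def] prod.case find_None_iff not_not Bex_def ..
  moreover have "recognizable \<Gamma> (\<lambda>z. case (find (\<lambda>a. snd a = None) z, find (\<lambda>a. snd a \<noteq> Some (fst a)) z) of
      (n, f) \<Rightarrow> n \<noteq> None \<or> (case f of Some (x, Some y) \<Rightarrow> (y, x) \<in> r | _ \<Rightarrow> False))"
    by (rule recognizable_comp) (intro recognizable_Pair recognizable_find[OF fin])
  ultimately show ?thesis by simp
qed

lemma lenlex_if_precedes:
  assumes len: "length v = length u" and s: "precedes r (zip u v)"
  shows "(List.map_filter id v, u) \<in> lenlex r"
proof (cases "None \<in> set v")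
  case True
  then have "length (List.map_filter id v) < length v"
    by (simp add: List.map_filter_def length_filter_less[of None])
  then show ?thesis using len by (simp add: lenlex_conv)
next
  case False
  define w where "w = map the v"
  have v: "v = map Some w" using False by (auto simp: w_def intro!: nth_equalityI) (metis nth_mem option.collapse)
  have "\<not> (\<exists>a\<in>set (zip u v). snd a = None)" using False by (metis set_zip_rightD surjective_pairing)
  then obtain x y where f: "find (\<lambda>a. snd a \<noteq> Some (fst a)) (zip u v) = Some (x, Some y)" "(y, x) \<in> r"
    using s unfolding precedes_def by (auto split: option.splits)
  then obtain i where i: "i < length (zip u v)" "(x, Some y) = zip u v ! i"
    "\<forall>j<i. \<not> snd (zip u v ! j) \<noteq> Some (fst (zip u v ! j))"
    by (auto simp: find_Some_iff)
  have n: "i < length u" "length w = length u" using i(1) len v by simp_all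
  have xy: "u ! i = x" "w ! i = y" using i(2) n v by simp_all
  have "take i u = take i w"
  proof (rule nth_equalityI)
    fix j assume "j < length (take i u)"
    then show "take i u ! j = take i w ! j" using i(3) n v by auto
  qed (use n in simp)
  then have "w = take i u @ y # drop (Suc i) w" "u = take i u @ x # drop (Suc i) u"
    using n xy id_take_nth_drop[of i w] id_take_nth_drop[of i u] by simp_all
  then have "(w, u) \<in> lex r" using n(2) f(2) unfolding lex_conv by blast
  moreover have "List.map_filter id v = w" unfolding v by (simp add: List.map_filter_def comp_def)
  ultimately show ?thesis using n by (simp add: lenlex_conv)
qed

lemma precedes_if_lenlex:
  assumes r: "irrefl r" and l: "(w, u) \<in> lenlex r"
  shows "precedes r (zip u (pad (length u) w))"
proof (cases "length w < length u")
  case True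
  then have "zip u (pad (length u) w) ! length w = (u ! length w, None)" by (simp add: nth_pad)
  then have "(u ! length w, None) \<in> set (zip u (pad (length u) w))"
    using True by (metis length_pad length_zip min.idem nth_mem)
  then show ?thesis unfolding precedes_def by force
next
  case False
  then have n: "length w = length u" and "(w, u) \<in> lex r" using l by (auto simp: lenlex_conv)
  then obtain p x y w' u' where d: "w = p @ y # w'" "u = p @ x # u'" "(y, x) \<in> r"
    unfolding lex_conv by blast
  then have "x \<noteq> y" using r by (auto simp: irrefl_def)
  have "pad (length u) w = map Some w" using n by (simp add: pad_eq)
  then have "zip u (pad (length u) w) = zip p (map Some p) @ (x, Some y) # zip u' (map Some w')"
    by (simp add: d)
  moreover have "find (\<lambda>a. snd a \<noteq> Some (fst a)) (zip p (map Some p)) = None"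
    by (auto simp: find_None_iff in_set_zip)
  ultimately have "find (\<lambda>a. snd a \<noteq> Some (fst a)) (zip u (pad (length u) w)) = Some (x, Some y)"
    using \<open>x \<noteq> y\<close> by (simp add: find_append)
  then show ?thesis using d(3) by (simp add: precedes_def)
qed

lemma lenlex_total:
  assumes tot: "total_on X r" and uv: "u \<in> lists X" "v \<in> lists X" "u \<noteq> v"
  shows "(u, v) \<in> lenlex r \<or> (v, u) \<in> lenlex r"
proof (cases "length u = length v")
  case True
  have "(u, v) \<in> lex r \<or> (v, u) \<in> lex r" using True uv
  proof (induction u v rule: list_induct2)
    case (Cons x u y v)
    then show ?case using tot unfolding total_on_def by (cases "x = y") auto
  qed simp
  with True show ?thesis by (auto simp: lenlex_conv)
next
  case False
  then show ?thesis by (auto simp: lenlex_conv)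
qed

context group
begin

text \<open>
  The word problem for words in which \<open>None\<close> stands for a gap.
\<close>

lemma dcs_gapped_word_problem:
  assumes "dcs X {w \<in> lists X. word_val G w = \<one>}"
  shows "dcs (insert None (Some ` X)) {w \<in> lists (insert None (Some ` X)). word_val G (List.map_filter id w) = \<one>}"
proof -
  have "List.map_filter id w \<in> lists X" if "w \<in> lists (insert None (Some ` X))" for w
    using that by (intro map_filter_in) (auto simp: in_lists_conv_set)
  then have "{w \<in> lists (insert None (Some ` X)). word_val G (List.map_filter id w) = \<one>} =
    {w \<in> lists (insert None (Some ` X)). List.map_filter id w \<in> {w \<in> lists X. word_val G w = \<one>}}"
    by auto
  also have "dcs (insert None (Some ` X)) \<dots>"
    by (rule dcs_erase[OF assms]) (use dcs_finite[OF assms] in auto)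
  finally show ?thesis .
qed

lemma inv_eq_iff:
  assumes "g \<in> carrier G" "h \<in> carrier G"
  shows "g \<otimes> inv h = \<one> \<longleftrightarrow> g = h"
  using assms by (metis inv_closed inv_equality inv_inv r_inv)

text \<open>
  A search for a candidate \<open>v\<close> that precedes \<open>u\<close> and satisfies \<open>u v\<inverse> = 1\<close>. The word \<open>u\<close> is written on track
  \<open>0\<close>, and the inverse letters of \<open>v\<close> on track \<open>1\<close>, which is read backwards. A successful search sets the
  flag in all cells.
\<close>

lemma dcs_not_geodesic:
  assumes X: "sym_generating_set G X" and wp: "dcs X {w \<in> lists X. word_val G w = \<one>}" and r: "irrefl r"
  shows "dcs X {u \<in> lists X. \<exists>v\<in>lists X. word_val G v = word_val G u \<and> (v, u) \<in> lenlex r}"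
proof -
  define V where "V = insert None (Some ` X)"
  have finX: "finite X" and Xc: "X \<subseteq> carrier G" "\<And>x. x \<in> X \<Longrightarrow> inv x \<in> X"
    using X by (auto simp: sym_generating_set_def)
  have lXc: "lists X \<subseteq> lists (carrier G)" using Xc(1) by (rule lists_mono)
  define L where "L = {w \<in> lists V. word_val G (List.map_filter id w) = \<one>}"
  have L: "dcs V L" unfolding L_def V_def by (rule dcs_gapped_word_problem[OF wp])
  define F where "F z = precedes r (map (\<lambda>a. (fst (fst a), snd a)) z)" for z :: "(('a \<times> bool) \<times> 'a option) list"
  define \<rho> where "\<rho> f a j = (if j = 0 then Some (fst (fst a)) else map_option (m_inv G) (snd a))"
    for f :: bool and a :: "('a \<times> bool) \<times> 'a option" and j :: nat
  define upd where "upd X Xl a Xr = (fst (fst a), True)" for X Xl Xr :: bool and a :: "('a \<times> bool) \<times> 'a option"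
  define A where "A X = (case X of Some (_, s) \<Rightarrow> s | None \<Rightarrow> False)" for X :: "('a \<times> bool) option"
  define R where "R = {(c, sweep upd F (zip c v)) |c v. v \<in> lists V \<and> length v = length c \<and>
    (F (zip c v) \<and> snake 2 \<rho> (zip c v) \<in> L)}"
  have sw: "sweep upd F (zip c v) = map (\<lambda>a. (fst a, True)) c" if "length v = length c" for c v
    by (rule nth_equalityI) (simp_all add: that nth_sweep upd_def)
  have iff: "(\<exists>c. (map (\<lambda>a. (a, False)) u, c) \<in> R\<^sup>* \<and> A (find (\<lambda>_. True) c)) \<longleftrightarrow>
     (\<exists>v\<in>lists X. word_val G v = word_val G u \<and> (v, u) \<in> lenlex r)"
    if u: "u \<in> lists X" "u \<noteq> []" for u
  proof -
    define c0 where "c0 = map (\<lambda>a. (a, False)) u"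
    have len: "length c0 = length u" by (simp add: c0_def)
    have hit: "(F (zip c0 v) \<and> snake 2 \<rho> (zip c0 v) \<in> L) \<longleftrightarrow>
       precedes r (zip u v) \<and> word_val G (List.map_filter id v) = word_val G u"
      if v: "v \<in> lists V" "length v = length u" for v
    proof -
      have z: "length (zip c0 v) = length u" using v by (simp add: len)
      have "map (\<lambda>a. (fst (fst a), snd a)) (zip c0 v) = zip u v"
        by (rule nth_equalityI) (use v in \<open>simp_all add: c0_def\<close>)
      then have F: "F (zip c0 v) = precedes r (zip u v)" by (simp add: F_def)
      have "map (\<lambda>a. Some (fst (fst a))) (zip c0 v) = map Some u"
        "map (\<lambda>a. map_option (m_inv G) (snd a)) (zip c0 v) = map (map_option (m_inv G)) v"
        by (rule nth_equalityI; use v in \<open>simp add: c0_def\<close>)+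
      then have sn: "snake 2 \<rho> (zip c0 v) = map Some u @ rev (map (map_option (m_inv G)) v)"
        unfolding snake_numeral \<rho>_def
        using map_nth_fun[of "\<lambda>a. Some (fst (fst a))" "zip c0 v"]
          map_nth_fun[of "\<lambda>a. map_option (m_inv G) (snd a)" "zip c0 v"] by simp
      have v': "List.map_filter id v \<in> lists X"
        using v(1) by (intro map_filter_in) (auto simp: V_def in_lists_conv_set)
      have in_V: "snake 2 \<rho> (zip c0 v) \<in> lists V"
        unfolding sn using u v(1) Xc(2) by (auto simp: V_def in_lists_conv_set)
      have "List.map_filter id (snake 2 \<rho> (zip c0 v)) = u @ rev (map (m_inv G) (List.map_filter id v))"
        unfolding sn map_filter_append map_filter_rev map_filter_map id_apply map_filter_map_option map_filter_Some
        by (simp add: id_def)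
      moreover have "rev (map (m_inv G) (List.map_filter id v)) \<in> lists X"
        using v' Xc(2) by (auto simp: in_lists_conv_set)
      ultimately have "word_val G (List.map_filter id (snake 2 \<rho> (zip c0 v))) =
          word_val G u \<otimes> inv (word_val G (List.map_filter id v))"
        using u v' lXc by (simp add: word_val_append word_val_inv subsetD)
      then have "snake 2 \<rho> (zip c0 v) \<in> L \<longleftrightarrow> word_val G (List.map_filter id v) = word_val G u"
        using in_V inv_eq_iff[of "word_val G u" "word_val G (List.map_filter id v)"] u v' lXc
        by (auto simp: L_def subsetD)
      then show ?thesis unfolding F by blast
    qed
    have "A (find (\<lambda>_. True) (map (\<lambda>a. (fst a, True)) c0))" "\<not> A (find (\<lambda>_. True) c0)"
      using u by (cases u; simp add: A_def c0_def)+
    moreover have "(c0, d) \<in> R \<Longrightarrow> d = map (\<lambda>a. (fst a, True)) c0" for d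
      unfolding R_def using sw by auto
    ultimately have "(\<exists>c. (c0, c) \<in> R\<^sup>* \<and> A (find (\<lambda>_. True) c)) \<longleftrightarrow> (\<exists>d. (c0, d) \<in> R)"
      by (metis converse_rtranclE r_into_rtrancl)
    also have "\<dots> \<longleftrightarrow> (\<exists>v. v \<in> lists V \<and> length v = length u \<and> precedes r (zip u v) \<and>
        word_val G (List.map_filter id v) = word_val G u)"
      unfolding R_def using hit len by auto
    also have "\<dots> \<longleftrightarrow> (\<exists>v\<in>lists X. word_val G v = word_val G u \<and> (v, u) \<in> lenlex r)"
    proof
      assume "\<exists>v. v \<in> lists V \<and> length v = length u \<and> precedes r (zip u v) \<and>
        word_val G (List.map_filter id v) = word_val G u"
      then obtain v where v: "v \<in> lists V" "length v = length u" "precedes r (zip u v)"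
        "word_val G (List.map_filter id v) = word_val G u" by blast
      have "List.map_filter id v \<in> lists X"
        using v(1) by (intro map_filter_in) (auto simp: V_def in_lists_conv_set)
      then show "\<exists>v\<in>lists X. word_val G v = word_val G u \<and> (v, u) \<in> lenlex r"
        using lenlex_if_precedes[OF v(2,3)] v(4) by blast
    next
      assume "\<exists>v\<in>lists X. word_val G v = word_val G u \<and> (v, u) \<in> lenlex r"
      then obtain v where v: "v \<in> lists X" "word_val G v = word_val G u" "(v, u) \<in> lenlex r" by blast
      have "length v \<le> length u" using v(3) by (auto simp: lenlex_conv)
      then have "List.map_filter id (pad (length u) v) = v" by (rule map_filter_pad)
      then show "\<exists>v. v \<in> lists V \<and> length v = length u \<and> precedes r (zip u v) \<and>
        word_val G (List.map_filter id v) = word_val G u"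
        using precedes_if_lenlex[OF r v(3)] v(2) pad_in[OF v(1), of "length u"]
        by (intro exI[of _ "pad (length u) v"]) (simp add: V_def)
    qed
    finally show ?thesis by (simp add: c0_def)
  qed
  have "{u \<in> lists X. \<exists>v\<in>lists X. word_val G v = word_val G u \<and> (v, u) \<in> lenlex r} =
    {u \<in> lists X. if u = [] then False
       else \<exists>c. (map (\<lambda>a. (a, False)) u, c) \<in> R\<^sup>* \<and> A (find (\<lambda>_. True) c)}"
    by (intro Collect_cong conj_cong refl) (simp add: iff)
  also have "dcs X \<dots>"
    unfolding R_def
  proof (rule dcs_if_search[where \<Gamma> = "X \<times> UNIV" and V = V and I = "{()}" and \<Delta> = V and L = "\<lambda>_. L"
        and \<kappa> = "\<lambda>_. ()" and F = F and G = "find (\<lambda>_. True)" and \<Theta> = "\<lambda>s b. s \<and> b" and \<rho> = \<rho> and K = 2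
        and upd = upd])
    show "finite X" "finite (X \<times> (UNIV :: bool set))" "finite {()}" "finite V" "V \<noteq> {}"
      using finX by (simp_all add: V_def)
    show "recognizable (X \<times> (UNIV :: bool set)) (find (\<lambda>_. True))" using finX by (intro recognizable_find) simp
    show "recognizable ((X \<times> (UNIV :: bool set)) \<times> V) F"
      unfolding F_def
      by (rule recognizable_map[where \<Gamma>' = "X \<times> V", OF recognizable_precedes]) (use finX in \<open>auto simp: V_def\<close>)
    show "\<rho> f a j \<in> V" if "a \<in> (X \<times> (UNIV :: bool set)) \<times> V" "j < 2" for f a j
      using that Xc(2) by (auto simp: \<rho>_def V_def)
    show "sweep upd F z \<in> lists (X \<times> UNIV)" if z: "z \<in> lists ((X \<times> (UNIV :: bool set)) \<times> V)" for z
    proof (rule in_lists_nth)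
      fix i assume "i < length (sweep upd F z)"
      then show "sweep upd F z ! i \<in> X \<times> UNIV"
        using nth_lists[OF z, of i] by (auto simp: nth_sweep upd_def)
    qed
    show "d = d'"
      if "(c, d) \<in> {(c, sweep upd F (zip c v)) |c v. v \<in> lists V \<and> length v = length c \<and>
            (F (zip c v) \<and> snake 2 \<rho> (zip c v) \<in> L)}"
        "(c, d') \<in> {(c, sweep upd F (zip c v)) |c v. v \<in> lists V \<and> length v = length c \<and>
            (F (zip c v) \<and> snake 2 \<rho> (zip c v) \<in> L)}" for c d d'
      using that sw by auto
  qed (use L in auto)
  finally show ?thesis .
qed

text \<open>
  The multiplication languages consist of the convolutions whose components are geodesics and which
  pass one query to the word problem. Reading tracks forwards and backwards gives \<open>u\<close> and \<open>v\<inverse>\<close>; since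
  only the first cell can be told apart from the others, the letter \<open>x\<close> has to come first, and the
  conditions \<open>v = u x\<close> and \<open>v = x u\<close> are tested as \<open>x v\<inverse> u = 1\<close> and \<open>x u v\<inverse> = 1\<close>.
\<close>

theorem shortlex_biautomatic_if_word_problem:
  assumes "dcs_word_problem_group G"
  shows "shortlex_dcs_biautomatic_group G"
proof -
  obtain X where X: "sym_generating_set G X" and wp: "dcs X {w \<in> lists X. word_val G w = \<one>}"
    using assms by (auto simp: dcs_word_problem_group_def dcs_word_problem_def)
  have finX: "finite X" and Xc: "X \<subseteq> carrier G" "\<And>x. x \<in> X \<Longrightarrow> inv x \<in> X"
    using X by (auto simp: sym_generating_set_def)
  have lXc: "lists X \<subseteq> lists (carrier G)" using Xc(1) by (rule lists_mono)
  obtain e :: "'a \<Rightarrow> nat" where e: "inj_on e X" using finite_imp_inj_to_nat_seg[OF finX] by blast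
  define r where "r = {(x, y). x \<in> X \<and> y \<in> X \<and> e x < e y}"
  have rX: "r \<subseteq> X \<times> X" by (auto simp: r_def)
  have irr: "irrefl r" by (auto simp: r_def irrefl_def)
  have slo: "strict_linear_order_on X r"
    using e by (auto simp: strict_linear_order_on_def r_def trans_def irrefl_def total_on_def inj_on_def)
      (metis linorder_neqE_nat)
  have "wf r" by (rule wf_subset[OF wf_measure[of e]]) (auto simp: r_def)
  then have wfl: "wf (lenlex r)" by (rule wf_lenlex)
  have tot: "(u, v) \<in> lenlex r \<or> (v, u) \<in> lenlex r" if "u \<in> lists X" "v \<in> lists X" "u \<noteq> v" for u v
    using lenlex_total[OF _ that] slo by (auto simp: strict_linear_order_on_def)
  define S where "S = shortlex_geodesics G X r"
  have S_in: "S \<subseteq> lists X" by (auto simp: S_def shortlex_geodesics_def)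
  have asym: "\<not> ((u, v) \<in> lenlex r \<and> (v, u) \<in> lenlex r)" for u v
    using wf_not_sym[OF wfl] by blast
  have S_eq: "S = lists X - {u \<in> lists X. \<exists>v\<in>lists X. word_val G v = word_val G u \<and> (v, u) \<in> lenlex r}"
    unfolding S_def shortlex_geodesics_def using tot asym by (auto; blast)
  have dcsS: "dcs X S" unfolding S_eq by (rule dcs_Compl[OF dcs_not_geodesic[OF X wp irr]])
  have nil: "[] \<in> S" unfolding S_eq by (auto simp: lenlex_conv)
  have "bij_betw (word_val G) S (carrier G)"
    unfolding bij_betw_def
  proof (intro conjI equalityI subsetI)
    show "inj_on (word_val G) S"
    proof (rule inj_onI, rule ccontr)
      fix u v assume "u \<in> S" "v \<in> S" "word_val G u = word_val G v" "u \<noteq> v"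
      then have "(u, v) \<in> lenlex r" "(v, u) \<in> lenlex r" unfolding S_def shortlex_geodesics_def by auto
      then show False using asym by blast
    qed
    show "g \<in> carrier G" if "g \<in> word_val G ` S" for g
      using that S_in lXc word_val_closed by blast
    show "g \<in> word_val G ` S" if g: "g \<in> carrier G" for g
    proof -
      obtain w where w: "w \<in> {w \<in> lists X. word_val G w = g}" using word_val_surj[OF X g] by blast
      then obtain u where u: "u \<in> {w \<in> lists X. word_val G w = g}"
        "\<And>v. (v, u) \<in> lenlex r \<Longrightarrow> v \<notin> {w \<in> lists X. word_val G w = g}"
        using wfE_min[OF wfl w] by blast
      then have "u \<in> S" unfolding S_eq by blast
      then show ?thesis using u(1) by blast
    qed
  qed
  then have nf: "normal_form G X S (word_val G)" using S_in by (simp add: normal_form_def)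
  define V where "V = insert None (Some ` X)"
  define CA where "CA = conv_alphabet X"
  have CA: "CA = V \<times> V" by (simp add: CA_def V_def conv_alphabet_def)
  have finCA: "finite CA" using finX by (simp add: CA V_def)
  define L where "L = {w \<in> lists V. word_val G (List.map_filter id w) = \<one>}"
  have L: "dcs V L" unfolding L_def V_def by (rule dcs_gapped_word_problem[OF wp])
  have comp: "List.map_filter f z \<in> lists X" if "z \<in> lists CA" "f = fst \<or> f = snd" for f z
    using that by (intro map_filter_in) (auto simp: CA V_def in_lists_conv_set)
  \<comment> \<open>Both multiplication languages have this form for a suitable query.\<close>
  have mult: "dcs CA {conv u v |u v. u \<in> S \<and> v \<in> S \<and> P u v}"
    if K: "0 < K" and \<rho>: "\<And>f a j. \<lbrakk>a \<in> CA; j < K\<rbrakk> \<Longrightarrow> \<rho> f a j \<in> V"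
      and P: "\<And>z. \<lbrakk>z \<in> lists CA; z \<noteq> []\<rbrakk> \<Longrightarrow> word_val G (List.map_filter id (snake K \<rho> z)) = \<one> \<longleftrightarrow>
        P (List.map_filter fst z) (List.map_filter snd z)" for P K \<rho>
  proof -
    have Q: "dcs CA {z \<in> lists CA. if z = [] then P [] [] else proper z \<and> snake K \<rho> z \<in> L}" (is "dcs _ ?Q")
      by (rule dcs_if_query[OF finCA recognizable_proper[OF finCA] L, where \<Theta> = "\<lambda>a b. a \<and> b"])
        (use \<rho> K in auto)
    have S1: "dcs CA {z \<in> lists CA. List.map_filter fst z \<in> S}" (is "dcs _ ?S1")
      by (rule dcs_erase[OF dcsS finCA]) (auto simp: CA V_def)
    have S2: "dcs CA {z \<in> lists CA. List.map_filter snd z \<in> S}" (is "dcs _ ?S2")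
      by (rule dcs_erase[OF dcsS finCA]) (auto simp: CA V_def)
    have "dcs CA (?Q \<inter> (?S1 \<inter> ?S2))" by (rule dcs_Int[OF Q dcs_Int[OF S1 S2]])
    also have "?Q \<inter> (?S1 \<inter> ?S2) = {conv u v |u v. u \<in> S \<and> v \<in> S \<and> P u v}"
    proof (intro equalityI subsetI)
      fix z assume z: "z \<in> ?Q \<inter> (?S1 \<inter> ?S2)"
      let ?u = "List.map_filter fst z" and ?v = "List.map_filter snd z"
      have "z = conv ?u ?v \<and> P ?u ?v"
      proof (cases "z = []")
        case True then show ?thesis using z by (simp add: List.map_filter_def conv_def)
      next
        case False
        then have "proper z" "word_val G (List.map_filter id (snake K \<rho> z)) = \<one>" "z \<in> lists CA"
          using z by (auto simp: L_def)
        then show ?thesis using P[of z] False conv_of_proper[of z] by blast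
      qed
      then show "z \<in> {conv u v |u v. u \<in> S \<and> v \<in> S \<and> P u v}" using z by blast
    next
      fix z assume "z \<in> {conv u v |u v. u \<in> S \<and> v \<in> S \<and> P u v}"
      then obtain u v where uv: "z = conv u v" "u \<in> S" "v \<in> S" "P u v" by blast
      have z: "z \<in> lists CA" unfolding uv(1) CA_def using uv(2,3) S_in by (intro conv_in) auto
      have c: "List.map_filter fst z = u" "List.map_filter snd z = v" "proper z"
        using map_filter_conv[of u v] proper_conv[of u v] by (simp_all add: uv(1))
      have "snake K \<rho> z \<in> lists V" by (rule snake_in[OF _ z], erule \<rho>, assumption)
      then have "z \<noteq> [] \<Longrightarrow> snake K \<rho> z \<in> L" using P[OF z] uv(4) c by (simp add: L_def)
      moreover have "z = [] \<Longrightarrow> P [] []" using c uv(4) by (auto simp: List.map_filter_def)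
      ultimately show "z \<in> ?Q \<inter> (?S1 \<inter> ?S2)" using z c uv(2,3) by auto
    qed
    finally show ?thesis .
  qed
  have "dcs CA (right_mult_lang G S (word_val G) x)" if x: "x \<in> X" for x
    unfolding right_mult_lang_def
  proof (rule mult[where K = 3 and \<rho> = "\<lambda>f a j. if j = 0 then (if f then Some x else None)
        else if j = 1 then map_option (m_inv G) (snd a) else fst a"])
    fix z assume z: "z \<in> lists CA" "z \<noteq> []"
    let ?\<rho> = "\<lambda>f (a :: 'a option \<times> 'a option) (j :: nat). if j = 0 then (if f then Some x else None)
        else if j = 1 then map_option (m_inv G) (snd a) else fst a"
    let ?u = "List.map_filter fst z" and ?v = "List.map_filter snd z"
    have uv: "?u \<in> lists (carrier G)" "?v \<in> lists (carrier G)" using comp[OF z(1)] lXc by blast+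
    have "List.map_filter id (snake 3 ?\<rho> z) = [x] @ rev (map (m_inv G) ?v) @ ?u"
      unfolding snake_numeral
      by (simp add: map_nth_fun[of "\<lambda>a. map_option (m_inv G) (snd a)"] map_nth_fun[of fst] map_filter_append
          map_filter_first[OF z(2)] map_filter_rev map_filter_map map_filter_map_option map_filter_None)
    also have "word_val G \<dots> = x \<otimes> (inv (word_val G ?v) \<otimes> word_val G ?u)"
    proof -
      have "rev (map (m_inv G) ?v) \<in> lists (carrier G)" using uv(2) by (auto simp: in_lists_conv_set)
      then show ?thesis using uv by (simp add: word_val_append word_val_inv)
    qed
    finally have val: "word_val G (List.map_filter id (snake 3 ?\<rho> z)) = x \<otimes> (inv (word_val G ?v) \<otimes> word_val G ?u)" .
    show "word_val G (List.map_filter id (snake 3 ?\<rho> z)) = \<one> \<longleftrightarrow> word_val G ?v = word_val G ?u \<otimes> x"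
      unfolding val
    proof -
      have c: "x \<in> carrier G" "word_val G ?u \<in> carrier G" "word_val G ?v \<in> carrier G" using x Xc uv by auto
      have "x \<otimes> (inv (word_val G ?v) \<otimes> word_val G ?u) = \<one> \<longleftrightarrow> inv (word_val G ?v) \<otimes> word_val G ?u = inv x"
        using c by (metis inv_closed inv_equality inv_inv l_inv m_closed r_inv inv_unique')
      also have "\<dots> \<longleftrightarrow> word_val G ?u = word_val G ?v \<otimes> inv x"
        using c by (metis inv_closed inv_solve_left)
      also have "\<dots> \<longleftrightarrow> word_val G ?v = word_val G ?u \<otimes> x"
        using c by (metis inv_solve_right)
      finally show "x \<otimes> (inv (word_val G ?v) \<otimes> word_val G ?u) = \<one> \<longleftrightarrow> word_val G ?v = word_val G ?u \<otimes> x" .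
    qed
  qed (use x Xc(2) in \<open>auto simp: CA V_def\<close>)
  moreover have "dcs CA (left_mult_lang G S (word_val G) x)" if x: "x \<in> X" for x
    unfolding left_mult_lang_def
  proof (rule mult[where K = 4 and \<rho> = "\<lambda>f a j. if j = 0 then (if f then Some x else None)
        else if j = 1 then None else if j = 2 then fst a else map_option (m_inv G) (snd a)"])
    fix z assume z: "z \<in> lists CA" "z \<noteq> []"
    let ?\<rho> = "\<lambda>f (a :: 'a option \<times> 'a option) (j :: nat). if j = 0 then (if f then Some x else None)
        else if j = 1 then None else if j = 2 then fst a else map_option (m_inv G) (snd a)"
    let ?u = "List.map_filter fst z" and ?v = "List.map_filter snd z"
    have uv: "?u \<in> lists (carrier G)" "?v \<in> lists (carrier G)" using comp[OF z(1)] lXc by blast+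
    have "List.map_filter id (snake 4 ?\<rho> z)
      = [x] @ ?u @ rev (map (m_inv G) ?v)"
      unfolding snake_numeral
      by (simp add: map_nth_fun[of "\<lambda>a. map_option (m_inv G) (snd a)"] map_nth_fun[of fst] map_filter_append
          map_filter_first[OF z(2)] map_filter_rev map_filter_map map_filter_map_option map_filter_None)
    also have "word_val G \<dots> = (x \<otimes> word_val G ?u) \<otimes> inv (word_val G ?v)"
    proof -
      have "rev (map (m_inv G) ?v) \<in> lists (carrier G)" using uv(2) by (auto simp: in_lists_conv_set)
      then show ?thesis using uv x Xc(1) by (simp add: word_val_append word_val_inv m_assoc subsetD)
    qed
    finally have val: "word_val G (List.map_filter id (snake 4 ?\<rho> z))
      = (x \<otimes> word_val G ?u) \<otimes> inv (word_val G ?v)" .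
    have "x \<in> carrier G" using x Xc(1) by blast
    then have c: "x \<otimes> word_val G ?u \<in> carrier G" "word_val G ?v \<in> carrier G"
      using uv word_val_closed by blast+
    show "word_val G (List.map_filter id (snake 4 ?\<rho> z)) = \<one>
       \<longleftrightarrow> word_val G ?v = x \<otimes> word_val G ?u"
      unfolding val inv_eq_iff[OF c] by (rule eq_commute)
  qed (use x Xc(2) in \<open>auto simp: CA V_def\<close>)
  ultimately have "dcs_biautomatic G X S (word_val G)"
    using X nf dcsS by (simp add: dcs_biautomatic_def CA_def)
  then show ?thesis unfolding shortlex_dcs_biautomatic_group_def using rX slo S_def by blast
qed

end

section \<open>From graph automatic groups to the word problem\<close>

text \<open>
  Cells that store one letter for each track, read along the tracks.
\<close>

abbreviation flat :: "nat \<Rightarrow> 'b list list \<Rightarrow> 'b list" where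
  "flat K y \<equiv> snake K (\<lambda>_ l j. l ! j) y"

lemma flat_place:
  assumes "i < length y" "j < K"
  shows "nat (place (int (length y)) (int j) (int i)) < K * length y"
    and "flat K y ! nat (place (int (length y)) (int j) (int i)) = y ! i ! j"
proof -
  define n where "n = length y"
  define p where "p = nat (place (int n) (int j) (int i))"
  have i: "i < n" using assms(1) by (simp add: n_def)
  have "0 \<le> place (int n) (int j) (int i)" using i by (auto simp: place_def)
  then have p: "int p = place (int n) (int j) (int i)" by (simp add: p_def)
  have "int p div int n = int j" using i unfolding p by (intro place_div) simp_all
  then have d: "p div n = j" by (metis of_nat_eq_iff zdiv_int)
  have c: "column (int n) (int p) = int i" using i unfolding p by (intro column_place) simp_all
  have "p < K * n" using d i assms(2) by (metis div_less_iff_less_mult less_nat_zero_code gr0I)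
  then show "nat (place (int (length y)) (int j) (int i)) < K * length y"
    "flat K y ! nat (place (int (length y)) (int j) (int i)) = y ! i ! j"
    using nth_snake[of p K y "\<lambda>_ l j. l ! j"] c d by (simp_all add: p_def n_def)
qed

lemma flat_inj:
  assumes "flat K y = flat K y'" "length y = length y'"
    "y \<in> lists {l. set l \<subseteq> B \<and> length l = K}" "y' \<in> lists {l. set l \<subseteq> B \<and> length l = K}"
  shows "y = y'"
proof (rule nth_equalityI)
  show "length y = length y'" by (rule assms)
  fix i assume i: "i < length y"
  then have l: "length (y ! i) = K" "length (y' ! i) = K"
    using nth_lists[OF assms(3), of i] nth_lists[OF assms(4), of i] assms(2) by auto
  show "y ! i = y' ! i"
  proof (rule nth_equalityI)
    fix j assume "j < length (y ! i)"
    then show "y ! i ! j = y' ! i ! j"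
      using flat_place(2)[of i y j K] flat_place(2)[of i y' j K] i l assms(1,2) by simp
  qed (simp add: l)
qed

text \<open>
  Every word of length \<open>K * n\<close> can be distributed over \<open>n\<close> cells.
\<close>

lemma flat_surj:
  assumes Z: "Z \<in> lists B" "length Z = K * n" and n: "0 < n"
  shows "\<exists>y. length y = n \<and> y \<in> lists {l. set l \<subseteq> B \<and> length l = K} \<and> flat K y = Z"
proof -
  define y where "y = map (\<lambda>i. map (\<lambda>j. Z ! nat (place (int n) (int j) (int i))) [0..<K]) [0..<n]"
  have len: "length y = n" by (simp add: y_def)
  have "Z ! nat (place (int n) (int j) (int i)) \<in> B" if "i < n" "j < K" for i j
    using flat_place(1)[of i y j K] that Z by (intro nth_lists[OF Z(1)]) (simp add: len)
  then have "y \<in> lists {l. set l \<subseteq> B \<and> length l = K}"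
    by (auto simp: y_def in_lists_conv_set)
  moreover have "flat K y = Z"
  proof (rule nth_equalityI)
    fix p assume "p < length (flat K y)"
    then have p: "p < K * n" by (simp add: len)
    define i where "i = nat (column (int n) (int p))"
    have i: "int i = column (int n) (int p)" "i < n"
      using column_bounds[of "int n" "int p"] n by (auto simp: i_def)
    have "p div n < K" using p by (simp add: less_mult_imp_div_less)
    then have "y ! i ! (p div n) = Z ! nat (place (int n) (int (p div n)) (int i))"
      using i(2) by (simp add: y_def)
    also have "place (int n) (int (p div n)) (int i) = int p"
      unfolding i(1) zdiv_int using n by (intro place_column) simp
    finally show "flat K y ! p = Z ! p"
      using nth_snake[of p K y "\<lambda>_ l j. l ! j"] p by (simp add: len i_def)
  qed (simp add: len Z)
  ultimately show ?thesis using len by blast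
qed

lemma snake_zip:
  assumes "length v = length c"
  shows "snake K (\<lambda>_ a j. (f (fst a) ! j, snd a ! j)) (zip c v) = zip (flat K (map f c)) (flat K v)"
proof (rule nth_equalityI)
  fix p assume "p < length (snake K (\<lambda>_ a j. (f (fst a) ! j, snd a ! j)) (zip c v))"
  then have p: "p < K * length c" using assms by simp
  define i where "i = nat (column (int (length c)) (int p))"
  have "0 < int (length c)" using p by (cases c) auto
  then have i: "i < length c" using column_bounds[of "int (length c)" "int p"] by (auto simp: i_def)
  have "snake K (\<lambda>_ a j. (f (fst a) ! j, snd a ! j)) (zip c v) ! p
      = (f (c ! i) ! (p div length c), v ! i ! (p div length c))"
    using nth_snake[of p K "zip c v" "\<lambda>_ a j. (f (fst a) ! j, snd a ! j)"] p i assms by (simp add: i_def)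
  moreover have "flat K (map f c) ! p = f (c ! i) ! (p div length c)"
    using nth_snake[of p K "map f c" "\<lambda>_ l j. l ! j"] p i by (simp add: i_def)
  moreover have "flat K v ! p = v ! i ! (p div length c)"
    using nth_snake[of p K v "\<lambda>_ l j. l ! j"] p assms by (simp add: i_def)
  ultimately show "snake K (\<lambda>_ a j. (f (fst a) ! j, snd a ! j)) (zip c v) ! p = zip (flat K (map f c)) (flat K v) ! p"
    using p assms by simp
qed (simp add: assms)

lemma pad_extend: "length u \<le> m \<Longrightarrow> pad m u @ replicate k None = pad (m + k) u"
  by (rule nth_equalityI) (auto simp: nth_pad nth_append)

text \<open>
  Two words padded to a common length form a convolution followed by empty pairs, so the multiplication
  languages can be queried on padded words after erasing the empty pairs. Requiring the empty pairs at
  the end excludes gaps inside a word.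
\<close>

lemma tidy_conv_iff:
  assumes len: "length U = N" "length V = N"
  shows "tidy (\<lambda>a. a \<noteq> (None, None)) (zip U V) \<and> filter (\<lambda>a. a \<noteq> (None, None)) (zip U V) = conv u v
    \<longleftrightarrow> length u \<le> N \<and> length v \<le> N \<and> U = pad N u \<and> V = pad N v" (is "?l \<longleftrightarrow> ?r")
proof
  let ?M = "max (length u) (length v)"
  assume l: ?l
  define rest where "rest = filter (\<lambda>a. \<not> a \<noteq> (None, None)) (zip U V)"
  have z: "zip U V = conv u v @ rest" using tidy_split[of "\<lambda>a. a \<noteq> (None, None)" "zip U V"] l
    by (simp add: rest_def)
  have rest: "rest = replicate (length rest) (None, None)"
    by (rule replicate_eqI) (auto simp: rest_def)
  have N: "N = ?M + length rest" using arg_cong[OF z, of length] len by simp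
  have "U = map fst (zip U V)" "V = map snd (zip U V)" using len by simp_all
  then have "U = map fst (conv u v) @ map fst rest" "V = map snd (conv u v) @ map snd rest"
    unfolding z by simp_all
  moreover have "map fst rest = replicate (length rest) None" "map snd rest = replicate (length rest) None"
    by (subst rest, simp)+
  ultimately have "U = pad ?M u @ replicate (length rest) None" "V = pad ?M v @ replicate (length rest) None"
    by (simp_all add: conv_eq)
  moreover have "length u \<le> ?M + length rest" "length v \<le> ?M + length rest" by simp_all
  ultimately show ?r unfolding N by (simp only: pad_extend max.cobounded1 max.cobounded2 simp_thms)
next
  let ?M = "max (length u) (length v)"
  assume r: ?r
  then have "N = ?M + (N - ?M)" by simp
  then have "U = pad ?M u @ replicate (N - ?M) None" "V = pad ?M v @ replicate (N - ?M) None"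
    using r by (simp_all add: pad_extend)
  then have z: "zip U V = conv u v @ replicate (N - ?M) (None, None)"
    by (simp add: conv_eq zip_replicate)
  have nz: "\<forall>a\<in>set (conv u v). a \<noteq> (None, None)" using conv_nonempty_letters by blast
  have "tidy (\<lambda>a. a \<noteq> (None, None)) (conv u v)" "tidy (\<lambda>a. a \<noteq> (None, None)) (replicate k (None, None))" for k
    using nz unfolding tidy_def by (auto simp: sorted_wrt_iff_nth_less)
  then have "tidy (\<lambda>a. a \<noteq> (None, None)) (zip U V)"
    unfolding z using nz by (auto simp: tidy_def sorted_wrt_append)
  moreover have "filter (\<lambda>a. a \<noteq> (None, None)) (zip U V) = conv u v"
    unfolding z using nz by (simp add: filter_id_conv)
  ultimately show ?l by blast
qed

lemma recognizable_take:
  fixes \<Gamma> :: "'a set"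
  assumes "finite \<Gamma>"
  shows "recognizable \<Gamma> (take k)"
proof (rule recognizable_if_morphism)
  have "take k ` lists \<Gamma> \<subseteq> {xs. set xs \<subseteq> \<Gamma> \<and> length xs \<le> k}"
    by (auto simp: in_lists_conv_set dest: in_set_takeD)
  then show "finite (take k ` lists \<Gamma>)" using finite_lists_length_le[OF assms] finite_subset by blast
  show "take k (u @ v) = take k (u' @ v')" if "take k u = take k u'" "take k v = take k v'"
    for u u' v v' :: "'a list"
  proof -
    have t: "take k (u @ v) = take k (take k u @ take k v)" for u v :: "'a list"
      by (cases "length u \<le> k") (simp_all add: min_def)
    show ?thesis by (simp only: t[of u v] t[of u' v'] that)
  qed
qed

text \<open>
  Among the words of \<open>L\<close>, the word \<open>u\<close> is recognized by an initial part of length \<open>length u + 1\<close>.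
\<close>

lemma dcs_singleton:
  assumes "dcs \<Lambda> L" "u \<in> L"
  shows "dcs \<Lambda> {u}"
proof -
  have "w = u" if "take (Suc (length u)) w = u" for w
  proof -
    have "length (take (Suc (length u)) w) = length u" using that by simp
    then have "length w = length u" by (simp add: min_def split: if_splits)
    then show ?thesis using that by simp
  qed
  then have "{u} = {w \<in> L. take (Suc (length u)) w = u}" using assms(2) by auto
  also have "dcs \<Lambda> \<dots>"
    by (rule dcs_Int_recognizable[OF assms(1) recognizable_take[OF dcs_finite[OF assms(1)]]])
  finally show ?thesis .
qed

text \<open>
  An input letter, its stage, and the parts of the stored and of the current normal form in this cell, one
  padded letter for each track.
\<close>

type_synonym 'a work_cell = "'a \<times> nat \<times> nat option list \<times> nat option list"

context group
begin

text \<open>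
  A system of cells, each of which holds a letter of the input, a stage, the stored normal form \<open>u0\<close> of the
  identity and the current normal form, both distributed over \<open>K\<close> tracks. Stage \<open>0\<close> lasts until \<open>u0\<close> has
  been found; a search finds it, since its letters may be spread over cells and tracks in different
  ways, depending on the length of the input. Afterwards stage \<open>1\<close> marks the letters still to be multiplied and stage \<open>2\<close> those
  already done. The first letter in stage \<open>1\<close> selects the multiplication language for the search of the
  next normal form. When all letters are done, the two stored words are compared cell by cell.
\<close>

theorem word_problem_if_graph_automatic:
  assumes "quasigeodesic_dcs_graph_automatic_group G"
  shows "dcs_word_problem_group G"
proof -
  obtain X and \<Lambda> :: "nat set" and L \<nu> D where ga: "dcs_graph_automatic G X \<Lambda> L \<nu>"
    and D: "\<And>u. u \<in> L \<Longrightarrow> length u \<le> D * (word_norm G X (\<nu> u) + 1)"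
    using assms unfolding quasigeodesic_dcs_graph_automatic_group_def quasigeodesic_def by blast
  have X: "sym_generating_set G X" and fin\<Lambda>: "finite \<Lambda>" and dcsL: "dcs \<Lambda> L"
    and LL: "L \<subseteq> lists \<Lambda>" and bij: "bij_betw \<nu> L (carrier G)"
    and rm: "\<And>x. x \<in> X \<Longrightarrow> dcs (conv_alphabet \<Lambda>) (right_mult_lang G L \<nu> x)"
    using ga by (auto simp: dcs_graph_automatic_def normal_form_def)
  have finX: "finite X" and Xc: "X \<subseteq> carrier G" using X by (auto simp: sym_generating_set_def)
  have lXc: "lists X \<subseteq> lists (carrier G)" using Xc by (rule lists_mono)
  have inj: "u = v" if "u \<in> L" "v \<in> L" "\<nu> u = \<nu> v" for u v
    using bij that by (auto simp: bij_betw_def inj_on_def)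
  define nf where "nf = the_inv_into L \<nu>"
  have nf: "nf g \<in> L" "\<nu> (nf g) = g" if "g \<in> carrier G" for g
    using bij that f_the_inv_into_f_bij_betw[OF bij, of g] the_inv_into_into[of \<nu> L g L]
    by (auto simp: nf_def bij_betw_def)
  define OL where "OL = insert None (Some ` \<Lambda>)"
  define CA where "CA = conv_alphabet \<Lambda>"
  have CA: "CA = OL \<times> OL" by (simp add: CA_def OL_def conv_alphabet_def)
  have finCA: "finite CA" "finite OL" using fin\<Lambda> by (simp_all add: CA OL_def)
  define nz :: "nat option \<times> nat option \<Rightarrow> bool" where "nz a \<longleftrightarrow> a \<noteq> (None, None)" for a
  define u0 where "u0 = nf \<one>"
  have u0: "u0 \<in> L" "\<nu> u0 = \<one>" using nf by (simp_all add: u0_def)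
  \<comment> \<open>The languages for the queries: \<open>None\<close> asks for \<open>u0\<close> in the second component, \<open>Some x\<close> for right
    multiplication by \<open>x\<close>.\<close>
  define LX where "LX k = (case k of
      Some x \<Rightarrow> {z \<in> lists CA. tidy nz z \<and> filter nz z \<in> right_mult_lang G L \<nu> x}
    | None \<Rightarrow> {z \<in> lists CA. tidy (\<lambda>a. snd a \<noteq> None) z \<and> List.map_filter snd z = u0})" for k
  have LX_dcs: "dcs CA (LX k)" if "k \<in> insert None (Some ` X)" for k
  proof (cases k)
    case None
    have "dcs CA {z \<in> lists CA. List.map_filter snd z \<in> {u0}}"
      by (rule dcs_erase[OF dcs_singleton[OF dcsL u0(1)] finCA(1)]) (auto simp: CA OL_def)
    from dcs_Int_recognizable[OF this recognizable_tidy, of "\<lambda>b. b" "\<lambda>a. snd a \<noteq> None"]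
    show ?thesis by (simp add: LX_def None conj_assoc conj_commute)
  next
    case (Some x)
    then have x: "x \<in> X" using that by auto
    have "List.map_filter (\<lambda>a. if nz a then Some a else None) z = filter nz z" for z
      by (induction z) (auto simp: List.map_filter_def)
    moreover have "dcs CA {z \<in> lists CA. List.map_filter (\<lambda>a. if nz a then Some a else None) z \<in> right_mult_lang G L \<nu> x}"
      by (rule dcs_erase[OF rm[OF x] finCA(1)]) (auto simp: CA_def split: if_splits)
    ultimately have "dcs CA {z \<in> lists CA. filter nz z \<in> right_mult_lang G L \<nu> x}" by simp
    from dcs_Int_recognizable[OF this recognizable_tidy, of "\<lambda>b. b" nz]
    show ?thesis by (rule back_subst[of "dcs CA"]) (auto simp: LX_def Some)
  qed
  have LX_None: "zip U V \<in> LX None \<longleftrightarrow> length u0 \<le> N \<and> V = pad N u0"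
    if "U \<in> lists OL" "V \<in> lists OL" "length U = N" "length V = N" for U V N
  proof -
    have z: "zip U V \<in> lists CA" using that(1,2)
      by (auto simp: CA in_lists_conv_set dest: set_zip_leftD set_zip_rightD)
    have "map snd (zip U V) = V" using that by simp
    then have "tidy (\<lambda>a. snd a \<noteq> None) (zip U V) = tidy (\<lambda>a. a \<noteq> None) V"
      "List.map_filter snd (zip U V) = List.map_filter id V"
      using tidy_map[of "\<lambda>a. a \<noteq> None" snd "zip U V"] map_filter_map[of id snd "zip U V"] by simp_all
    then have "zip U V \<in> LX None \<longleftrightarrow> tidy (\<lambda>a. a \<noteq> None) V \<and> List.map_filter id V = u0"
      using z by (simp add: LX_def)
    also have "\<dots> \<longleftrightarrow> length u0 \<le> N \<and> V = pad N u0"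
    proof
      assume a: "tidy (\<lambda>a. a \<noteq> None) V \<and> List.map_filter id V = u0"
      have "length (List.map_filter id V) \<le> length V" by (simp add: List.map_filter_def)
      then show "length u0 \<le> N \<and> V = pad N u0" using a tidy_eq_pad[of V] that(4) by simp
    next
      assume "length u0 \<le> N \<and> V = pad N u0"
      then show "tidy (\<lambda>a. a \<noteq> None) V \<and> List.map_filter id V = u0"
        using tidy_pad[of N u0] map_filter_pad[of u0 N] by blast
    qed
    finally show ?thesis .
  qed
  have LX_Some: "zip U V \<in> LX (Some x) \<longleftrightarrow> (\<exists>u v. u \<in> L \<and> v \<in> L \<and> \<nu> v = \<nu> u \<otimes> x \<and>
      length u \<le> N \<and> length v \<le> N \<and> U = pad N u \<and> V = pad N v)"
    if "U \<in> lists OL" "V \<in> lists OL" "length U = N" "length V = N" for U V N x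
  proof -
    have z: "zip U V \<in> lists CA" using that(1,2)
      by (auto simp: CA in_lists_conv_set dest: set_zip_leftD set_zip_rightD)
    have "zip U V \<in> LX (Some x) \<longleftrightarrow> (\<exists>u v. u \<in> L \<and> v \<in> L \<and> \<nu> v = \<nu> u \<otimes> x \<and>
      (tidy nz (zip U V) \<and> filter nz (zip U V) = conv u v))"
      using z by (auto simp: LX_def right_mult_lang_def)
    then show ?thesis using tidy_conv_iff[OF that(3,4)] unfolding nz_def by (simp only:)
  qed
  \<comment> \<open>Normal forms of prefixes have length at most \<open>D * (n + 1)\<close>, and \<open>n + 1\<close> is at most \<open>2 * n\<close> for a
    nonempty input.\<close>
  define K where "K = 2 * (D + 1)"
  define W where "W = {l. set l \<subseteq> OL \<and> length l = K}"
  have finW: "finite W" unfolding W_def by (rule finite_lists_length_eq[OF finCA(2)])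
  define E where "E = replicate K (None :: nat option)"
  have E: "E \<in> W" by (auto simp: E_def W_def OL_def)
  define \<Gamma> where "\<Gamma> = X \<times> {..2 :: nat} \<times> W \<times> W"
  define st where "st c = fst (snd c)" for c :: "'a work_cell"
  define cur where "cur c = snd (snd (snd c))" for c :: "'a work_cell"
  define F' where "F' c = (find (\<lambda>_. True) c, find (\<lambda>a. st a \<noteq> 2) c)" for c
  define F where "F z = F' (map fst z)"
    for z :: "('a work_cell \<times> nat option list) list"
  define \<kappa> where "\<kappa> X = (case X of (h, t) \<Rightarrow> (case h of None \<Rightarrow> None | Some a \<Rightarrow> if st a = 0 then None
      else (case t of Some b \<Rightarrow> Some (fst b) | None \<Rightarrow> Some (fst a))))"
    for X :: "'a work_cell option \<times>
      'a work_cell option"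
  define \<rho> where "\<rho> = (\<lambda>(f :: bool) a j. (cur (fst a) ! j, snd a ! j :: nat option))"
  define \<Theta> where "\<Theta> X b \<longleftrightarrow> b \<and> snd X \<noteq> None"
    for b and X :: "'a work_cell option \<times>
      'a work_cell option"
  define upd where "upd X Xl a Xr = (case a of ((x, s, U0, U), v) \<Rightarrow>
      if s = 0 then (x, 1, v, v) else (x, if s = 1 \<and> snd Xl = None then 2 else s, U0, v))"
    for X Xl Xr :: "'a work_cell option \<times>
      'a work_cell option"
    and a :: "'a work_cell \<times> nat option list"
  define G' where "G' = find (\<lambda>c :: 'a work_cell.
      st c \<noteq> 2 \<or> fst (snd (snd c)) \<noteq> cur c)"
  define ok where "ok z = \<Theta> (F z) (snake K \<rho> z \<in> LX (\<kappa> (F z)))" for z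
  define R where "R = {(c, sweep upd F (zip c v)) |c v. v \<in> lists W \<and> length v = length c \<and> ok (zip c v)}"
  have ok_iff: "ok (zip c v) \<longleftrightarrow> zip (flat K (map cur c)) (flat K v) \<in> LX (\<kappa> (F' c)) \<and> snd (F' c) \<noteq> None"
    if "length v = length c" for c v
  proof -
    have "map fst (zip c v) = c" using that by simp
    then show ?thesis using snake_zip[OF that, of K cur] by (simp add: ok_def \<Theta>_def F_def \<rho>_def)
  qed
  have flat_in: "flat K y \<in> lists OL" if "y \<in> lists W" for y
    by (rule snake_in[OF _ that]) (auto simp: W_def)
  have unique_v: "v = v'" if c: "c \<in> lists \<Gamma>" and v: "v \<in> lists W" "length v = length c" "ok (zip c v)"
    and v': "v' \<in> lists W" "length v' = length c" "ok (zip c v')" for c v v'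
  proof -
    have "map cur c \<in> lists W" using c by (auto simp: \<Gamma>_def cur_def in_lists_conv_set)
    note f = flat_in[OF this] flat_in[OF v(1)] flat_in[OF v'(1)]
    define N where "N = K * length c"
    have lens: "length (flat K (map cur c)) = N" "length (flat K v) = N" "length (flat K v') = N"
      using v(2) v'(2) by (simp_all add: N_def)
    have "flat K v = flat K v'"
    proof (cases "\<kappa> (F' c)")
      case None
      then have "flat K v = pad N u0" "flat K v' = pad N u0"
        using v(3) v'(3) LX_None[OF f(1,2) lens(1,2)] LX_None[OF f(1,3) lens(1,3)]
        unfolding ok_iff[OF v(2)] ok_iff[OF v'(2)] by simp_all
      then show ?thesis by simp
    next
      case (Some x)
      obtain u1 v1 where 1: "u1 \<in> L" "v1 \<in> L" "\<nu> v1 = \<nu> u1 \<otimes> x" "length u1 \<le> N"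
        "flat K (map cur c) = pad N u1" "flat K v = pad N v1"
        using v(3) LX_Some[OF f(1,2) lens(1,2), of x] unfolding ok_iff[OF v(2)] Some by blast
      obtain u2 v2 where 2: "u2 \<in> L" "v2 \<in> L" "\<nu> v2 = \<nu> u2 \<otimes> x" "length u2 \<le> N"
        "flat K (map cur c) = pad N u2" "flat K v' = pad N v2"
        using v'(3) LX_Some[OF f(1,3) lens(1,3), of x] unfolding ok_iff[OF v'(2)] Some by blast
      have "u1 = u2" using pad_inj[of N u1 u2] 1 2 by simp
      then have "v1 = v2" using inj[OF 1(2) 2(2)] 1 2 by simp
      then show ?thesis using 1 2 by simp
    qed
    then show ?thesis
      using v(1,2) v'(1,2) unfolding W_def by (intro flat_inj[of K v v' OL]) simp_all
  qed
  have unique: "d = d'" if "c \<in> lists \<Gamma>" "(c, d) \<in> R" "(c, d') \<in> R" for c d d'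
    using that unique_v[OF that(1)] unfolding R_def by blast
  have main: "(\<exists>c. (map (\<lambda>x. (x, 0, E, E)) w, c) \<in> R\<^sup>* \<and> G' c = None) \<longleftrightarrow> word_val G w = \<one>"
    if w: "w \<in> lists X" "w \<noteq> []" for w
  proof -
    define n where "n = length w"
    have n: "0 < n" using w by (simp add: n_def)
    have wc: "take k w \<in> lists (carrier G)" for k
      using w(1) lXc by (auto simp: in_lists_conv_set dest: in_set_takeD)
    define u where "u k = nf (word_val G (take k w))" for k
    have u: "u k \<in> L" "\<nu> (u k) = word_val G (take k w)" for k
      using nf word_val_closed[OF wc[of k]] by (simp_all add: u_def)
    have u_0: "u 0 = u0" by (simp add: u_def u0_def)
    define N where "N = K * n"
    have u_len: "length (u k) \<le> N" if "k \<le> n" for k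
    proof -
      have "take k w \<in> lists X" using w(1) by (auto simp: in_lists_conv_set dest: in_set_takeD)
      then have "word_norm G X (\<nu> (u k)) \<le> length (take k w)" using u(2) by (intro word_norm_le) simp_all
      also have "\<dots> \<le> n" by (simp add: n_def)
      finally have "D * (word_norm G X (\<nu> (u k)) + 1) \<le> D * (n + n)" using n by (intro mult_le_mono2) simp
      also have "\<dots> \<le> N" by (simp add: N_def K_def algebra_simps)
      finally show ?thesis using D[OF u(1)[of k]] by simp
    qed
    have "\<exists>y. length y = n \<and> y \<in> lists W \<and> flat K y = pad N (u k)" for k
      unfolding W_def using u(1)[of k] LL n
      by (intro flat_surj) (auto simp: N_def OL_def intro!: pad_in)
    then obtain y where y: "\<And>k. length (y k) = n" "\<And>k. y k \<in> lists W" "\<And>k. flat K (y k) = pad N (u k)"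
      by metis
    have y_in: "y k ! i \<in> W" if "i < n" for k i using nth_lists[OF y(2)[of k]] y(1) that by simp
    have w_in: "w ! i \<in> X" if "i < n" for i using nth_lists[OF w(1)] that by (simp add: n_def)
    define c0 where "c0 = map (\<lambda>x. (x, 0 :: nat, E, E)) w"
    \<comment> \<open>The configuration after \<open>k\<close> multiplications.\<close>
    define cfg where "cfg k = map (\<lambda>i. (w ! i, if i < k then 2 else 1 :: nat, y 0 ! i, y k ! i)) [0..<n]" for k
    have len: "length c0 = n" "length (cfg k) = n" for k by (simp_all add: c0_def cfg_def n_def)
    have c0_in: "c0 \<in> lists \<Gamma>" using w(1) E by (auto simp: c0_def \<Gamma>_def in_lists_conv_set)
    have cfg_in: "cfg k \<in> lists \<Gamma>" for k
      by (rule in_lists_nth) (simp add: cfg_def \<Gamma>_def w_in y_in)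
    have nth_cfg: "cfg k ! i = (w ! i, if i < k then 2 else 1, y 0 ! i, y k ! i)" if "i < n" for k i
      using that by (simp add: cfg_def)
    have nth_c0: "c0 ! i = (w ! i, 0, E, E)" if "i < n" for i
      using that by (simp add: c0_def n_def)
    have F_take: "F (take i (zip c v)) = F' (take i c)" if "length v = length c" for c v i
    proof -
      have "map fst (take i (zip c v)) = take i c" using that by (simp add: take_zip)
      then show ?thesis by (simp add: F_def)
    qed
    have cur_cfg: "map cur (cfg k) = y k" for k
      by (rule nth_equalityI) (simp_all add: len y(1) nth_cfg cur_def)
    have lens: "length (flat K (y k)) = N" for k by (simp add: y(1) N_def)
    have find_st: "find (\<lambda>a. st a \<noteq> 2) (take i (cfg k)) = None \<longleftrightarrow> i \<le> k" if "i \<le> n" "k \<le> n" for i k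
    proof -
      have "(\<forall>j<i. \<not> st (cfg k ! j) \<noteq> 2) \<longleftrightarrow> (\<forall>j<i. j < k)"
        using that by (auto simp: nth_cfg st_def)
      also have "\<dots> \<longleftrightarrow> i \<le> k" by (meson leI less_le_trans order_less_irrefl)
      finally show ?thesis using that unfolding find_None_iff_nth by (simp add: len)
    qed
    have first: "find (\<lambda>_. True) c = Some (c ! 0)" if "length c = n"
      for c :: "'a work_cell list"
      using that n by (cases c) simp_all
    have init: "(c0, cfg 0) \<in> R"
    proof -
      have l: "length (y 0) = length c0" by (simp add: len y(1))
      have "find (\<lambda>a. st a \<noteq> 2) c0 \<noteq> None"
        unfolding find_None_iff_nth using n by (auto simp: len nth_c0 st_def)
      moreover have "\<kappa> (F' c0) = None" using first[OF len(1)] n by (simp add: \<kappa>_def F'_def nth_c0 st_def)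
      moreover have "map cur c0 = replicate n E"
        by (rule nth_equalityI) (simp_all add: len nth_c0 cur_def)
      then have "map cur c0 \<in> lists W" using E by (simp add: in_lists_conv_set)
      then have f: "flat K (map cur c0) \<in> lists OL" by (rule flat_in)
      have lf: "length (flat K (map cur c0)) = N" by (simp add: len N_def)
      have "zip (flat K (map cur c0)) (flat K (y 0)) \<in> LX None"
        unfolding LX_None[OF f flat_in[OF y(2)[of 0]] lf lens[of 0]]
        using u_len[of 0] u_0 y(3)[of 0] by simp
      ultimately have "ok (zip c0 (y 0))" unfolding ok_iff[OF l] by (simp add: F'_def)
      moreover have "sweep upd F (zip c0 (y 0)) = cfg 0"
      proof (rule nth_equalityI)
        fix i assume "i < length (sweep upd F (zip c0 (y 0)))"
        then have "i < n" "i < length (zip c0 (y 0))" by (simp_all add: len y(1))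
        then show "sweep upd F (zip c0 (y 0)) ! i = cfg 0 ! i"
          by (simp add: nth_sweep upd_def nth_c0 nth_cfg len y(1))
      qed (simp add: len y(1))
      ultimately show ?thesis unfolding R_def using y(2)[of 0] l
        by (intro CollectI exI[of _ c0] exI[of _ "y 0"] conjI) simp_all
    qed
    have step: "(cfg k, cfg (Suc k)) \<in> R" if k: "k < n" for k
    proof -
      have l: "length (y (Suc k)) = length (cfg k)" by (simp add: len y(1))
      have fk: "find (\<lambda>a. st a \<noteq> 2) (cfg k) = Some (cfg k ! k)"
        unfolding find_Some_iff using k by (intro exI[of _ k]) (simp add: len nth_cfg st_def)
      then have "\<kappa> (F' (cfg k)) = Some (w ! k)"
        using first[OF len(2)] n k by (simp add: \<kappa>_def F'_def nth_cfg st_def)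
      moreover have "zip (flat K (y k)) (flat K (y (Suc k))) \<in> LX (Some (w ! k))"
      proof -
        have "take (Suc k) w = take k w @ [w ! k]" using k by (simp add: n_def take_Suc_conv_app_nth)
        moreover have "w ! k \<in> carrier G" using w_in[OF k] Xc by blast
        ultimately have "word_val G (take (Suc k) w) = word_val G (take k w) \<otimes> (w ! k)"
          using word_val_append[OF wc[of k], of "[w ! k]"] by simp
        then have "\<nu> (u (Suc k)) = \<nu> (u k) \<otimes> (w ! k)" by (simp add: u(2))
        then show ?thesis
          unfolding LX_Some[OF flat_in[OF y(2)] flat_in[OF y(2)] lens lens]
          using u(1) u_len[of k] u_len[of "Suc k"] k y(3) by (intro exI[of _ "u k"] exI[of _ "u (Suc k)"]) simp
      qed
      ultimately have "ok (zip (cfg k) (y (Suc k)))"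
        unfolding ok_iff[OF l] using fk by (simp add: cur_cfg F'_def)
      moreover have "sweep upd F (zip (cfg k) (y (Suc k))) = cfg (Suc k)"
      proof (rule nth_equalityI)
        fix i assume "i < length (sweep upd F (zip (cfg k) (y (Suc k))))"
        then have i: "i < n" "i < length (zip (cfg k) (y (Suc k)))" by (simp_all add: len y(1))
        have "snd (F (take i (zip (cfg k) (y (Suc k))))) = None \<longleftrightarrow> i \<le> k"
          unfolding F_take[OF l] using find_st[of i k] i k by (simp add: F'_def)
        then show "sweep upd F (zip (cfg k) (y (Suc k))) ! i = cfg (Suc k) ! i"
          using i by (simp add: nth_sweep upd_def nth_cfg len y(1))
      qed (simp add: len y(1))
      ultimately show ?thesis unfolding R_def using y(2)[of "Suc k"] l
        by (intro CollectI exI[of _ "cfg k"] exI[of _ "y (Suc k)"] conjI) simp_all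
    qed
    have stuck: "(cfg n, d) \<notin> R" for d
    proof
      assume "(cfg n, d) \<in> R"
      then obtain v where "length v = length (cfg n)" "ok (zip (cfg n) v)" unfolding R_def by blast
      then have "snd (F' (cfg n)) \<noteq> None" using ok_iff by blast
      moreover have "snd (F' (cfg n)) = None" using find_st[of n n] by (simp add: F'_def len)
      ultimately show False by simp
    qed
    have reach: "c = c0 \<or> (\<exists>k\<le>n. c = cfg k)" if "(c0, c) \<in> R\<^sup>*" for c
      using that
    proof (induction rule: rtrancl_induct)
      case (step c d)
      from step.IH show ?case
      proof
        assume "c = c0"
        then have "d = cfg 0" using unique[OF c0_in _ init] step.hyps(2) by blast
        then show ?thesis by blast
      next
        assume "\<exists>k\<le>n. c = cfg k"
        then obtain k where k: "k \<le> n" "c = cfg k" by blast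
        then have "k < n" using stuck step.hyps(2) by (cases "k = n") auto
        then have "d = cfg (Suc k)" using unique[OF cfg_in _ \<open>\<And>k. k < n \<Longrightarrow> (cfg k, cfg (Suc k)) \<in> R\<close>] step.hyps(2) k(2) by blast
        then show ?thesis using \<open>k < n\<close> by (intro disjI2 exI[of _ "Suc k"]) simp
      qed
    qed simp
    have run: "(c0, cfg k) \<in> R\<^sup>*" if "k \<le> n" for k
      using that
    proof (induction k)
      case 0 show ?case using init by blast
    next
      case (Suc k) then show ?case using step[of k] by (meson Suc_le_lessD less_imp_le rtrancl.rtrancl_into_rtrancl)
    qed
    have G_c0: "G' c0 \<noteq> None" unfolding G'_def find_None_iff_nth using n by (auto simp: len nth_c0 st_def)
    have G_cfg: "G' (cfg k) \<noteq> None" if "k < n" for k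
      unfolding G'_def find_None_iff_nth using that by (auto simp: len nth_cfg st_def intro!: exI[of _ k])
    have "G' (cfg n) = None \<longleftrightarrow> (\<forall>i<n. y 0 ! i = y n ! i)"
      unfolding G'_def find_None_iff_nth by (auto simp: len nth_cfg st_def cur_def)
    also have "\<dots> \<longleftrightarrow> y 0 = y n" using y(1) by (auto simp: list_eq_iff_nth_eq)
    also have "\<dots> \<longleftrightarrow> word_val G w = \<one>"
    proof
      assume "y 0 = y n"
      then have "pad N (u 0) = pad N (u n)" using y(3) by metis
      then have "u 0 = u n" using pad_inj u_len by blast
      then have "\<nu> (u 0) = \<nu> (u n)" by simp
      then show "word_val G w = \<one>" unfolding u(2) by (simp add: n_def)
    next
      assume "word_val G w = \<one>"
      then have "u 0 = u n" by (simp add: u_def n_def)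
      then have "flat K (y 0) = flat K (y n)" using y(3) by simp
      then show "y 0 = y n" using flat_inj[of K "y 0" "y n" OL] y(1,2) by (simp add: W_def)
    qed
    finally have "G' (cfg n) = None \<longleftrightarrow> word_val G w = \<one>" .
    moreover have "(\<exists>c. (c0, c) \<in> R\<^sup>* \<and> G' c = None) \<longleftrightarrow> G' (cfg n) = None"
    proof
      assume "\<exists>c. (c0, c) \<in> R\<^sup>* \<and> G' c = None"
      then obtain c where "(c0, c) \<in> R\<^sup>*" "G' c = None" by blast
      then show "G' (cfg n) = None" using reach[of c] G_c0 G_cfg by (metis le_neq_implies_less)
    qed (use run in blast)
    ultimately show ?thesis unfolding c0_def by simp
  qed
  have "{w \<in> lists X. word_val G w = \<one>} = {w \<in> lists X. if w = [] then True
      else \<exists>c. (map (\<lambda>x. (x, 0, E, E)) w, c) \<in> R\<^sup>* \<and> G' c = None}"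
    by (intro Collect_cong conj_cong refl) (simp add: main)
  also have "dcs X \<dots>"
    unfolding R_def ok_def
  proof (rule dcs_if_search[where \<Gamma> = \<Gamma> and V = W and I = "insert None (Some ` X)" and \<Delta> = CA and L = LX
        and \<kappa> = \<kappa> and F = F and G = G' and A = "\<lambda>g. g = None" and \<Theta> = \<Theta> and \<rho> = \<rho> and K = K and upd = upd])
    show "finite X" "finite \<Gamma>" "finite (insert None (Some ` X))" "finite W" "W \<noteq> {}" "0 < K"
      using finX finW E by (auto simp: \<Gamma>_def K_def)
    show "(\<lambda>x. (x, 0, E, E)) ` X \<subseteq> \<Gamma>" using E by (auto simp: \<Gamma>_def)
    have fin\<Gamma>: "finite \<Gamma>" using finX finW by (simp add: \<Gamma>_def)
    show "recognizable \<Gamma> G'" unfolding G'_def by (rule recognizable_find[OF fin\<Gamma>])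
    have "recognizable \<Gamma> F'" unfolding F'_def by (intro recognizable_Pair recognizable_find[OF fin\<Gamma>])
    then show "recognizable (\<Gamma> \<times> W) F" unfolding F_def by (rule recognizable_map) auto
    show "dcs CA (LX k)" if "k \<in> insert None (Some ` X)" for k by (rule LX_dcs[OF that])
    show "\<kappa> (F z) \<in> insert None (Some ` X)" if z: "z \<in> lists (\<Gamma> \<times> W)" for z
    proof -
      have "fst a \<in> X" if "a \<in> set (map fst z)" for a
        using that z by (auto simp: \<Gamma>_def in_lists_conv_set)
      then have "find P (map fst z) = Some a \<Longrightarrow> fst a \<in> X" for P a using find_in_set by metis
      then show ?thesis by (auto simp: \<kappa>_def F_def F'_def split: option.splits)
    qed
    show "\<rho> f a j \<in> CA" if "a \<in> \<Gamma> \<times> W" "j < K" for f a j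
      using that by (auto simp: \<rho>_def CA \<Gamma>_def cur_def W_def)
    show "sweep upd F z \<in> lists \<Gamma>" if z: "z \<in> lists (\<Gamma> \<times> W)" for z
    proof (rule in_lists_nth)
      fix i assume "i < length (sweep upd F z)"
      then have "z ! i \<in> \<Gamma> \<times> W" "i < length z" using nth_lists[OF z, of i] by simp_all
      then show "sweep upd F z ! i \<in> \<Gamma>"
        by (cases "z ! i") (auto simp: nth_sweep upd_def \<Gamma>_def)
    qed
    show "d = d'" if "c \<in> lists \<Gamma>"
      "(c, d) \<in> {(c, sweep upd F (zip c v)) |c v. v \<in> lists W \<and> length v = length c \<and>
          \<Theta> (F (zip c v)) (snake K \<rho> (zip c v) \<in> LX (\<kappa> (F (zip c v))))}"
      "(c, d') \<in> {(c, sweep upd F (zip c v)) |c v. v \<in> lists W \<and> length v = length c \<and>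
          \<Theta> (F (zip c v)) (snake K \<rho> (zip c v) \<in> LX (\<kappa> (F (zip c v))))}" for c d d'
      using unique[OF that(1)] that(2,3) unfolding R_def ok_def by blast
  qed
  finally have "dcs X {w \<in> lists X. word_val G w = \<one>}" .
  then have "dcs_word_problem G X" using X by (simp add: dcs_word_problem_def)
  then show ?thesis unfolding dcs_word_problem_group_def by blast
qed

end

section \<open>The three classes coincide\<close>

theorem theorem4p4:
  fixes G :: "('g, 'm) monoid_scheme"
  assumes "group G"
  shows "(quasigeodesic_dcs_graph_automatic_group G \<longleftrightarrow> shortlex_dcs_biautomatic_group G) \<and>
         (shortlex_dcs_biautomatic_group G \<longleftrightarrow> dcs_word_problem_group G)"
  using group.graph_automatic_if_shortlex_biautomatic[OF assms]
    group.word_problem_if_graph_automatic[OF assms]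
    group.shortlex_biautomatic_if_word_problem[OF assms] by blast

end
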